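(* Let $\mathcal X$ be a projective, geometrically irreducible, nonsingular curve of genus $g$ over $\mathbf F_q$. Let $D=P_1+\dots+P_n$ be a sum of $n$ pairwise distinct $\mathbf F_q$-rational points of $\mathcal X$, and let $G$ be an $\mathbf F_q$-rational divisor with $P_i\notin\operatorname{supp}(G)$ for all $i$. Let $\mathcal C=\mathcal C(\mathcal X,D,G)$ have dimension $k$, and assume $2k\le n$ and $n>2g$. Let $\gamma_2$ be the gonality of $\mathcal X$ over $\mathbf F_q$. Then $$s[\mathcal C]\ge w(\mathcal C)-g+\gamma_2-2.$$
   Context: $\ell(F)=\dim_{\mathbf F_q}\mathcal L(F)$, where $\mathcal L(F)$ is the space of rational functions $f$ over $\mathbf F_q$ with $f=0$ or $F+\operatorname{div}(f)\succeq0$. The code $\mathcal C(\mathcal X,D,G)$ is the image of $\mathcal L(G)\to\mathbf F_q^n$, $f\mapsto(f(P_1),\dots,f(P_n))$. The gonality over $\mathbf F_q$ is $\gamma_2=\min\{\deg A: A\ \mathbf F_q\text{-rational divisor},\ \ell(A)\ge2\}$. For a linear $[n,k]$ code $\mathcal C$ with fixed coordinate order, define $\mathcal P_0=\mathcal F_n=0$, $\mathcal P_n=\mathcal F_0=\mathcal C$, and for $1\le i\le n-1$, $\mathcal P_i=\{(c_1,\dots,c_i):(c_1,\dots,c_i,0,\dots,0)\in\mathcal C\}$ and $\mathcal F_i=\{(c_{i+1},\dots,c_n):(0,\dots,0,c_{i+1},\dots,c_n)\in\mathcal C\}$. Put $\Delta_i=\dim\mathcal P_i+\dim\mathcal F_i$.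 The state complexity (of the minimal trellis) is $s(\mathcal C)=k-\min_{0\le i\le n}\Delta_i$. Further, $s[\mathcal C]$ is the minimum of $s(\mathcal C')$ over all codes $\mathcal C'$ obtained from $\mathcal C$ by permuting coordinates, and $w(\mathcal C)=\min\{k,n-k\}$. *)

theory Defs
  imports Main "HOL-Combinatorics.Permutations"
begin

text \<open>Algebraic function fields of one variable over a finite field F (the whole
type 'k plays the role of the function field K = F_q(X)).  Points of the curve are
the places of K/F, represented by their valuation rings.\<close>

definition subfield :: "'k::field set \<Rightarrow> bool" where
  "subfield F \<longleftrightarrow> 0 \<in> F \<and> 1 \<in> F \<and>
     (\<forall>a\<in>F. \<forall>b\<in>F. a + b \<in> F \<and> a * b \<in> F) \<and>
     (\<forall>a\<in>F. - a \<in> F \<and> inverse a \<in> F)"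

definition alg_over :: "'k::field set \<Rightarrow> 'k \<Rightarrow> bool" where
  "alg_over F y \<longleftrightarrow> (\<exists>(c::nat \<Rightarrow> 'k) n. (\<forall>i\<le>n. c i \<in> F) \<and> (\<exists>i\<le>n. c i \<noteq> 0) \<and>
       (\<Sum>i\<le>n. c i * y ^ i) = 0)"

definition polys_in :: "'k::field set \<Rightarrow> 'k \<Rightarrow> 'k set" where
  "polys_in F x = {(\<Sum>i<n. c i * x ^ i) | (c::nat \<Rightarrow> 'k) n. \<forall>i. c i \<in> F}"

definition ratfuns :: "'k::field set \<Rightarrow> 'k \<Rightarrow> 'k set" where
  "ratfuns F x = {a / b | a b. a \<in> polys_in F x \<and> b \<in> polys_in F x \<and> b \<noteq> 0}"

definition kspan :: "'k::field set \<Rightarrow> 'k set \<Rightarrow> 'k set" where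
  "kspan L B = {(\<Sum>b\<in>B. c b * b) | c. \<forall>b\<in>B. c b \<in> L}"

definition kdim :: "'k::field set \<Rightarrow> 'k set \<Rightarrow> nat" where
  "kdim F V = (LEAST d. \<exists>B. finite B \<and> B \<subseteq> V \<and> card B = d \<and> V \<subseteq> kspan F B)"

text \<open>K is an algebraic function field of one variable over F with full constant field F
 (i.e. K is the function field of a projective, nonsingular, geometrically irreducible
 curve over F).\<close>
definition function_field :: "'k::field set \<Rightarrow> bool" where
  "function_field F \<longleftrightarrow> subfield F \<and>
     (\<exists>x. \<not> alg_over F x \<and> (\<exists>B. finite B \<and> (UNIV::'k set) \<subseteq> kspan (ratfuns F x) B)) \<and>
     (\<forall>y. alg_over F y \<longrightarrow> y \<in> F)"

definition place :: "'k::field set \<Rightarrow> 'k set \<Rightarrow> bool" where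
  "place F R \<longleftrightarrow> F \<subseteq> R \<and> R \<noteq> UNIV \<and>
     (\<forall>a\<in>R. \<forall>b\<in>R. a + b \<in> R \<and> a * b \<in> R \<and> - a \<in> R) \<and>
     (\<forall>z. z \<in> R \<or> inverse z \<in> R)"

definition maxid :: "'k::field set \<Rightarrow> 'k set" where
  "maxid R = {z \<in> R. z = 0 \<or> inverse z \<notin> R}"

definition uniformizer :: "'k::field set \<Rightarrow> 'k \<Rightarrow> bool" where
  "uniformizer R t \<longleftrightarrow> t \<in> R \<and> maxid R = {t * y | y. y \<in> R}"

text \<open>Normalized discrete valuation v_O (for z \<noteq> 0).\<close>
definition val :: "'k::field set \<Rightarrow> 'k \<Rightarrow> int" where
  "val R z = (THE m. \<exists>u. u \<in> R \<and> u \<noteq> 0 \<and> inverse u \<in> R \<and>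
                     z = (SOME t. uniformizer R t) powi m * u)"

definition pdeg :: "'k::field set \<Rightarrow> 'k set \<Rightarrow> nat" where
  "pdeg F R = (LEAST d. \<exists>B. finite B \<and> B \<subseteq> R \<and> card B = d \<and>
       (\<forall>z\<in>R. \<exists>c. (\<forall>b\<in>B. c b \<in> F) \<and> z - (\<Sum>b\<in>B. c b * b) \<in> maxid R))"

definition rational_place :: "'k::field set \<Rightarrow> 'k set \<Rightarrow> bool" where
  "rational_place F R \<longleftrightarrow> place F R \<and> pdeg F R = 1"

text \<open>Value f(P) \<in> F of a function f regular at a rational place P.\<close>
definition evalp :: "'k::field set \<Rightarrow> 'k set \<Rightarrow> 'k \<Rightarrow> 'k" where
  "evalp F R f = (THE c. c \<in> F \<and> f - c \<in> maxid R)"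

text \<open>Divisors (all divisors of K/F, i.e. F_q-rational divisors of the curve).\<close>
definition divisor :: "'k::field set \<Rightarrow> ('k set \<Rightarrow> int) \<Rightarrow> bool" where
  "divisor F A \<longleftrightarrow> finite {R. A R \<noteq> 0} \<and> (\<forall>R. A R \<noteq> 0 \<longrightarrow> place F R)"

definition ddeg :: "'k::field set \<Rightarrow> ('k set \<Rightarrow> int) \<Rightarrow> int" where
  "ddeg F A = (\<Sum>R\<in>{R. A R \<noteq> 0}. A R * int (pdeg F R))"

definition LL :: "'k::field set \<Rightarrow> ('k set \<Rightarrow> int) \<Rightarrow> 'k set" where
  "LL F A = {f. f = 0 \<or> (\<forall>R. place F R \<longrightarrow> A R + val R f \<ge> 0)}"

definition ell :: "'k::field set \<Rightarrow> ('k set \<Rightarrow> int) \<Rightarrow> nat" where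
  "ell F A = kdim F (LL F A)"

text \<open>Genus (Riemann's definition): g = max over divisors A of deg A - \<ell>(A) + 1.\<close>
definition is_genus :: "'k::field set \<Rightarrow> nat \<Rightarrow> bool" where
  "is_genus F g \<longleftrightarrow> (\<forall>A. divisor F A \<longrightarrow> ddeg F A - int (ell F A) + 1 \<le> int g) \<and>
     (\<exists>A. divisor F A \<and> ddeg F A - int (ell F A) + 1 = int g)"

definition gonality :: "'k::field set \<Rightarrow> int" where
  "gonality F = (LEAST d. \<exists>A. divisor F A \<and> ell F A \<ge> 2 \<and> ddeg F A = d)"

text \<open>Codes: words of length n are functions nat \<Rightarrow> 'k, zero outside {0..<n}
 (coordinates 1..n of the paper are indices 0..n-1).\<close>
definition vspan :: "'k::field set \<Rightarrow> (nat \<Rightarrow> 'k) set \<Rightarrow> (nat \<Rightarrow> 'k) set" where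
  "vspan F B = {(\<lambda>j. \<Sum>b\<in>B. c b * b j) | c. \<forall>b\<in>B. c b \<in> F}"

definition vdim :: "'k::field set \<Rightarrow> (nat \<Rightarrow> 'k) set \<Rightarrow> nat" where
  "vdim F V = (LEAST d. \<exists>B. finite B \<and> B \<subseteq> V \<and> card B = d \<and> V \<subseteq> vspan F B)"

definition AG_code :: "'k::field set \<Rightarrow> nat \<Rightarrow> (nat \<Rightarrow> 'k set) \<Rightarrow> ('k set \<Rightarrow> int) \<Rightarrow> (nat \<Rightarrow> 'k) set" where
  "AG_code F n Ps G = {(\<lambda>i. if i < n then evalp F (Ps i) f else 0) | f. f \<in> LL F G}"

definition past :: "nat \<Rightarrow> (nat \<Rightarrow> 'k::field) set \<Rightarrow> nat \<Rightarrow> (nat \<Rightarrow> 'k) set" where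
  "past n C i = {(\<lambda>j. if j < i then c j else 0) | c. c \<in> C \<and> (\<forall>j. i \<le> j \<and> j < n \<longrightarrow> c j = 0)}"

definition future :: "nat \<Rightarrow> (nat \<Rightarrow> 'k::field) set \<Rightarrow> nat \<Rightarrow> (nat \<Rightarrow> 'k) set" where
  "future n C i = {(\<lambda>j. if j < n - i then c (j + i) else 0) | c. c \<in> C \<and> (\<forall>j<i. c j = 0)}"

definition state_cplx :: "'k::field set \<Rightarrow> nat \<Rightarrow> (nat \<Rightarrow> 'k) set \<Rightarrow> nat" where
  "state_cplx F n C = vdim F C - Min {vdim F (past n C i) + vdim F (future n C i) | i. i \<le> n}"

definition perm_code :: "(nat \<Rightarrow> nat) \<Rightarrow> (nat \<Rightarrow> 'k) set \<Rightarrow> (nat \<Rightarrow> 'k) set" where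
  "perm_code \<sigma> C = (\<lambda>c. c \<circ> \<sigma>) ` C"

definition min_state_cplx :: "'k::field set \<Rightarrow> nat \<Rightarrow> (nat \<Rightarrow> 'k) set \<Rightarrow> nat" where
  "min_state_cplx F n C = Min {state_cplx F n (perm_code \<sigma> C) | \<sigma>. \<sigma> permutes {..<n}}"

end

theory Submission
  imports Defs "HOL-Library.FuncSet" "HOL-Library.Function_Algebras" "HOL-Computational_Algebra.Polynomial"
begin

text \<open>
  Let \<open>\<gamma>\<close> be the gonality. If \<open>2 k \<le> n\<close> and \<open>n > 2 g\<close>, Riemann's inequality forces \<open>\<L>(G - D) = 0\<close>, so
  past and future subcodes are the spaces \<open>\<L>(G - D')\<close> for partial sums \<open>D'\<close> of the points. Cutting where
  the future divisor has degree \<open>\<gamma> - 1\<close> makes the future at most one-dimensional, and leaves a past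
  divisor \<open>B\<close> of degree at most \<open>2 g - 1 - \<gamma>\<close>, for which \<open>\<ell>(B) \<le> g - \<gamma> + 1\<close> is needed. After raising
  the degree to exactly \<open>2 g - 1 - \<gamma>\<close> this says that the index of speciality of \<open>B\<close> is at most one. Otherwise two
  independent Weil differentials vanish on \<open>B\<close>; their quotient is a nonconstant function \<open>\<phi>\<close>, and one of
  them already vanishes on \<open>B\<close> plus the polar divisor of \<open>\<phi>\<close>, which has degree at least \<open>2 g - 1\<close>. But a
  nonzero differential vanishing on \<open>E\<close> embeds \<open>\<L>(E)\<close> into the \<open>g\<close>-dimensional space of regular
  differentials, whence \<open>deg E \<le> 2 g - 2\<close>.

  As \<open>F\<close> is finite, dimensions are compared by counting elements, and linear dependence is produced by
  the pigeonhole principle.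
\<close>

section \<open>Dimension as a logarithm of cardinality\<close>

text \<open>The constants come from balancing the two halves of the cut. Put m = deg G. Riemann's
  inequality and the vanishing of the kernel of evaluation give m + 1 - g \<le> k, so 2 k \<le> n
  bounds the degree 2 m - n - \<gamma> + 1 of the past divisor by 2 g - 1 - \<gamma>. This is the
  least degree d with d + \<gamma> > 2 g - 2, the point from which two independent differentials are
  impossible. The past contributes at most g - \<gamma> + 1 and the future at most 1. Differentials
  enter through one dimension count: the adeles modulo \<open>adl A\<close> and the function field
  have dimension \<open>spec A\<close>, so \<open>spec A\<close> \<ge> 2 yields two independent
  functionals. The main obstacle lies earlier. Places are bare valuation rings, and the field is
  known only to be finite over F(x). Discreteness, finite residue degree and finiteness of zeros all
  have to be derived, and all three follow from one statement: for each t \<noteq> 0 there is an N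
  such that any N + 1 functions satisfy a linear relation over F[t] whose coefficients are not all
  divisible by t. Since n > 2 g there is a rational place, so degrees can be moved in steps of
  one.\<close>

locale finite_subfield =
  fixes F :: "'k::field set"
  assumes finite_F: "finite F" and subfield_F: "subfield F"
begin

lemma F_0 [simp]: "0 \<in> F" and F_1 [simp]: "1 \<in> F"
  and F_add [simp]: "a \<in> F \<Longrightarrow> b \<in> F \<Longrightarrow> a + b \<in> F"
  and F_mult [simp]: "a \<in> F \<Longrightarrow> b \<in> F \<Longrightarrow> a * b \<in> F"
  and F_uminus [simp]: "a \<in> F \<Longrightarrow> - a \<in> F"
  and F_inverse [simp]: "a \<in> F \<Longrightarrow> inverse a \<in> F"
  using subfield_F unfolding subfield_def by auto

lemma F_diff [simp]: "a \<in> F \<Longrightarrow> b \<in> F \<Longrightarrow> a - b \<in> F"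
  using F_add[of a "-b"] by simp

lemma F_divide [simp]: "a \<in> F \<Longrightarrow> b \<in> F \<Longrightarrow> a / b \<in> F"
  by (simp add: divide_inverse)

lemma F_sum [simp]: "(\<And>i. i \<in> I \<Longrightarrow> f i \<in> F) \<Longrightarrow> sum f I \<in> F"
  by (induction I rule: infinite_finite_induct) auto

abbreviation q :: nat where "q \<equiv> card F"

lemma q_ge_2: "q \<ge> 2"
proof -
  have "card {0, 1 :: 'k} \<le> q" by (rule card_mono[OF finite_F]) simp
  then show ?thesis by simp
qed

lemma q_power_le_iff [simp]: "q ^ a \<le> q ^ b \<longleftrightarrow> a \<le> b"
  and q_power_less_iff [simp]: "q ^ a < q ^ b \<longleftrightarrow> a < b"
  and q_power_inject [simp]: "q ^ a = q ^ b \<longleftrightarrow> a = b"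
  using q_ge_2 by auto

text \<open>The scaling \<open>s\<close> will come from a module over all of \<open>'k\<close>, but
  closure is asked for scalars in \<open>F\<close> only. With \<open>s\<close> as a parameter, one
  notion serves functions, words and adeles.\<close>

definition fsubspace :: "('k \<Rightarrow> 'v \<Rightarrow> 'v) \<Rightarrow> 'v::ab_group_add set \<Rightarrow> bool" where
  "fsubspace s V \<longleftrightarrow> 0 \<in> V \<and> (\<forall>x\<in>V. \<forall>y\<in>V. x + y \<in> V) \<and> (\<forall>a\<in>F. \<forall>x\<in>V. s a x \<in> V)"

lemma fsubspaceD:
  assumes "fsubspace s V"
  shows "0 \<in> V" "x \<in> V \<Longrightarrow> y \<in> V \<Longrightarrow> x + y \<in> V" "a \<in> F \<Longrightarrow> x \<in> V \<Longrightarrow> s a x \<in> V"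
  using assms unfolding fsubspace_def by auto

lemma fsubspace_sum:
  assumes "fsubspace s V" "\<And>i. i \<in> I \<Longrightarrow> f i \<in> V"
  shows "sum f I \<in> V"
  using assms(2) by (induction I rule: infinite_finite_induct) (auto simp: fsubspaceD[OF assms(1)])

lemma fsubspace_diff:
  assumes "module s" "fsubspace s V" "x \<in> V" "y \<in> V"
  shows "x - y \<in> V"
proof -
  interpret module s by fact
  have "s (-1) y \<in> V" using fsubspaceD(3)[OF assms(2), of "-1" y] assms(4) by simp
  then have "x + s (-1) y \<in> V" using fsubspaceD(2)[OF assms(2)] assms(3) by blast
  then show ?thesis by simp
qed

text \<open>A relation modulo \<open>N\<close> with a nonzero coefficient would allow one element of
  a minimal spanning set to be dropped. \<open>N = {0}\<close> serves \<open>kdim\<close> and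
  \<open>vdim\<close>; \<open>N = maxid R\<close> serves \<open>pdeg\<close>.\<close>

lemma Least_dimension_basis:
  fixes s :: "'k \<Rightarrow> 'v \<Rightarrow> 'v::ab_group_add"
  assumes m: "module s" and N: "fsubspace s N"
    and ex: "\<exists>B. finite B \<and> B \<subseteq> V \<and> (\<forall>z\<in>V. \<exists>c. (\<forall>b\<in>B. c b \<in> F) \<and> z - (\<Sum>b\<in>B. s (c b) b) \<in> N)"
  defines "D \<equiv> LEAST d. \<exists>B. finite B \<and> B \<subseteq> V \<and> card B = d \<and>
     (\<forall>z\<in>V. \<exists>c. (\<forall>b\<in>B. c b \<in> F) \<and> z - (\<Sum>b\<in>B. s (c b) b) \<in> N)"
  obtains B where "finite B" "B \<subseteq> V" "card B = D"
    "\<And>z. z \<in> V \<Longrightarrow> \<exists>c. (\<forall>b\<in>B. c b \<in> F) \<and> z - (\<Sum>b\<in>B. s (c b) b) \<in> N"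
    "\<And>c b. (\<And>b. b \<in> B \<Longrightarrow> c b \<in> F) \<Longrightarrow> (\<Sum>b\<in>B. s (c b) b) \<in> N \<Longrightarrow> b \<in> B \<Longrightarrow> c b = 0"
proof -
  interpret module s by fact
  define P where "P B \<longleftrightarrow> finite B \<and> B \<subseteq> V \<and> (\<forall>z\<in>V. \<exists>c. (\<forall>b\<in>B. c b \<in> F) \<and> z - (\<Sum>b\<in>B. s (c b) b) \<in> N)" for B
  have D: "D = (LEAST d. \<exists>B. P B \<and> card B = d)"
    unfolding D_def P_def by (intro arg_cong[where f=Least] ext) auto
  have "\<exists>d B. P B \<and> card B = d" using ex unfolding P_def by auto
  then have "\<exists>B. P B \<and> card B = D" unfolding D by (rule LeastI_ex)
  then obtain B where B: "P B" "card B = D" by auto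
  have le: "D \<le> card B'" if "P B'" for B' unfolding D by (rule Least_le) (use that in auto)
  have fB: "finite B" and BV: "B \<subseteq> V" using B unfolding P_def by auto
  have ind: "c b0 = 0" if c: "\<And>b. b \<in> B \<Longrightarrow> c b \<in> F" and cN: "(\<Sum>b\<in>B. s (c b) b) \<in> N" and b0: "b0 \<in> B" for c b0
  proof (rule ccontr)
    assume nz: "c b0 \<noteq> 0"
    have "P (B - {b0})" unfolding P_def
    proof (intro conjI ballI)
      show "finite (B - {b0})" "B - {b0} \<subseteq> V" using fB BV by auto
      fix z assume z: "z \<in> V"
      then obtain d where d: "\<forall>b\<in>B. d b \<in> F" "z - (\<Sum>b\<in>B. s (d b) b) \<in> N"
        using B unfolding P_def by blast
      \<comment> \<open>Subtracting \<open>e\<close> times the relation kills the coefficient of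
        \<open>b0\<close>.\<close>
      define e where "e = d b0 / c b0"
      have eF: "e \<in> F" using d c b0 unfolding e_def by simp
      have "(\<Sum>b\<in>B - {b0}. s (d b - e * c b) b) = (\<Sum>b\<in>B. s (d b - e * c b) b)"
        by (rule sum.mono_neutral_left) (use fB nz in \<open>auto simp: e_def\<close>)
      also have "\<dots> = (\<Sum>b\<in>B. s (d b) b) - s e (\<Sum>b\<in>B. s (c b) b)"
        by (simp add: scale_left_diff_distrib sum_subtractf scale_sum_right)
      finally have "z - (\<Sum>b\<in>B - {b0}. s (d b - e * c b) b) = (z - (\<Sum>b\<in>B. s (d b) b)) + s e (\<Sum>b\<in>B. s (c b) b)"
        by simp
      also have "\<dots> \<in> N" using fsubspaceD(2,3)[OF N] d(2) cN eF by blast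
      finally show "\<exists>c. (\<forall>b\<in>B - {b0}. c b \<in> F) \<and> z - (\<Sum>b\<in>B - {b0}. s (c b) b) \<in> N"
        using d c eF by (intro exI[of _ "\<lambda>b. d b - e * c b"]) auto
    qed
    from le[OF this] B(2) fB b0 show False
      by (metis card_Diff1_less not_le)
  qed
  show ?thesis
    by (rule that[of B]) (use B ind fB BV in \<open>auto simp: P_def\<close>)
qed

text \<open>Coordinates in a minimal basis identify \<open>V\<close> with the functions from that
  basis to \<open>F\<close>. Finiteness of \<open>V\<close> makes the \<open>LEAST\<close>
  meaningful: \<open>V\<close> then spans itself.\<close>

lemma card_eq_power_dimension:
  fixes s :: "'k \<Rightarrow> 'v \<Rightarrow> 'v::ab_group_add"
  assumes m: "module s" and V: "fsubspace s V" "finite V"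
  shows "card V = q ^ (LEAST d. \<exists>B. finite B \<and> B \<subseteq> V \<and> card B = d \<and>
     (\<forall>z\<in>V. \<exists>c. (\<forall>b\<in>B. c b \<in> F) \<and> z = (\<Sum>b\<in>B. s (c b) b)))"
proof -
  interpret module s by fact
  have N: "fsubspace s {0}" by (simp add: fsubspace_def)
  have "\<exists>c. (\<forall>b\<in>V. c b \<in> F) \<and> z - (\<Sum>b\<in>V. s (c b) b) \<in> {0}" if "z \<in> V" for z
  proof -
    have "(\<Sum>b\<in>V. s (if b = z then 1 else 0) b) = (\<Sum>b\<in>V. if b = z then b else 0)"
      by (rule sum.cong) auto
    also have "\<dots> = z" using V(2) that by simp
    finally show ?thesis by (intro exI[of _ "\<lambda>b. if b = z then 1 else 0"]) auto
  qed
  then have ex: "\<exists>B. finite B \<and> B \<subseteq> V \<and> (\<forall>z\<in>V. \<exists>c. (\<forall>b\<in>B. c b \<in> F) \<and> z - (\<Sum>b\<in>B. s (c b) b) \<in> {0})"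
    using V(2) by (intro exI[of _ V]) auto
  obtain B where B: "finite B" "B \<subseteq> V" "card B = (LEAST d. \<exists>B. finite B \<and> B \<subseteq> V \<and> card B = d \<and>
     (\<forall>z\<in>V. \<exists>c. (\<forall>b\<in>B. c b \<in> F) \<and> z - (\<Sum>b\<in>B. s (c b) b) \<in> {0}))"
    "\<And>z. z \<in> V \<Longrightarrow> \<exists>c. (\<forall>b\<in>B. c b \<in> F) \<and> z - (\<Sum>b\<in>B. s (c b) b) \<in> {0}"
    "\<And>c b. (\<And>b. b \<in> B \<Longrightarrow> c b \<in> F) \<Longrightarrow> (\<Sum>b\<in>B. s (c b) b) \<in> {0} \<Longrightarrow> b \<in> B \<Longrightarrow> c b = 0"
    by (rule Least_dimension_basis[OF m N ex]) blast
  have "bij_betw (\<lambda>c. \<Sum>b\<in>B. s (c b) b) (B \<rightarrow>\<^sub>E F) V"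
  proof (rule bij_betwI')
    fix c d assume c: "c \<in> B \<rightarrow>\<^sub>E F" and d: "d \<in> B \<rightarrow>\<^sub>E F"
    show "((\<Sum>b\<in>B. s (c b) b) = (\<Sum>b\<in>B. s (d b) b)) = (c = d)"
    proof
      assume "(\<Sum>b\<in>B. s (c b) b) = (\<Sum>b\<in>B. s (d b) b)"
      then have "(\<Sum>b\<in>B. s (c b - d b) b) \<in> {0}"
        by (simp add: scale_left_diff_distrib sum_subtractf)
      moreover have "c b - d b \<in> F" if "b \<in> B" for b
        using PiE_mem[OF c that] PiE_mem[OF d that] by simp
      ultimately have "c b - d b = 0" if "b \<in> B" for b
        using B(5)[of "\<lambda>b. c b - d b" b] that by blast
      then show "c = d" using c d by (intro PiE_ext[OF c d]) simp
    qed simp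
  next
    fix c assume "c \<in> B \<rightarrow>\<^sub>E F"
    then show "(\<Sum>b\<in>B. s (c b) b) \<in> V"
      using B(2) by (intro fsubspace_sum[OF V(1)] fsubspaceD(3)[OF V(1)]) (auto simp: PiE_mem)
  next
    fix z assume "z \<in> V"
    then obtain c where c: "\<forall>b\<in>B. c b \<in> F" "z = (\<Sum>b\<in>B. s (c b) b)" using B(4) by fastforce
    then show "\<exists>c\<in>B \<rightarrow>\<^sub>E F. z = (\<Sum>b\<in>B. s (c b) b)"
      by (intro bexI[of _ "restrict c B"]) auto
  qed
  then have "card V = card (B \<rightarrow>\<^sub>E F)" by (simp add: bij_betw_same_card)
  also have "\<dots> = q ^ card B" using B(1) by (simp add: card_PiE)
  finally show ?thesis unfolding B(3) by simp
qed

definition fscale :: "'k \<Rightarrow> ('i \<Rightarrow> 'k) \<Rightarrow> ('i \<Rightarrow> 'k)" where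
  "fscale a f = (\<lambda>i. a * f i)"

lemma fscale_apply [simp]: "fscale a f i = a * f i"
  by (simp add: fscale_def)

lemma module_mult: "module ((*) :: 'k \<Rightarrow> 'k \<Rightarrow> 'k)"
  by unfold_locales (auto simp: algebra_simps)

lemma module_fscale: "module (fscale :: 'k \<Rightarrow> ('i \<Rightarrow> 'k) \<Rightarrow> 'i \<Rightarrow> 'k)"
  by unfold_locales (auto simp: fscale_def algebra_simps fun_eq_iff)

lemma sum_fun_apply: "(\<Sum>b\<in>B. f b) i = (\<Sum>b\<in>B. f b i)" for f :: "'b \<Rightarrow> 'i \<Rightarrow> 'a::comm_monoid_add"
  by (induction B rule: infinite_finite_induct) auto

lemma card_eq_power_kdim:
  assumes "fsubspace (*) V" "finite V"
  shows "card V = q ^ kdim F V"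
proof -
  have "(V \<subseteq> kspan F B) = (\<forall>z\<in>V. \<exists>c. (\<forall>b\<in>B. c b \<in> F) \<and> z = (\<Sum>b\<in>B. c b * b))" for B
    unfolding kspan_def by blast
  then show ?thesis using card_eq_power_dimension[OF module_mult assms] unfolding kdim_def by simp
qed

lemma card_eq_power_vdim:
  assumes "fsubspace fscale V" "finite V"
  shows "card V = q ^ vdim F V"
proof -
  have "(\<lambda>j. \<Sum>b\<in>B. c b * b j) = (\<Sum>b\<in>B. fscale (c b) b)" for B and c :: "(nat \<Rightarrow> 'k) \<Rightarrow> 'k"
    by (simp add: fun_eq_iff sum_fun_apply)
  then have "vspan F B = {(\<Sum>b\<in>B. fscale (c b) b) | c. \<forall>b\<in>B. c b \<in> F}" for B
    unfolding vspan_def by presburger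
  then have "(V \<subseteq> vspan F B) = (\<forall>z\<in>V. \<exists>c. (\<forall>b\<in>B. c b \<in> F) \<and> z = (\<Sum>b\<in>B. fscale (c b) b))" for B
    by blast
  then show ?thesis using card_eq_power_dimension[OF module_fscale assms] unfolding vdim_def by simp
qed

end

text \<open>Only the fibres of \<open>h\<close> matter: they are cosets of \<open>U\<close>. This
  covers maps into residue classes, whose values are sets, as well as evaluation of functions at
  points.\<close>

lemma card_eq_card_kernel_times_image:
  fixes V U :: "'v::ab_group_add set"
  assumes fin: "finite U" "finite (h ` V)" and "U \<subseteq> V"
    and add: "\<And>x y. x \<in> V \<Longrightarrow> y \<in> U \<Longrightarrow> x + y \<in> V"
    and h: "\<And>x y. x \<in> V \<Longrightarrow> y \<in> V \<Longrightarrow> h x = h y \<longleftrightarrow> x - y \<in> U"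
  shows "finite V" "card V = card U * card (h ` V)"
proof -
  obtain r where r: "\<And>y. y \<in> h ` V \<Longrightarrow> r y \<in> V \<and> h (r y) = y"
    using bchoice[of "h ` V" "\<lambda>y x. x \<in> V \<and> h x = y"] by blast
  have "bij_betw (\<lambda>(u, y). r y + u) (U \<times> h ` V) V"
  proof (rule bij_betw_byWitness[where f' = "\<lambda>x. (x - r (h x), h x)"])
    show "\<forall>a\<in>U \<times> h ` V. (\<lambda>x. (x - r (h x), h x)) ((\<lambda>(u, y). r y + u) a) = a"
    proof (clarify, goal_cases)
      case ux: (1 u _ x)
      have V: "r (h x) + u \<in> V" using add r ux by blast
      then have "h (r (h x) + u) = h x" using h[OF V, of "r (h x)"] r[of "h x"] ux by simp
      then show ?case by simp
    qed
    show "\<forall>x\<in>V. (case (x - r (h x), h x) of (u, y) \<Rightarrow> r y + u) = x" by simp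
    show "(\<lambda>(u, y). r y + u) ` (U \<times> h ` V) \<subseteq> V" using add r by force
    show "(\<lambda>x. (x - r (h x), h x)) ` V \<subseteq> U \<times> h ` V"
    proof safe
      fix x assume x: "x \<in> V"
      then have "r (h x) \<in> V" "h (r (h x)) = h x" using r by blast+
      then show "x - r (h x) \<in> U" using h x by metis
    qed auto
  qed
  then show "finite V" "card V = card U * card (h ` V)"
    using fin bij_betw_finite[of _ "U \<times> h ` V" V] bij_betw_same_card[of _ "U \<times> h ` V" V]
    by (auto simp: card_cartesian_product)
qed

section \<open>Bounded degree over a simple subfield\<close>

context finite_subfield
begin

definition fpolys :: "nat \<Rightarrow> 'k poly set" where
  "fpolys d = {p. (\<forall>i. coeff p i \<in> F) \<and> (\<forall>i\<ge>d. coeff p i = 0)}"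

lemma fpolys_mono: "p \<in> fpolys d \<Longrightarrow> d \<le> e \<Longrightarrow> p \<in> fpolys e"
  by (auto simp: fpolys_def)

lemma fpolys_add: "p \<in> fpolys d \<Longrightarrow> r \<in> fpolys d \<Longrightarrow> p + r \<in> fpolys d"
  by (auto simp: fpolys_def)

lemma fpolys_0: "0 \<in> fpolys d" and fpolys_1: "1 \<in> fpolys (Suc d)"
  by (auto simp: fpolys_def coeff_1)

lemma fpolys_mult:
  assumes "p \<in> fpolys d" "r \<in> fpolys e"
  shows "p * r \<in> fpolys (d + e)"
proof -
  have "coeff (p * r) i = 0" if "i \<ge> d + e" for i
  proof -
    have "coeff p j * coeff r (i - j) = 0" if "j \<le> i" for j
      using assms \<open>i \<ge> d + e\<close> that unfolding fpolys_def by (cases "j \<ge> d") auto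
    then show ?thesis unfolding coeff_mult by (intro sum.neutral) simp
  qed
  moreover have "coeff (p * r) i \<in> F" for i
    using assms unfolding fpolys_def by (auto simp: coeff_mult intro!: F_sum F_mult)
  ultimately show ?thesis by (simp add: fpolys_def)
qed

lemma card_fpolys: "finite (fpolys d)" "card (fpolys d) \<le> q ^ d"
proof -
  have inj: "inj_on (\<lambda>p. restrict (coeff p) {..<d}) (fpolys d)"
  proof (rule inj_onI)
    fix p r assume p: "p \<in> fpolys d" and r: "r \<in> fpolys d"
      and eq: "restrict (coeff p) {..<d} = restrict (coeff r) {..<d}"
    show "p = r"
    proof (rule poly_eqI)
      fix i show "coeff p i = coeff r i"
        using p r fun_cong[OF eq, of i] by (cases "i < d") (auto simp: fpolys_def)
    qed
  qed
  have im: "(\<lambda>p. restrict (coeff p) {..<d}) ` fpolys d \<subseteq> {..<d} \<rightarrow>\<^sub>E F"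
    by (auto simp: fpolys_def PiE_def Pi_def extensional_def)
  have fin: "finite ({..<d} \<rightarrow>\<^sub>E F)" by (intro finite_PiE) (auto simp: finite_F)
  show "finite (fpolys d)" using inj_on_finite[OF inj im fin] .
  show "card (fpolys d) \<le> q ^ d" using card_inj_on_le[OF inj im fin] by (simp add: card_PiE)
qed

definition polys_below :: "'k \<Rightarrow> nat \<Rightarrow> 'k set" where
  "polys_below x d = (\<lambda>p. poly p x) ` fpolys d"

lemma polys_below_mono: "p \<in> polys_below x d \<Longrightarrow> d \<le> e \<Longrightarrow> p \<in> polys_below x e"
  by (auto simp: polys_below_def intro: fpolys_mono)

lemma polys_below_add: "p \<in> polys_below x d \<Longrightarrow> r \<in> polys_below x d \<Longrightarrow> p + r \<in> polys_below x d"
  by (auto simp: polys_below_def simp flip: poly_add intro: fpolys_add)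

lemma polys_below_mult: "p \<in> polys_below x d \<Longrightarrow> r \<in> polys_below x e \<Longrightarrow> p * r \<in> polys_below x (d + e)"
  by (auto simp: polys_below_def simp flip: poly_mult intro: fpolys_mult)

lemma polys_below_0: "0 \<in> polys_below x d"
  unfolding polys_below_def by (rule image_eqI[of _ _ 0]) (auto simp: fpolys_0)

lemma polys_below_1: "1 \<in> polys_below x (Suc d)"
  unfolding polys_below_def by (rule image_eqI[of _ _ 1]) (auto simp: fpolys_1)

lemma polys_below_scale: "a \<in> F \<Longrightarrow> p \<in> polys_below x d \<Longrightarrow> a * p \<in> polys_below x d"
  unfolding polys_below_def
  by clarify (rule image_eqI[of _ _ "smult a _"], auto simp: fpolys_def)

lemma polys_below_prod:
  assumes "finite I" "\<And>i. i \<in> I \<Longrightarrow> \<exists>d. f i \<in> polys_below x d"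
  shows "\<exists>d. prod f I \<in> polys_below x d"
  using assms
proof (induction I)
  case empty
  then show ?case using polys_below_1 by auto
next
  case (insert i I)
  obtain d where "f i \<in> polys_below x d" using insert.prems by blast
  moreover obtain e where "prod f I \<in> polys_below x e" using insert by blast
  ultimately have "f i * prod f I \<in> polys_below x (d + e)" by (rule polys_below_mult)
  then show ?case using insert.hyps by auto
qed

lemma card_polys_below: "finite (polys_below x d)" "card (polys_below x d) \<le> q ^ d"
  unfolding polys_below_def using card_fpolys[of d] card_image_le[of "fpolys d" "\<lambda>p. poly p x"] by auto

lemma polys_in_imp_below:
  assumes "p \<in> polys_in F x"
  shows "\<exists>d. p \<in> polys_below x d"
proof -
  obtain c n where cn: "p = (\<Sum>i<n. c i * x ^ i)" "\<forall>i. c i \<in> F" using assms unfolding polys_in_def by auto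
  have "(\<Sum>i<n. monom (c i) i) \<in> fpolys n"
    using cn(2) by (auto simp: fpolys_def coeff_sum coeff_monom if_distrib cong: if_cong)
  moreover have "poly (\<Sum>i<n. monom (c i) i) x = p" by (simp add: cn poly_sum poly_monom)
  ultimately show ?thesis unfolding polys_below_def by blast
qed

text \<open>Combinations of \<open>B\<close> with coefficients in F[x] of degree below
  \<open>d\<close>: a finite box that serves as the target of the pigeonhole argument.\<close>

definition lattice :: "'k \<Rightarrow> 'k set \<Rightarrow> nat \<Rightarrow> 'k set" where
  "lattice x B d = {(\<Sum>b\<in>B. p b * b) | p. \<forall>b\<in>B. p b \<in> polys_below x d}"

lemma lattice_0: "0 \<in> lattice x B d"
  unfolding lattice_def by (auto intro!: exI[of _ "\<lambda>_. 0"] simp: polys_below_0)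

lemma lattice_add:
  assumes "y \<in> lattice x B d" "z \<in> lattice x B d"
  shows "y + z \<in> lattice x B d"
proof -
  obtain p r where "y = (\<Sum>b\<in>B. p b * b)" "z = (\<Sum>b\<in>B. r b * b)"
    "\<forall>b\<in>B. p b \<in> polys_below x d" "\<forall>b\<in>B. r b \<in> polys_below x d"
    using assms unfolding lattice_def by auto
  then show ?thesis unfolding lattice_def
    by (auto intro!: exI[of _ "\<lambda>b. p b + r b"] simp: sum.distrib algebra_simps polys_below_add)
qed

lemma lattice_sum: "(\<And>i. i \<in> I \<Longrightarrow> f i \<in> lattice x B d) \<Longrightarrow> sum f I \<in> lattice x B d"
  by (induction I rule: infinite_finite_induct) (auto simp: lattice_0 lattice_add)

lemma lattice_mult:
  assumes "h \<in> polys_below x d" "y \<in> lattice x B e"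
  shows "h * y \<in> lattice x B (d + e)"
proof -
  obtain p where "y = (\<Sum>b\<in>B. p b * b)" "\<forall>b\<in>B. p b \<in> polys_below x e"
    using assms unfolding lattice_def by auto
  then show ?thesis unfolding lattice_def using assms(1)
    by (auto intro!: exI[of _ "\<lambda>b. h * p b"] simp: sum_distrib_left mult.assoc polys_below_mult)
qed

lemma lattice_scale:
  assumes "a \<in> F" "y \<in> lattice x B e"
  shows "a * y \<in> lattice x B e"
proof -
  obtain p where "y = (\<Sum>b\<in>B. p b * b)" "\<forall>b\<in>B. p b \<in> polys_below x e"
    using assms unfolding lattice_def by auto
  then show ?thesis unfolding lattice_def using assms(1)
    by (auto intro!: exI[of _ "\<lambda>b. a * p b"] simp: sum_distrib_left mult.assoc polys_below_scale)
qed

lemma card_lattice: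
  assumes "finite B"
  shows "finite (lattice x B d)" "card (lattice x B d) \<le> q ^ (d * card B)"
proof -
  let ?P = "B \<rightarrow>\<^sub>E polys_below x d"
  have eq: "lattice x B d = (\<lambda>p. \<Sum>b\<in>B. p b * b) ` ?P"
  proof safe
    fix y assume "y \<in> lattice x B d"
    then obtain p where "y = (\<Sum>b\<in>B. p b * b)" "\<forall>b\<in>B. p b \<in> polys_below x d"
      unfolding lattice_def by auto
    then show "y \<in> (\<lambda>p. \<Sum>b\<in>B. p b * b) ` ?P" by (intro image_eqI[of _ _ "restrict p B"]) auto
  next
    fix p assume "p \<in> ?P"
    then show "(\<Sum>b\<in>B. p b * b) \<in> lattice x B d" unfolding lattice_def by (blast dest: PiE_mem)
  qed
  have fin: "finite ?P" using assms card_polys_below by (intro finite_PiE) auto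
  then show "finite (lattice x B d)" unfolding eq by simp
  have "card (lattice x B d) \<le> card ?P" unfolding eq by (rule card_image_le[OF fin])
  also have "\<dots> = card (polys_below x d) ^ card B" using assms by (simp add: card_PiE)
  also have "\<dots> \<le> (q ^ d) ^ card B" by (rule power_mono) (simp_all add: card_polys_below)
  finally show "card (lattice x B d) \<le> q ^ (d * card B)" by (simp add: power_mult)
qed

text \<open>The product of the denominators of all coefficients clears one function, and the
  induction multiplies such products. The denominator is a polynomial in \<open>x\<close>, so
  multiplying by it raises box degrees by a known amount.\<close>

lemma common_denominator:
  assumes B: "finite B" "UNIV \<subseteq> kspan (ratfuns F x) B" and Y: "finite Y"
  shows "\<exists>h d. h \<noteq> 0 \<and> h \<in> polys_below x d \<and> (\<forall>y\<in>Y. h * y \<in> lattice x B d)"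
  using Y
proof (induction Y)
  case empty
  show ?case using polys_below_1[of x 0] by (intro exI[of _ 1]) auto
next
  case (insert y Y)
  then obtain h d where h: "h \<noteq> 0" "h \<in> polys_below x d" "\<forall>y\<in>Y. h * y \<in> lattice x B d" by auto
  obtain c where c: "y = (\<Sum>b\<in>B. c b * b)" "\<forall>b\<in>B. c b \<in> ratfuns F x"
    using B(2) unfolding kspan_def by blast
  then have "\<forall>b\<in>B. \<exists>u w. c b = u / w \<and> w \<noteq> 0 \<and> (\<exists>d. u \<in> polys_below x d) \<and> (\<exists>d. w \<in> polys_below x d)"
    using polys_in_imp_below unfolding ratfuns_def by blast
  then obtain u w where uw: "\<And>b. b \<in> B \<Longrightarrow> c b = u b / w b \<and> w b \<noteq> 0 \<and> (\<exists>d. u b \<in> polys_below x d) \<and> (\<exists>d. w b \<in> polys_below x d)"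
    by metis
  define W where "W = prod w B"
  have W0: "W \<noteq> 0" unfolding W_def using uw B(1) by (auto simp: prod_zero_iff)
  obtain e1 where e1: "W \<in> polys_below x e1" unfolding W_def using polys_below_prod[of B w] uw B(1) by blast
  have "\<exists>d. W * c b \<in> polys_below x d" if b: "b \<in> B" for b
  proof -
    have "W = w b * prod w (B - {b})" unfolding W_def using B(1) that by (simp add: prod.remove)
    then have eq: "W * c b = prod w (B - {b}) * u b" using uw[OF that] by simp
    have "\<exists>d. prod w (B - {b}) \<in> polys_below x d"
      by (rule polys_below_prod) (use uw B(1) in auto)
    moreover have "\<exists>d. u b \<in> polys_below x d" using uw[OF b] by blast
    ultimately show ?thesis using polys_below_mult unfolding eq by blast
  qed
  then obtain e where e: "\<And>b. b \<in> B \<Longrightarrow> W * c b \<in> polys_below x (e b)" by metis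
  define E where "E = e1 + sum e B"
  have "W * y \<in> lattice x B E"
  proof -
    have "W * c b \<in> polys_below x E" if "b \<in> B" for b
    proof (rule polys_below_mono[OF e[OF that]])
      have "e b \<le> sum e B" using B(1) that by (intro member_le_sum) auto
      then show "e b \<le> E" by (simp add: E_def)
    qed
    then show ?thesis unfolding lattice_def c(1)
      by (auto intro!: exI[of _ "\<lambda>b. W * c b"] simp: sum_distrib_left mult.assoc)
  qed
  then have "h * (W * y) \<in> lattice x B (d + E)" using h lattice_mult by blast
  moreover have WE: "W \<in> polys_below x E" using polys_below_mono[OF e1] by (simp add: E_def)
  then have "h * W \<in> polys_below x (d + E)" using polys_below_mult h(2) by blast
  moreover have "W * (h * y') \<in> lattice x B (E + d)" if "y' \<in> Y" for y'
    using lattice_mult[OF WE] h(3) that by blast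
  ultimately have "\<forall>y'\<in>insert y Y. (h * W) * y' \<in> lattice x B (d + E)"
    by (auto simp: algebra_simps)
  then show ?case using h(1) W0 \<open>h * W \<in> _\<close> by (intro exI[of _ "h * W"] exI[of _ "d + E"]) auto
qed

text \<open>The multiples \<open>t ^ i * y j\<close> with \<open>i \<le> d\<close> become, after clearing denominators, polynomials in
  \<open>x\<close> of degree growing like \<open>c d\<close>, so for large \<open>d\<close> there are more formal combinations than
  values as soon as the number of \<open>y j\<close> exceeds \<open>c * card B\<close>.\<close>

lemma bounded_degree_over:
  assumes B: "finite B" "UNIV \<subseteq> kspan (ratfuns F x) B"
  shows "\<exists>N. \<forall>y :: nat \<Rightarrow> 'k. \<exists>d c. (\<forall>j i. c j i \<in> F) \<and> (\<exists>j\<le>N. \<exists>i\<le>d. c j i \<noteq> 0) \<and>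
     (\<Sum>j\<le>N. \<Sum>i\<le>d. c j i * t ^ i * y j) = 0"
proof -
  obtain h a where h: "h \<noteq> 0" "h \<in> polys_below x a" "\<forall>b\<in>B. h * (t * b) \<in> lattice x B a"
    using common_denominator[OF B, of "(\<lambda>b. t * b) ` B"] B(1) by auto
  \<comment> \<open>The box degree grows by \<open>a\<close> for every \<open>y\<close>, since
    \<open>t\<close> is applied to the elements of \<open>B\<close> only and not to the
    coefficients.\<close>
  have ht: "h * t * y \<in> lattice x B (a + d)" if y: "y \<in> lattice x B d" for y d
  proof -
    obtain p where p: "y = (\<Sum>b\<in>B. p b * b)" "\<forall>b\<in>B. p b \<in> polys_below x d"
      using y unfolding lattice_def by auto
    have "h * t * y = (\<Sum>b\<in>B. p b * (h * (t * b)))" by (simp add: p sum_distrib_left algebra_simps)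
    also have "\<dots> \<in> lattice x B (d + a)" using p h(3) by (intro lattice_sum lattice_mult) auto
    finally show ?thesis by (simp add: add.commute)
  qed
  \<comment> \<open>Each factor \<open>h\<close> costs \<open>a\<close> whether or not it absorbs a
    power of \<open>t\<close>; hence one bound holds for all exponents up to
    \<open>d\<close>.\<close>
  have hti: "h ^ d * t ^ i * y \<in> lattice x B (a * d + e)" if "y \<in> lattice x B e" "i \<le> d" for y e i d
    using that(2)
  proof (induction d arbitrary: i)
    case 0
    then show ?case using that by simp
  next
    case (Suc d)
    show ?case
    proof (cases i)
      case 0
      have "h * (h ^ d * t ^ 0 * y) \<in> lattice x B (a + (a * d + e))" by (rule lattice_mult[OF h(2) Suc.IH]) simp
      then show ?thesis using 0 by (simp add: algebra_simps)
    next
      case (Suc i')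
      have "h * t * (h ^ d * t ^ i' * y) \<in> lattice x B (a + (a * d + e))" by (rule ht[OF Suc.IH]) (use Suc Suc.prems in simp)
      then show ?thesis using Suc by (simp add: algebra_simps)
    qed
  qed
  \<comment> \<open>With \<open>d = card B * e\<close> below, \<open>(N + 1) * (d + 1)\<close>
    exceeds \<open>(a * d + e) * card B\<close>. \<open>N\<close> depends on \<open>t\<close>
    through \<open>a\<close> but not on the \<open>y j\<close>, whose denominators enter only
    \<open>e\<close>.\<close>
  define N where "N = card B * a"
  show ?thesis
  proof (rule exI[of _ N], rule allI)
    fix y :: "nat \<Rightarrow> 'k"
    obtain h0 e where h0: "h0 \<noteq> 0" "\<forall>j\<le>N. h0 * y j \<in> lattice x B e"
      using common_denominator[OF B, of "y ` {..N}"] by auto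
    define d where "d = card B * e"
    let ?J = "{..N} \<times> {..d}"
    let ?C = "?J \<rightarrow>\<^sub>E F"
    let ?L = "lattice x B (a * d + e)"
    define \<Phi> where "\<Phi> c = (\<Sum>ji\<in>?J. c ji * (h ^ d * t ^ snd ji * (h0 * y (fst ji))))" for c :: "nat \<times> nat \<Rightarrow> 'k"
    have im: "\<Phi> ` ?C \<subseteq> ?L"
    proof (rule image_subsetI)
      fix c assume c: "c \<in> ?C"
      show "\<Phi> c \<in> ?L" unfolding \<Phi>_def
      proof (rule lattice_sum)
        fix ji assume ji: "ji \<in> ?J"
        then have "h ^ d * t ^ snd ji * (h0 * y (fst ji)) \<in> ?L" using h0(2) by (intro hti) auto
        then show "c ji * (h ^ d * t ^ snd ji * (h0 * y (fst ji))) \<in> ?L"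
          by (rule lattice_scale[OF PiE_mem[OF c ji]])
      qed
    qed
    have "card ?L \<le> q ^ ((a * d + e) * card B)" by (rule card_lattice[OF B(1)])
    also have "\<dots> < q ^ ((N + 1) * (d + 1))"
      unfolding q_power_less_iff by (simp add: N_def d_def algebra_simps)
    also have "\<dots> = card ?C" by (simp add: card_PiE card_cartesian_product)
    finally have "\<not> inj_on \<Phi> ?C"
      using card_inj_on_le[OF _ im card_lattice(1)[OF B(1)]] by fastforce
    then obtain c1 c2 where c: "c1 \<in> ?C" "c2 \<in> ?C" "\<Phi> c1 = \<Phi> c2" "c1 \<noteq> c2" by (auto simp: inj_on_def)
    define c where "c j i = (if (j, i) \<in> ?J then c1 (j, i) - c2 (j, i) else 0)" for j i
    have cF: "c j i \<in> F" for j i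
      unfolding c_def using PiE_mem[OF c(1), of "(j, i)"] PiE_mem[OF c(2), of "(j, i)"] by simp
    have "\<exists>ji\<in>?J. c1 ji \<noteq> c2 ji" using PiE_ext[OF c(1,2)] c(4) by blast
    then have cn: "\<exists>j\<le>N. \<exists>i\<le>d. c j i \<noteq> 0" by (auto simp: c_def)
    have "0 = \<Phi> c1 - \<Phi> c2" using c by simp
    also have "\<dots> = (\<Sum>ji\<in>?J. c (fst ji) (snd ji) * (h ^ d * t ^ snd ji * (h0 * y (fst ji))))"
      unfolding \<Phi>_def sum_subtractf[symmetric]
      by (intro sum.cong) (auto simp: c_def left_diff_distrib)
    also have "\<dots> = h ^ d * h0 * (\<Sum>ji\<in>?J. c (fst ji) (snd ji) * t ^ snd ji * y (fst ji))"
      by (simp add: sum_distrib_left algebra_simps)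
    also have "(\<Sum>ji\<in>?J. c (fst ji) (snd ji) * t ^ snd ji * y (fst ji)) = (\<Sum>j\<le>N. \<Sum>i\<le>d. c j i * t ^ i * y j)"
      by (simp add: sum.cartesian_product case_prod_unfold)
    finally have "(\<Sum>j\<le>N. \<Sum>i\<le>d. c j i * t ^ i * y j) = 0" using h(1) h0(1) by simp
    with cF cn show "\<exists>d c. (\<forall>j i. c j i \<in> F) \<and> (\<exists>j\<le>N. \<exists>i\<le>d. c j i \<noteq> 0) \<and>
        (\<Sum>j\<le>N. \<Sum>i\<le>d. c j i * t ^ i * y j) = 0" by blast
  qed
qed

end

locale finite_function_field = finite_subfield F for F :: "'k::field set" +
  assumes function_field_F: "function_field F"
begin

text \<open>Dividing a relation by the highest power of \<open>t\<close> common to all coefficients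
  leaves a nonzero constant term. At a place where \<open>t\<close> vanishes the terms with positive
  powers of \<open>t\<close> become negligible, so these constant terms carry the
  information.\<close>

lemma algebraic_relation:
  assumes "t \<noteq> 0"
  obtains N where "\<And>y :: nat \<Rightarrow> 'k. \<exists>d c. (\<forall>j i. c j i \<in> F) \<and> (\<exists>j\<le>N. c j 0 \<noteq> 0) \<and>
     (\<Sum>j\<le>N. \<Sum>i\<le>d. c j i * t ^ i * y j) = 0"
proof -
  obtain x B where "finite B" "UNIV \<subseteq> kspan (ratfuns F x) B"
    using function_field_F unfolding function_field_def by blast
  from bounded_degree_over[OF this, of t] obtain N where N: "\<And>y :: nat \<Rightarrow> 'k. \<exists>d c. (\<forall>j i. c j i \<in> F) \<and> (\<exists>j\<le>N. \<exists>i\<le>d. c j i \<noteq> 0) \<and>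
     (\<Sum>j\<le>N. \<Sum>i\<le>d. c j i * t ^ i * y j) = 0" by blast
  show ?thesis
  proof (rule that[of N])
    fix y :: "nat \<Rightarrow> 'k"
    obtain d c where c: "\<forall>j i. c j i \<in> F" "\<exists>j\<le>N. \<exists>i\<le>d. c j i \<noteq> 0"
      "(\<Sum>j\<le>N. \<Sum>i\<le>d. c j i * t ^ i * y j) = 0" using N by blast
    define m where "m = (LEAST i. i \<le> d \<and> (\<exists>j\<le>N. c j i \<noteq> 0))"
    have m: "m \<le> d \<and> (\<exists>j\<le>N. c j m \<noteq> 0)" unfolding m_def by (rule LeastI_ex) (use c(2) in blast)
    have less: "c j i = 0" if "i < m" "j \<le> N" for i j
      using not_less_Least[of i "\<lambda>i. i \<le> d \<and> (\<exists>j\<le>N. c j i \<noteq> 0)"] that m unfolding m_def by force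
    have "(\<Sum>i\<le>d. c j i * t ^ i * y j) = t ^ m * (\<Sum>i\<le>d - m. c j (i + m) * t ^ i * y j)" if "j \<le> N" for j
    proof -
      have "(\<Sum>i\<le>d. c j i * t ^ i * y j) = (\<Sum>i\<in>{m..d}. c j i * t ^ i * y j)"
        by (rule sum.mono_neutral_right) (use less that in auto)
      also have "\<dots> = (\<Sum>i\<in>{0..d - m}. c j (i + m) * t ^ (i + m) * y j)"
        using sum.shift_bounds_cl_nat_ivl[of "\<lambda>i. c j i * t ^ i * y j" 0 m "d - m"] m by simp
      finally show ?thesis by (simp add: sum_distrib_left power_add algebra_simps atMost_atLeast0)
    qed
    then have "t ^ m * (\<Sum>j\<le>N. \<Sum>i\<le>d - m. c j (i + m) * t ^ i * y j) = 0"
      using c(3) by (simp add: sum_distrib_left)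
    then have "(\<Sum>j\<le>N. \<Sum>i\<le>d - m. c j (i + m) * t ^ i * y j) = 0" using assms by simp
    then show "\<exists>d c. (\<forall>j i. c j i \<in> F) \<and> (\<exists>j\<le>N. c j 0 \<noteq> 0) \<and>
     (\<Sum>j\<le>N. \<Sum>i\<le>d. c j i * t ^ i * y j) = 0"
      using m c(1) by (intro exI[of _ "d - m"] exI[of _ "\<lambda>j i. c j (i + m)"]) auto
  qed
qed

end

section \<open>Places and their valuations\<close>

context finite_function_field
begin

lemma place_rules:
  assumes "place F R"
  shows place_F: "a \<in> F \<Longrightarrow> a \<in> R"
    and place_add: "x \<in> R \<Longrightarrow> y \<in> R \<Longrightarrow> x + y \<in> R"
    and place_mult: "x \<in> R \<Longrightarrow> y \<in> R \<Longrightarrow> x * y \<in> R"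
    and place_uminus: "x \<in> R \<Longrightarrow> - x \<in> R"
    and place_inverse: "x \<notin> R \<Longrightarrow> inverse x \<in> R"
    and place_nontrivial: "R \<noteq> UNIV"
  using assms unfolding place_def by auto

lemma place_0: "place F R \<Longrightarrow> 0 \<in> R" and place_1: "place F R \<Longrightarrow> 1 \<in> R"
  by (auto intro: place_F)

lemma place_diff: "place F R \<Longrightarrow> x \<in> R \<Longrightarrow> y \<in> R \<Longrightarrow> x - y \<in> R"
  using place_add[of R x "-y"] place_uminus[of R y] by simp

lemma place_power: "place F R \<Longrightarrow> x \<in> R \<Longrightarrow> x ^ n \<in> R"
  by (induction n) (auto intro: place_1 place_mult)

lemma maxid_iff: "z \<in> maxid R \<longleftrightarrow> z \<in> R \<and> (z = 0 \<or> inverse z \<notin> R)"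
  by (simp add: maxid_def)

lemma maxid_imp_place: "z \<in> maxid R \<Longrightarrow> z \<in> R"
  by (simp add: maxid_def)

lemma inverse_in_maxid: "place F R \<Longrightarrow> z \<notin> R \<Longrightarrow> inverse z \<in> maxid R"
  using place_inverse[of R z] place_0[of R] by (auto simp: maxid_iff)

lemma one_notin_maxid: "place F R \<Longrightarrow> 1 \<notin> maxid R"
  using place_1 by (auto simp: maxid_iff)

lemma maxid_0: "place F R \<Longrightarrow> 0 \<in> maxid R"
  using place_0 by (auto simp: maxid_iff)

lemma maxid_mult:
  assumes "place F R" "z \<in> maxid R" "y \<in> R"
  shows "z * y \<in> maxid R"
proof -
  have "inverse (z * y) \<notin> R" if nz: "z * y \<noteq> 0"
  proof
    assume "inverse (z * y) \<in> R"
    then have "y * inverse (z * y) \<in> R" using place_mult assms by blast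
    moreover have "y * inverse (z * y) = inverse z" using nz by (simp add: field_simps)
    ultimately have "inverse z \<in> R" by metis
    then show False using assms nz by (auto simp: maxid_iff)
  qed
  then show ?thesis using assms place_mult by (auto simp: maxid_iff)
qed

lemma maxid_mult': "place F R \<Longrightarrow> z \<in> maxid R \<Longrightarrow> y \<in> R \<Longrightarrow> y * z \<in> maxid R"
  using maxid_mult[of R z y] by (simp add: mult.commute)

text \<open>One of \<open>x / y\<close> and \<open>y / x\<close> lies in \<open>R\<close>, so the
  sum is a multiple of \<open>x\<close> or of \<open>y\<close> by an element of
  \<open>R\<close>.\<close>

lemma maxid_add:
  assumes R: "place F R" and x: "x \<in> maxid R" and y: "y \<in> maxid R"
  shows "x + y \<in> maxid R"
proof (cases "x = 0 \<or> y = 0")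
  case False
  then have eq: "x + y = y * (x * inverse y + 1)" "x + y = x * (1 + y * inverse x)" by (auto simp: field_simps)
  show ?thesis
  proof (cases "x * inverse y \<in> R")
    case True
    then show ?thesis unfolding eq(1) using R y by (intro maxid_mult place_add place_1) auto
  next
    case False
    then have "y * inverse x \<in> R" using place_inverse[OF R, of "x * inverse y"] by (simp add: mult.commute)
    then show ?thesis unfolding eq(2) using R x by (intro maxid_mult place_add place_1) auto
  qed
qed (use x y in auto)

lemma maxid_uminus: "place F R \<Longrightarrow> x \<in> maxid R \<Longrightarrow> - x \<in> maxid R"
  using maxid_mult[of R x "-1"] place_uminus[of R 1] place_1[of R] by simp

lemma maxid_diff: "place F R \<Longrightarrow> x \<in> maxid R \<Longrightarrow> y \<in> maxid R \<Longrightarrow> x - y \<in> maxid R"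
  using maxid_add[of R x "-y"] maxid_uminus[of R y] by simp

lemma maxid_sum: "place F R \<Longrightarrow> (\<And>i. i \<in> I \<Longrightarrow> f i \<in> maxid R) \<Longrightarrow> sum f I \<in> maxid R"
  by (induction I rule: infinite_finite_induct) (auto simp: maxid_0 maxid_add)

lemma F_maxid: "place F R \<Longrightarrow> a \<in> F \<Longrightarrow> a \<in> maxid R \<Longrightarrow> a = 0"
  using place_F[of R "inverse a"] F_inverse by (auto simp: maxid_iff)

lemma maxid_cancel_F: "place F R \<Longrightarrow> a \<in> F \<Longrightarrow> a \<noteq> 0 \<Longrightarrow> a * z \<in> maxid R \<Longrightarrow> z \<in> maxid R"
  using maxid_mult'[of R "a * z" "inverse a"] place_F[of R "inverse a"] F_inverse
  by (simp flip: mult.assoc)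

lemma fsubspace_maxid: "place F R \<Longrightarrow> fsubspace (*) (maxid R)"
  by (auto simp: fsubspace_def maxid_0 maxid_add maxid_mult' place_F)

section \<open>Discreteness: bounded chains and uniformizers\<close>

lemma maxid_nontrivial:
  assumes "place F R"
  obtains t where "t \<in> maxid R" "t \<noteq> 0"
proof -
  obtain z where "z \<notin> R" using place_nontrivial[OF assms] by auto
  then show ?thesis using that[of "inverse z"] inverse_in_maxid[OF assms] place_0[OF assms] by auto
qed

text \<open>Dividing by the dominant term would put 1 into the maximal ideal. This is the strict
  triangle inequality in a form that makes sense before a valuation is available.\<close>

lemma dominant_term:
  assumes R: "place F R" and S: "finite S" "a \<in> S" and "sum w S = 0" "w a \<noteq> 0"
    and dom: "\<And>b. b \<in> S \<Longrightarrow> b \<noteq> a \<Longrightarrow> w b / w a \<in> maxid R"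
  shows False
proof -
  have "0 = (\<Sum>b\<in>S. w b / w a)" using assms(4) by (simp add: sum_divide_distrib[symmetric])
  also have "\<dots> = 1 + (\<Sum>b\<in>S - {a}. w b / w a)" using S assms(5) by (simp add: sum.remove)
  finally have "1 = - (\<Sum>b\<in>S - {a}. w b / w a)" by (simp add: eq_neg_iff_add_eq_0)
  also have "\<dots> \<in> maxid R" using dom by (intro maxid_uminus maxid_sum R) auto
  finally show False using one_notin_maxid[OF R] by simp
qed

text \<open>Along the chain the order of vanishing strictly decreases from that of \<open>t\<close>
  and stays positive. A relation over F[t] between the \<open>N + 1\<close> members after
  \<open>t\<close> would have a dominant term, so the length is bounded in terms of
  \<open>t\<close>.\<close>

lemma chain_bounded:
  assumes R: "place F R" and t: "t \<in> maxid R" "t \<noteq> 0"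
  obtains N where "\<And>z :: nat \<Rightarrow> 'k. z 0 = t \<Longrightarrow>
     (\<And>j. j \<le> N \<Longrightarrow> z (Suc j) \<in> maxid R \<and> z (Suc j) \<noteq> 0 \<and> z j / z (Suc j) \<in> maxid R) \<Longrightarrow> False"
proof -
  from algebraic_relation[OF t(2)] obtain N where N: "\<And>y :: nat \<Rightarrow> 'k. \<exists>d c. (\<forall>j i. c j i \<in> F) \<and> (\<exists>j\<le>N. c j 0 \<noteq> 0) \<and>
     (\<Sum>j\<le>N. \<Sum>i\<le>d. c j i * t ^ i * y j) = 0" by blast
  show ?thesis
  proof (rule that[of N])
    fix z :: "nat \<Rightarrow> 'k" assume z0: "z 0 = t"
      and z: "\<And>j. j \<le> N \<Longrightarrow> z (Suc j) \<in> maxid R \<and> z (Suc j) \<noteq> 0 \<and> z j / z (Suc j) \<in> maxid R"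
    have ratio: "z i / z j \<in> maxid R" if "i < j" "j \<le> Suc N" for i j
      using that
    proof (induction j)
      case (Suc j)
      show ?case
      proof (cases "i = j")
        case True
        then show ?thesis using z Suc.prems by simp
      next
        case False
        then have "z i / z j \<in> maxid R" using Suc by simp
        moreover have "z j / z (Suc j) \<in> R" using z Suc.prems by (auto intro: maxid_imp_place)
        ultimately have "z i / z j * (z j / z (Suc j)) \<in> maxid R" using maxid_mult R by blast
        moreover have "z j \<noteq> 0" using z0 t z[of "j - 1"] Suc.prems by (cases j) auto
        ultimately show ?thesis by simp
      qed
    qed simp
    from N[of "\<lambda>j. z (Suc j)"] obtain d c where c: "\<And>j i. c j i \<in> F" "\<exists>j\<le>N. c j 0 \<noteq> 0"
      "(\<Sum>j\<le>N. \<Sum>i\<le>d. c j i * t ^ i * z (Suc j)) = 0" by blast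
    \<comment> \<open>The dominant term is the constant one of largest index: \<open>t\<close>
      vanishes to higher order than any \<open>z (Suc j)\<close>, and among the constant terms later
      members of the chain vanish to lower order.\<close>
    define l where "l = Max {j. j \<le> N \<and> c j 0 \<noteq> 0}"
    have fin: "finite {j. j \<le> N \<and> c j 0 \<noteq> 0}" by simp
    have l: "l \<le> N" "c l 0 \<noteq> 0" using Max_in[OF fin] c(2) unfolding l_def by auto
    have lmax: "j \<le> l" if "j \<le> N" "c j 0 \<noteq> 0" for j
      unfolding l_def by (rule Max_ge[OF fin]) (use that in simp)
    let ?w = "\<lambda>(j, i). c j i * t ^ i * z (Suc j)"
    show False
    proof (rule dominant_term[OF R, of "{..N} \<times> {..d}" "(l, 0)" ?w])
      show "sum ?w ({..N} \<times> {..d}) = 0" using c(3) by (simp add: sum.cartesian_product)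
      show "?w (l, 0) \<noteq> 0" using l z by simp
      fix b assume b: "b \<in> {..N} \<times> {..d}" "b \<noteq> (l, 0)"
      obtain j i where ji: "b = (j, i)" by (cases b)
      have cR: "c j i / c l 0 \<in> R" using c(1) by (simp add: place_F[OF R])
      have "?w b / ?w (l, 0) = (c j i / c l 0) * (t ^ i * z (Suc j) / z (Suc l))" by (simp add: ji)
      moreover have "\<dots> \<in> maxid R"
      proof (cases "c j i = 0")
        case nz: False
        show ?thesis
        proof (rule maxid_mult'[OF R _ cR])
          show "t ^ i * z (Suc j) / z (Suc l) \<in> maxid R"
          proof (cases i)
            case 0
            then have "j < l" using nz lmax[of j] b ji by force
            then show ?thesis using ratio[of "Suc j" "Suc l"] l 0 by simp
          next
            case (Suc i')
            have "t / z (Suc l) \<in> maxid R" using ratio[of 0 "Suc l"] z0 l by simp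
            moreover have "t ^ i' * z (Suc j) \<in> R"
              using z[of j] b ji t by (intro place_mult place_power R) (auto intro: maxid_imp_place)
            ultimately have "t / z (Suc l) * (t ^ i' * z (Suc j)) \<in> maxid R" by (rule maxid_mult[OF R])
            then show ?thesis using Suc by (simp add: algebra_simps)
          qed
        qed
      qed (simp add: maxid_0 R)
      ultimately show "?w b / ?w (l, 0) \<in> maxid R" by metis
    qed (use l in auto)
  qed
qed

text \<open>If no element generates the maximal ideal, every nonzero \<open>z\<close> in it has a
  \<open>y\<close> in it with \<open>z / y\<close> still in it. Dependent choice then builds an
  infinite chain, which \<open>chain_bounded\<close> forbids.\<close>

lemma uniformizer_exists:
  assumes R: "place F R"
  shows "\<exists>t. uniformizer R t"
proof (rule ccontr)
  assume no: "\<not> ?thesis"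
  obtain t where t: "t \<in> maxid R" "t \<noteq> 0" using maxid_nontrivial[OF R] .
  obtain N where N: "\<And>z :: nat \<Rightarrow> 'k. z 0 = t \<Longrightarrow>
     (\<And>j. j \<le> N \<Longrightarrow> z (Suc j) \<in> maxid R \<and> z (Suc j) \<noteq> 0 \<and> z j / z (Suc j) \<in> maxid R) \<Longrightarrow> False"
    using chain_bounded[OF R t] by blast
  have step: "\<exists>y. (y \<in> maxid R \<and> y \<noteq> 0) \<and> z / y \<in> maxid R" if z: "z \<in> maxid R \<and> z \<noteq> 0" for z
  proof -
    have "maxid R \<noteq> {z * y | y. y \<in> R}" using no z maxid_imp_place unfolding uniformizer_def by blast
    moreover have "{z * y | y. y \<in> R} \<subseteq> maxid R" using z maxid_mult[OF R] by auto
    ultimately obtain y where y: "y \<in> maxid R" "\<And>w. w \<in> R \<Longrightarrow> y \<noteq> z * w" by blast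
    have "y / z \<notin> R" using y(2)[of "y / z"] z by auto
    from inverse_in_maxid[OF R this] have "z / y \<in> maxid R" by simp
    moreover have "y \<noteq> 0" using y(2)[of 0] place_0[OF R] by simp
    ultimately show ?thesis using y by blast
  qed
  have "\<exists>f :: nat \<Rightarrow> 'k. \<forall>n. (f n \<in> maxid R \<and> f n \<noteq> 0 \<and> (n = 0 \<longrightarrow> f n = t)) \<and> f n / f (Suc n) \<in> maxid R"
  proof (rule dependent_nat_choice)
    show "\<exists>x. x \<in> maxid R \<and> x \<noteq> 0 \<and> (0 = (0::nat) \<longrightarrow> x = t)" using t by blast
  next
    fix x n assume "x \<in> maxid R \<and> x \<noteq> 0 \<and> (n = (0::nat) \<longrightarrow> x = t)"
    then show "\<exists>y. (y \<in> maxid R \<and> y \<noteq> 0 \<and> (Suc n = 0 \<longrightarrow> y = t)) \<and> x / y \<in> maxid R" using step[of x] by auto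
  qed
  then obtain f where f: "\<And>n. (f n \<in> maxid R \<and> f n \<noteq> 0 \<and> (n = 0 \<longrightarrow> f n = t)) \<and> f n / f (Suc n) \<in> maxid R"
    by blast
  show False by (rule N[of f]) (use f in auto)
qed

text \<open>The same choice as inside \<open>val\<close>, so that \<open>val_def\<close> can be
  folded to it.\<close>

definition unif :: "'k set \<Rightarrow> 'k" where "unif R = (SOME t. uniformizer R t)"

section \<open>Units and the normalized valuation\<close>

definition unit_at :: "'k set \<Rightarrow> 'k \<Rightarrow> bool" where
  "unit_at R u \<longleftrightarrow> u \<in> R \<and> u \<noteq> 0 \<and> inverse u \<in> R"

lemma unit_at_iff: "place F R \<Longrightarrow> unit_at R u \<longleftrightarrow> u \<in> R \<and> u \<notin> maxid R"
  using maxid_0 by (auto simp: unit_at_def maxid_iff)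

lemma unit_at_mult: "place F R \<Longrightarrow> unit_at R u \<Longrightarrow> unit_at R v \<Longrightarrow> unit_at R (u * v)"
  by (auto simp: unit_at_def place_mult)

lemma unit_at_inverse: "unit_at R u \<Longrightarrow> unit_at R (inverse u)"
  by (auto simp: unit_at_def)

lemma uniformizer_unif:
  assumes "place F R"
  shows "uniformizer R (unif R)"
  unfolding unif_def using uniformizer_exists[OF assms] by (rule someI_ex)

lemma unif_maxid: "place F R \<Longrightarrow> unif R \<in> maxid R"
  using uniformizer_unif[of R] place_1[of R] unfolding uniformizer_def by force

lemma maxid_div_unif:
  assumes "place F R" "z \<in> maxid R"
  shows "z / unif R \<in> R"
proof -
  obtain y where "z = unif R * y" "y \<in> R" using uniformizer_unif[OF assms(1)] assms(2) unfolding uniformizer_def by blast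
  then show ?thesis using place_0[OF assms(1)] by (cases "unif R = 0") auto
qed

lemma unif_nonzero:
  assumes "place F R"
  shows "unif R \<noteq> 0"
proof -
  obtain t where "t \<in> maxid R" "t \<noteq> 0" using maxid_nontrivial[OF assms] .
  then show ?thesis using uniformizer_unif[OF assms] unfolding uniformizer_def by auto
qed

lemma maxid_power: "place F R \<Longrightarrow> z \<in> maxid R \<Longrightarrow> n > 0 \<Longrightarrow> z ^ n \<in> maxid R"
  by (cases n) (simp_all add: maxid_mult place_power maxid_imp_place)

text \<open>Divide by the uniformizer for as long as the quotient stays in \<open>R\<close>; the
  last quotient is a unit. The process stops because of \<open>chain_bounded\<close>.\<close>

lemma valuation_decomp_ring:
  assumes R: "place F R" and z: "z \<in> R" "z \<noteq> 0"
  shows "\<exists>n u. unit_at R u \<and> z = unif R ^ n * u"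
proof -
  let ?p = "unif R"
  have p: "?p \<in> maxid R" "?p \<noteq> 0" using unif_maxid unif_nonzero R by auto
  have "\<exists>n. z / ?p ^ n \<notin> R"
  proof (rule ccontr)
    assume "\<nexists>n. z / ?p ^ n \<notin> R"
    then have all: "z / ?p ^ n \<in> R" for n by blast
    have zm: "z / ?p ^ n \<in> maxid R" for n
    proof -
      have "z / ?p ^ n = ?p * (z / ?p ^ Suc n)" using p by simp
      also have "\<dots> \<in> maxid R" using maxid_mult[OF R p(1) all] .
      finally show ?thesis .
    qed
    then have "z \<in> maxid R" using zm[of 0] by simp
    then obtain N where N: "\<And>w :: nat \<Rightarrow> 'k. w 0 = z \<Longrightarrow>
     (\<And>j. j \<le> N \<Longrightarrow> w (Suc j) \<in> maxid R \<and> w (Suc j) \<noteq> 0 \<and> w j / w (Suc j) \<in> maxid R) \<Longrightarrow> False"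
      using chain_bounded[OF R _ z(2)] by blast
    \<comment> \<open>If every power of \<open>?p\<close> divided \<open>z\<close>, then
      \<open>z\<close>, \<open>?p ^ (N + 1)\<close>, ..., \<open>?p\<close> would be a chain of
      \<open>N + 2\<close> elements, one more than the bound allows.\<close>
    let ?w = "\<lambda>j. if j = 0 then z else ?p ^ (N + 2 - j)"
    show False
    proof (rule N[of ?w])
      fix j assume j: "j \<le> N"
      have "?p ^ (N + 2 - Suc j) \<in> maxid R" using j by (intro maxid_power R p) simp
      moreover have "?w j / ?w (Suc j) \<in> maxid R"
      proof (cases "j = 0")
        case True
        then show ?thesis using zm[of "N + 1"] by simp
      next
        case False
        then have "N + 2 - j = Suc (N + 2 - Suc j)" using j by simp
        then have "?w j / ?w (Suc j) = ?p" using p False by simp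
        then show ?thesis using p by simp
      qed
      ultimately show "?w (Suc j) \<in> maxid R \<and> ?w (Suc j) \<noteq> 0 \<and> ?w j / ?w (Suc j) \<in> maxid R" using p by simp
    qed simp
  qed
  then obtain n where n: "z / ?p ^ n \<notin> R" "\<And>m. m < n \<Longrightarrow> z / ?p ^ m \<in> R"
    using exists_least_iff[of "\<lambda>n. z / ?p ^ n \<notin> R"] by blast
  then obtain m where m: "n = Suc m" using z by (cases n) auto
  have "z / ?p ^ m \<in> R" using n m by simp
  moreover have "z / ?p ^ m \<notin> maxid R"
    using maxid_div_unif[OF R, of "z / ?p ^ m"] n(1) m by (auto simp: field_simps)
  ultimately have "unit_at R (z / ?p ^ m)" using unit_at_iff[OF R] by blast
  then show ?thesis using p by (intro exI[of _ m] exI[of _ "z / ?p ^ m"]) simp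
qed

lemma valuation_decomp:
  assumes R: "place F R" and z: "z \<noteq> 0"
  shows "\<exists>n u. unit_at R u \<and> z = unif R powi n * u"
proof (cases "z \<in> R")
  case True
  then obtain n u where nu: "unit_at R u" "z = unif R ^ n * u" using valuation_decomp_ring[OF R _ z] by blast
  then show ?thesis by (intro exI[of _ "int n"] exI[of _ u]) simp
next
  case False
  then obtain n u where nu: "unit_at R u" "inverse z = unif R ^ n * u"
    using valuation_decomp_ring[OF R place_inverse[OF R False]] z by auto
  have "z = inverse (unif R ^ n * u)" using nu(2)[symmetric] by simp
  also have "\<dots> = unif R powi (- int n) * inverse u" by (simp add: power_int_minus)
  finally show ?thesis using unit_at_inverse[OF nu(1)] by blast
qed

lemma valuation_decomp_unique:
  assumes R: "place F R" and u: "unit_at R u" "unit_at R v" "unif R powi m * u = unif R powi n * v"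
  shows "m = n"
proof -
  have less: False if lt: "m < n" and u: "unit_at R u" "unit_at R v" and eq: "unif R powi m * u = unif R powi n * v" for m n u v
  proof -
    let ?p = "unif R"
    have p: "?p \<in> maxid R" "?p \<noteq> 0" using unif_maxid unif_nonzero R by auto
    have "n = m + int (nat (n - m))" using lt by simp
    then have "?p powi n = ?p powi m * ?p ^ nat (n - m)" using p by (metis power_int_add power_int_of_nat)
    then have "u = ?p ^ nat (n - m) * v" using eq p by (simp add: mult.assoc)
    moreover have "?p ^ nat (n - m) \<in> maxid R" using lt by (intro maxid_power R p) simp
    ultimately have "u \<in> maxid R" using maxid_mult[OF R] u by (simp add: unit_at_def)
    then show False using u unit_at_iff[OF R] by blast
  qed
  show ?thesis using less[of m n u v] less[of n m v u] u by (cases m n rule: linorder_cases) auto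
qed

lemma val_eqI:
  assumes R: "place F R" and u: "unit_at R u" "z = unif R powi n * u"
  shows "val R z = n"
  unfolding val_def unif_def[symmetric]
proof (rule the_equality)
  show "\<exists>u. u \<in> R \<and> u \<noteq> 0 \<and> inverse u \<in> R \<and> z = unif R powi n * u" using u unfolding unit_at_def by blast
next
  fix m assume "\<exists>u. u \<in> R \<and> u \<noteq> 0 \<and> inverse u \<in> R \<and> z = unif R powi m * u"
  then obtain v where "unit_at R v" "z = unif R powi m * v" unfolding unit_at_def by blast
  then show "m = n" using valuation_decomp_unique[OF R, of v u m n] u by simp
qed

lemma val_decomp:
  assumes R: "place F R" and z: "z \<noteq> 0"
  obtains n u where "unit_at R u" "z = unif R powi n * u" "val R z = n"
proof -
  obtain n u where nu: "unit_at R u" "z = unif R powi n * u" using valuation_decomp[OF R z] by blast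
  then show ?thesis using that val_eqI[OF R nu] by blast
qed

lemma val_mult:
  assumes R: "place F R" and "x \<noteq> 0" "y \<noteq> 0"
  shows "val R (x * y) = val R x + val R y"
proof -
  obtain m u where u: "unit_at R u" "x = unif R powi m * u" "val R x = m" using val_decomp[OF R assms(2)] .
  obtain n v where v: "unit_at R v" "y = unif R powi n * v" "val R y = n" using val_decomp[OF R assms(3)] .
  show ?thesis unfolding u(3) v(3)
  proof (rule val_eqI[OF R unit_at_mult[OF R u(1) v(1)]])
    show "x * y = unif R powi (m + n) * (u * v)"
      unfolding u(2) v(2) using unif_nonzero[OF R] by (simp add: power_int_add mult_ac)
  qed
qed

lemma val_unit: "place F R \<Longrightarrow> unit_at R u \<Longrightarrow> val R u = 0"
  using val_eqI[of R u u 0] by simp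

lemma val_1: "place F R \<Longrightarrow> val R 1 = 0"
  by (rule val_unit) (simp_all add: unit_at_def place_1)

lemma val_F: "place F R \<Longrightarrow> a \<in> F \<Longrightarrow> a \<noteq> 0 \<Longrightarrow> val R a = 0"
  by (rule val_unit) (simp_all add: unit_at_def place_F)

lemma val_inverse: "place F R \<Longrightarrow> z \<noteq> 0 \<Longrightarrow> val R (inverse z) = - val R z"
  using val_mult[of R z "inverse z"] val_1[of R] by simp

lemma val_powi: "place F R \<Longrightarrow> val R (unif R powi n) = n"
  using val_eqI[of R 1 "unif R powi n" n] by (simp add: unit_at_def place_1)

lemma val_power: "place F R \<Longrightarrow> z \<noteq> 0 \<Longrightarrow> val R (z ^ n) = int n * val R z"
  by (induction n) (simp_all add: val_1 val_mult distrib_right)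

lemma val_nonneg_iff:
  assumes R: "place F R" and z: "z \<noteq> 0"
  shows "val R z \<ge> 0 \<longleftrightarrow> z \<in> R"
proof -
  obtain n u where u: "unit_at R u" "z = unif R powi n * u" "val R z = n" using val_decomp[OF R z] .
  have uR: "u \<in> R" using u(1) by (simp add: unit_at_def)
  have p: "unif R \<in> maxid R" "unif R \<noteq> 0" using unif_maxid unif_nonzero R by auto
  have "n \<ge> 0 \<longleftrightarrow> z \<in> R"
  proof
    assume "n \<ge> 0"
    then have "unif R powi n = unif R ^ nat n" by (simp add: power_int_def)
    then show "z \<in> R" unfolding u(2) using p uR by (simp add: place_mult place_power R maxid_imp_place)
  next
    assume zR: "z \<in> R"
    show "n \<ge> 0"
    proof (rule ccontr)
      assume neg: "\<not> n \<ge> 0"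
      have "unif R powi n = inverse (unif R ^ nat (- n))" using neg by (simp add: power_int_def power_inverse)
      then have "u = unif R ^ nat (- n) * z" unfolding u(2) using p by simp
      also have "\<dots> \<in> maxid R" using neg zR by (intro maxid_mult maxid_power R p) auto
      finally show False using u(1) unit_at_iff[OF R] by blast
    qed
  qed
  then show ?thesis using u(3) by simp
qed

lemma val_pos_iff:
  assumes R: "place F R" and z: "z \<noteq> 0"
  shows "val R z \<ge> 1 \<longleftrightarrow> z \<in> maxid R"
proof -
  have "z \<in> maxid R \<longleftrightarrow> val R z \<ge> 0 \<and> \<not> val R (inverse z) \<ge> 0"
    using val_nonneg_iff[OF R] z by (simp add: maxid_iff)
  then show ?thesis using val_inverse[OF R z] by auto
qed

definition fil :: "'k set \<Rightarrow> int \<Rightarrow> 'k set" where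
  "fil R n = {z. z = 0 \<or> n \<le> val R z}"

text \<open>Rescaling by a power of the uniformizer turns a condition on orders into membership in
  \<open>R\<close>; closure properties of \<open>fil\<close> are then inherited from the
  ring.\<close>

lemma fil_iff: 
  assumes R: "place F R"
  shows "z \<in> fil R n \<longleftrightarrow> z * unif R powi (- n) \<in> R"
proof (cases "z = 0")
  case False
  have p: "unif R powi (- n) \<noteq> 0" using unif_nonzero[OF R] by simp
  have "val R (z * unif R powi (- n)) = val R z - n" using val_mult[OF R False p] val_powi[OF R] by simp
  then show ?thesis using val_nonneg_iff[OF R, of "z * unif R powi (- n)"] False p by (auto simp: fil_def)
qed (auto simp: fil_def place_0 R)

lemma fil_maxid_iff: 
  assumes R: "place F R"
  shows "z \<in> fil R (n + 1) \<longleftrightarrow> z * unif R powi (- n) \<in> maxid R"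
proof (cases "z = 0")
  case False
  have p: "unif R powi (- n) \<noteq> 0" using unif_nonzero[OF R] by simp
  have "val R (z * unif R powi (- n)) = val R z - n" using val_mult[OF R False p] val_powi[OF R] by simp
  then show ?thesis using val_pos_iff[OF R, of "z * unif R powi (- n)"] False p by (auto simp: fil_def)
qed (auto simp: fil_def maxid_0 R)

lemma fil_0: "0 \<in> fil R n" by (simp add: fil_def)

lemma fil_add: "place F R \<Longrightarrow> x \<in> fil R n \<Longrightarrow> y \<in> fil R n \<Longrightarrow> x + y \<in> fil R n"
  by (simp add: fil_iff distrib_right place_add)

lemma fil_diff: "place F R \<Longrightarrow> x \<in> fil R n \<Longrightarrow> y \<in> fil R n \<Longrightarrow> x - y \<in> fil R n"
  by (simp add: fil_iff left_diff_distrib place_diff)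

lemma fil_scale: "place F R \<Longrightarrow> a \<in> F \<Longrightarrow> x \<in> fil R n \<Longrightarrow> a * x \<in> fil R n"
  by (simp add: fil_iff mult.assoc place_mult place_F)

lemma fil_mult: "place F R \<Longrightarrow> x \<in> fil R m \<Longrightarrow> y \<in> fil R n \<Longrightarrow> x * y \<in> fil R (m + n)"
  by (cases "x = 0 \<or> y = 0") (auto simp: fil_def val_mult)

lemma fil_mono: "x \<in> fil R n \<Longrightarrow> m \<le> n \<Longrightarrow> x \<in> fil R m"
  by (auto simp: fil_def)

lemma fil_eq_place: "place F R \<Longrightarrow> fil R 0 = R"
  by (auto simp: fil_iff)

lemma fil_eq_maxid: "place F R \<Longrightarrow> fil R 1 = maxid R"
  using fil_maxid_iff[of R _ 0] by auto

end

section \<open>Residue fields and finiteness of zeros\<close>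

context finite_function_field
begin

text \<open>Residue classes are kept as cosets, so the residue field is the set \<open>res R\<close>
  followed by image of \<open>R\<close>, and its size is a plain cardinality.\<close>

definition res :: "'k set \<Rightarrow> 'k \<Rightarrow> 'k set" where
  "res R z = {y. y - z \<in> maxid R}"

lemma res_eq_iff:
  assumes R: "place F R"
  shows "res R x = res R y \<longleftrightarrow> x - y \<in> maxid R"
proof
  assume "res R x = res R y"
  moreover have "x \<in> res R x" by (simp add: res_def maxid_0 R)
  ultimately show "x - y \<in> maxid R" by (simp add: res_def)
next
  assume xy: "x - y \<in> maxid R"
  have "z - x \<in> maxid R \<longleftrightarrow> z - y \<in> maxid R" for z
    using maxid_add[OF R _ xy, of "z - x"] maxid_diff[OF R _ xy, of "z - y"] by auto
  then show "res R x = res R y" by (simp add: res_def)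
qed

text \<open>Modulo the maximal ideal, which contains \<open>t\<close>, a relation over F[t] reduces
  to its constant terms. So at most \<open>N\<close> residues are independent over \<open>F\<close>,
  and a largest independent set spans.\<close>

lemma residue_field_finite_dim:
  assumes R: "place F R"
  shows "\<exists>B. finite B \<and> B \<subseteq> R \<and> (\<forall>z\<in>R. \<exists>c. (\<forall>b\<in>B. c b \<in> F) \<and> z - (\<Sum>b\<in>B. c b * b) \<in> maxid R)"
proof -
  obtain t where t: "t \<in> maxid R" "t \<noteq> 0" using maxid_nontrivial[OF R] .
  from algebraic_relation[OF t(2)] obtain N where N: "\<And>y :: nat \<Rightarrow> 'k. \<exists>d c. (\<forall>j i. c j i \<in> F) \<and> (\<exists>j\<le>N. c j 0 \<noteq> 0) \<and>
     (\<Sum>j\<le>N. \<Sum>i\<le>d. c j i * t ^ i * y j) = 0" by blast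
  define ind where "ind B \<longleftrightarrow> finite B \<and> B \<subseteq> R \<and>
    (\<forall>c. (\<forall>b\<in>B. c b \<in> F) \<longrightarrow> (\<Sum>b\<in>B. c b * b) \<in> maxid R \<longrightarrow> (\<forall>b\<in>B. c b = 0))" for B
  have ind_card: "card B \<le> N" if B: "ind B" for B
  proof (rule ccontr)
    assume "\<not> card B \<le> N"
    then obtain B' where B': "B' \<subseteq> B" "card B' = Suc N" "finite B'"
      using obtain_subset_with_card_n[of "Suc N" B] by auto
    obtain y where y: "bij_betw y {..N} B'"
      using ex_bij_betw_nat_finite[OF B'(3)] B'(2) by (metis atLeast0LessThan lessThan_Suc_atMost)
    from N[of y] obtain d c where c: "\<And>j i. c j i \<in> F" "\<exists>j\<le>N. c j 0 \<noteq> 0"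
      "(\<Sum>j\<le>N. \<Sum>i\<le>d. c j i * t ^ i * y j) = 0" by blast
    have yR: "y j \<in> R" if "j \<le> N" for j using y B B' that unfolding ind_def bij_betw_def by auto
    have "(\<Sum>i\<le>d. c j i * t ^ i * y j) = c j 0 * y j + (\<Sum>i\<in>{1..d}. c j i * t ^ i * y j)" for j
    proof -
      have "{..d} = insert 0 {1..d}" by auto
      then show ?thesis by simp
    qed
    then have "(\<Sum>j\<le>N. c j 0 * y j) = - (\<Sum>j\<le>N. \<Sum>i\<in>{1..d}. c j i * t ^ i * y j)"
      using c(3) by (simp add: sum.distrib eq_neg_iff_add_eq_0)
    also have "\<dots> \<in> maxid R"
    proof (intro maxid_uminus maxid_sum R)
      fix j i assume "j \<in> {..N}" "i \<in> {1..d}"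
      then show "c j i * t ^ i * y j \<in> maxid R"
        using yR c(1) by (simp add: maxid_mult maxid_mult' maxid_power t R place_F)
    qed
    finally have rel: "(\<Sum>j\<le>N. c j 0 * y j) \<in> maxid R" .
    define y' where "y' = inv_into {..N} y"
    have y': "y' (y j) = j" if "j \<le> N" for j unfolding y'_def using y that by (simp add: bij_betw_def)
    let ?c = "\<lambda>b. if b \<in> B' then c (y' b) 0 else 0"
    have "(\<Sum>b\<in>B. ?c b * b) = (\<Sum>b\<in>B'. ?c b * b)"
      by (rule sum.mono_neutral_right) (use B B' in \<open>auto simp: ind_def\<close>)
    also have "\<dots> = (\<Sum>j\<le>N. ?c (y j) * y j)" by (rule sum.reindex_bij_betw[OF y, symmetric])
    also have "\<dots> = (\<Sum>j\<le>N. c j 0 * y j)" using y y' by (intro sum.cong) (auto simp: bij_betw_def)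
    finally have "(\<Sum>b\<in>B. ?c b * b) \<in> maxid R" using rel by simp
    then have z: "\<forall>b\<in>B. ?c b = 0"
      using B c(1) unfolding ind_def by (elim conjE allE[of _ ?c]) auto
    have "c j 0 = 0" if "j \<le> N" for j
    proof -
      have "y j \<in> B'" using y that by (auto simp: bij_betw_def)
      then show ?thesis using z B' y'[OF that] by force
    qed
    then show False using c(2) by blast
  qed
  have "ind {}" by (simp add: ind_def)
  then have "\<exists>B. ind B \<and> (\<forall>B'. ind B' \<longrightarrow> card B' \<le> card B)"
    using ind_card by (intro ex_has_greatest_nat[of ind "{}" card "Suc N"]) (auto simp: less_Suc_eq_le)
  then obtain B where B: "ind B" "\<And>B'. ind B' \<Longrightarrow> card B' \<le> card B" by blast
  have "\<exists>c. (\<forall>b\<in>B. c b \<in> F) \<and> z - (\<Sum>b\<in>B. c b * b) \<in> maxid R" if z: "z \<in> R" for z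
  proof (cases "z \<in> B")
    case True
    have "(\<Sum>b\<in>B. (if b = z then 1 else 0) * b) = (\<Sum>b\<in>B. if b = z then b else 0)"
      by (rule sum.cong) auto
    also have "\<dots> = z" using True B(1) unfolding ind_def by (simp add: sum.delta)
    finally have "(\<Sum>b\<in>B. (if b = z then 1 else 0) * b) = z" .
    then show ?thesis by (intro exI[of _ "\<lambda>b. if b = z then 1 else 0"]) (simp add: maxid_0 R)
  next
    case False
    then have "\<not> ind (insert z B)" using B(2)[of "insert z B"] B(1) by (auto simp: ind_def)
    then obtain c where c: "\<forall>b\<in>insert z B. c b \<in> F" "(\<Sum>b\<in>insert z B. c b * b) \<in> maxid R"
      "\<exists>b\<in>insert z B. c b \<noteq> 0" using B(1) z unfolding ind_def by blast
    have s: "c z * z + (\<Sum>b\<in>B. c b * b) \<in> maxid R" using c(2) False B(1) by (simp add: ind_def)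
    have cz: "c z \<noteq> 0"
    proof
      assume "c z = 0"
      then show False using s c B(1) unfolding ind_def by auto
    qed
    have "inverse (c z) * (c z * z + (\<Sum>b\<in>B. c b * b)) \<in> maxid R"
      using maxid_mult'[OF R s] place_F[OF R, of "inverse (c z)"] c(1) by simp
    also have "inverse (c z) * (c z * z + (\<Sum>b\<in>B. c b * b)) = z - (\<Sum>b\<in>B. (- inverse (c z) * c b) * b)"
      using cz by (simp add: distrib_left sum_distrib_left sum_negf mult.assoc)
    finally show ?thesis using c(1) by (intro exI[of _ "\<lambda>b. - inverse (c z) * c b"]) simp
  qed
  then show ?thesis using B(1) unfolding ind_def by blast
qed

lemma card_residue_field:
  assumes R: "place F R"
  shows "finite (res R ` R)" "card (res R ` R) = q ^ pdeg F R"
proof -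
  from Least_dimension_basis[OF module_mult fsubspace_maxid[OF R] residue_field_finite_dim[OF R], folded pdeg_def]
  obtain B where B: "finite B" "B \<subseteq> R" "card B = pdeg F R"
    "\<And>z. z \<in> R \<Longrightarrow> \<exists>c. (\<forall>b\<in>B. c b \<in> F) \<and> z - (\<Sum>b\<in>B. c b * b) \<in> maxid R"
    "\<And>c b. (\<And>b. b \<in> B \<Longrightarrow> c b \<in> F) \<Longrightarrow> (\<Sum>b\<in>B. c b * b) \<in> maxid R \<Longrightarrow> b \<in> B \<Longrightarrow> c b = 0"
    by blast
  have bij: "bij_betw (\<lambda>c. res R (\<Sum>b\<in>B. c b * b)) (B \<rightarrow>\<^sub>E F) (res R ` R)"
  proof (rule bij_betwI')
    fix c d assume c: "c \<in> B \<rightarrow>\<^sub>E F" and d: "d \<in> B \<rightarrow>\<^sub>E F"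
    show "(res R (\<Sum>b\<in>B. c b * b) = res R (\<Sum>b\<in>B. d b * b)) = (c = d)"
    proof
      assume "res R (\<Sum>b\<in>B. c b * b) = res R (\<Sum>b\<in>B. d b * b)"
      then have "(\<Sum>b\<in>B. (c b - d b) * b) \<in> maxid R"
        by (simp add: res_eq_iff[OF R] left_diff_distrib sum_subtractf)
      moreover have "c b - d b \<in> F" if "b \<in> B" for b
        using PiE_mem[OF c that] PiE_mem[OF d that] by simp
      ultimately have "c b - d b = 0" if "b \<in> B" for b
        using B(5)[of "\<lambda>b. c b - d b" b] that by blast
      then show "c = d" using c d by (intro PiE_ext[OF c d]) simp
    qed simp
  next
    fix c assume c: "c \<in> B \<rightarrow>\<^sub>E F"
    have "fsubspace (*) R" using R by (auto simp: fsubspace_def place_0 place_add place_mult place_F)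
    then have "(\<Sum>b\<in>B. c b * b) \<in> R"
      using PiE_mem[OF c] B(2) by (intro fsubspace_sum) (auto simp: place_mult[OF R] place_F[OF R])
    then show "res R (\<Sum>b\<in>B. c b * b) \<in> res R ` R" by blast
  next
    fix w assume "w \<in> res R ` R"
    then obtain z where z: "z \<in> R" "w = res R z" by blast
    then obtain c where c: "\<forall>b\<in>B. c b \<in> F" "z - (\<Sum>b\<in>B. c b * b) \<in> maxid R" using B(4) by blast
    then show "\<exists>c\<in>B \<rightarrow>\<^sub>E F. w = res R (\<Sum>b\<in>B. c b * b)"
      using z res_eq_iff[OF R] by (intro bexI[of _ "restrict c B"]) auto
  qed
  have "finite (B \<rightarrow>\<^sub>E F)" by (rule finite_PiE) (simp_all add: B finite_F)
  then show "finite (res R ` R)" using bij_betw_finite[OF bij] by blast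
  show "card (res R ` R) = q ^ pdeg F R" using bij_betw_same_card[OF bij] B by (simp add: card_PiE)
qed

section \<open>Separating places and finiteness of zeros\<close>

lemma place_subset_eq:
  assumes R: "place F R" and Q: "place F Q" and sub: "R \<subseteq> Q"
  shows "R = Q"
proof (rule ccontr)
  assume "R \<noteq> Q"
  then obtain z where z: "z \<in> Q" "z \<notin> R" using sub by blast
  then have z0: "z \<noteq> 0" using place_0[OF R] by auto
  have neg: "val R z < 0" using val_nonneg_iff[OF R z0] z by auto
  have "y \<in> Q" if "y \<noteq> 0" for y
  proof -
    \<comment> \<open>This power of \<open>z\<close> has at \<open>R\<close> a pole at least as bad
      as that of \<open>y\<close>, so \<open>y / z ^ n\<close> lies in \<open>R\<close>. Hence
      \<open>z\<close> and \<open>R\<close> together generate the whole field.\<close>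
    define n where "n = nat (- val R y)"
    have yz: "y / z ^ n \<noteq> 0" using that z0 by simp
    have "val R (y / z ^ n) = val R y - int n * val R z"
      using val_mult[OF R that, of "inverse (z ^ n)"] val_inverse[OF R, of "z ^ n"] val_power[OF R z0] z0
      by (simp add: divide_inverse)
    moreover have "int n * - val R z \<ge> int n * 1" using neg by (intro mult_left_mono) auto
    moreover have "int n \<ge> - val R y" by (simp add: n_def)
    ultimately have "val R (y / z ^ n) \<ge> 0" by simp
    then have "y / z ^ n \<in> Q" using val_nonneg_iff[OF R yz] sub by blast
    then have "y / z ^ n * z ^ n \<in> Q" using place_mult[OF Q] place_power[OF Q z(1)] by blast
    then show ?thesis using z0 by simp
  qed
  then have "Q = UNIV" using place_0[OF Q] by (metis UNIV_eq_I)
  then show False using place_nontrivial[OF Q] by blast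
qed

text \<open>One place \<open>Q\<close> is added at a time. A quotient \<open>z\<close> with a zero
  at \<open>P\<close> and a pole at \<open>Q\<close> exists because neither ring contains the other,
  and a large power of \<open>z\<close> is added to the function \<open>y\<close> found so
  far.\<close>

lemma separating_function:
  assumes P: "place F P" and S: "finite S" "\<And>Q. Q \<in> S \<Longrightarrow> place F Q" "P \<notin> S"
  shows "\<exists>y \<in> maxid P. \<forall>Q\<in>S. y \<notin> Q"
  using S
proof (induction S)
  case empty
  then show ?case using maxid_0[OF P] by blast
next
  case (insert Q S)
  then obtain y where y: "y \<in> maxid P" "\<And>R. R \<in> S \<Longrightarrow> y \<notin> R" by blast
  have Q: "place F Q" "P \<noteq> Q" using insert by auto
  obtain a where a: "a \<in> P" "a \<notin> Q" using place_subset_eq[OF P Q(1)] Q by blast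
  obtain b where b: "b \<in> Q" "b \<notin> P" using place_subset_eq[OF Q(1) P] Q by blast
  define z where "z = a / b"
  have zP: "z \<in> maxid P" using maxid_mult[OF P inverse_in_maxid[OF P b(2)] a(1)] by (simp add: z_def field_simps)
  have zQ: "z \<notin> Q"
  proof
    assume "z \<in> Q"
    then have "z * b \<in> Q" using place_mult[OF Q(1)] b by blast
    moreover have "b \<noteq> 0" using b place_0[OF P] by auto
    ultimately show False using a by (simp add: z_def)
  qed
  have z0: "z \<noteq> 0" using zQ place_0[OF Q(1)] by auto
  show ?case
  proof (cases "y \<in> Q")
    case False
    then show ?thesis using y by blast
  next
    case yQ: True
    \<comment> \<open>Larger than the pole order of \<open>y\<close> at every place of
      \<open>S\<close>. Where \<open>z\<close> has a pole too, \<open>z ^ r\<close> therefore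
      dominates \<open>y\<close>, and no cancellation can remove the pole.\<close>
    define r where "r = Suc (\<Sum>R\<in>S. nat (- val R y))"
    have zr: "z ^ r \<notin> R" if R: "place F R" and "z \<notin> R" for R
    proof -
      have "val R z < 0" using val_nonneg_iff[OF R z0] that by auto
      moreover have "int r > 0" by (simp only: r_def of_nat_0_less_iff zero_less_Suc)
      ultimately have "val R (z ^ r) < 0" using val_power[OF R z0, of r] by (simp only: mult_pos_neg)
      then show ?thesis using val_nonneg_iff[OF R, of "z ^ r"] z0 by auto
    qed
    have "y + z ^ r \<notin> Q" using place_diff[OF Q(1) _ yQ, of "y + z ^ r"] zr[OF Q(1) zQ] by auto
    moreover have "y + z ^ r \<notin> R" if RS: "R \<in> S" for R
    proof -
      have R: "place F R" using insert.prems RS by blast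
      have yR: "y \<notin> R" using y(2) RS by blast
      then have y0: "y \<noteq> 0" using place_0[OF R] by auto
      show ?thesis
      proof (cases "z \<in> R")
        case True
        then show ?thesis using place_diff[OF R _ place_power[OF R True], of "y + z ^ r" r] yR by auto
      next
        case False
        have neg: "val R z < 0" using val_nonneg_iff[OF R z0] False by auto
        have "nat (- val R y) \<le> (\<Sum>R\<in>S. nat (- val R y))"
          using insert.hyps RS by (intro member_le_sum) auto
        then have "int r > - val R y" unfolding r_def by linarith
        moreover have "int r * - val R z \<ge> int r * 1" using neg by (intro mult_left_mono) auto
        ultimately have "val R (y / z ^ r) \<ge> 1"
          using val_mult[OF R y0, of "inverse (z ^ r)"] val_inverse[OF R, of "z ^ r"] val_power[OF R z0, of r] z0
          by (simp add: divide_inverse)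
        then have m: "y / z ^ r \<in> maxid R" using val_pos_iff[OF R, of "y / z ^ r"] y0 z0 by simp
        have "1 + y / z ^ r \<in> R" using m maxid_imp_place place_add[OF R place_1[OF R]] by blast
        moreover have "1 + y / z ^ r \<notin> maxid R"
          using maxid_diff[OF R _ m, of "1 + y / z ^ r"] one_notin_maxid[OF R] by auto
        ultimately have "unit_at R (1 + y / z ^ r)" using unit_at_iff[OF R] by blast
        then have i: "inverse (1 + y / z ^ r) \<in> R" "1 + y / z ^ r \<noteq> 0" by (auto simp: unit_at_def)
        have eq: "z ^ r = (y + z ^ r) * inverse (1 + y / z ^ r)"
        proof -
          have "y + z ^ r = z ^ r * (1 + y / z ^ r)" using z0 by (simp add: distrib_left)
          then show ?thesis using i(2) by (simp only: mult.assoc right_inverse mult_1_right not_False_eq_True)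
        qed
        show ?thesis using place_mult[OF R _ i(1), of "y + z ^ r"] zr[OF R False] eq by metis
      qed
    qed
    moreover have "y + z ^ r \<in> maxid P" using y zP by (intro maxid_add maxid_power P) (auto simp: r_def)
    ultimately show ?thesis by blast
  qed
qed

text \<open>If \<open>y\<close> vanishes at \<open>P\<close> and has poles on \<open>S\<close>, then
  \<open>1 / (1 + y)\<close> is 1 at \<open>P\<close> and 0 on \<open>S\<close>.\<close>

lemma approximate_indicator:
  assumes P: "place F P" and S: "finite S" "\<And>Q. Q \<in> S \<Longrightarrow> place F Q" "P \<notin> S"
  shows "\<exists>y. y - 1 \<in> maxid P \<and> (\<forall>Q\<in>S. y \<in> maxid Q)"
proof -
  obtain y where y: "y \<in> maxid P" "\<And>Q. Q \<in> S \<Longrightarrow> y \<notin> Q" using separating_function[OF assms] by blast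
  have "1 + y \<notin> maxid P" using maxid_diff[OF P _ y(1), of "1 + y"] one_notin_maxid[OF P] by auto
  moreover have "1 + y \<in> P" using place_add[OF P place_1[OF P] maxid_imp_place[OF y(1)]] .
  ultimately have u: "unit_at P (1 + y)" using unit_at_iff[OF P] by blast
  then have "inverse (1 + y) - 1 = - y * inverse (1 + y)" by (simp add: unit_at_def field_simps)
  moreover have "- y * inverse (1 + y) \<in> maxid P"
    using u y by (intro maxid_mult maxid_uminus P) (auto simp: unit_at_def)
  moreover have "inverse (1 + y) \<in> maxid Q" if "Q \<in> S" for Q
  proof -
    have Q: "place F Q" using S that by blast
    have "1 + y \<notin> Q" using place_diff[OF Q _ place_1[OF Q], of "1 + y"] y(2)[OF that] by auto
    then show ?thesis by (rule inverse_in_maxid[OF Q])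
  qed
  ultimately show ?thesis by (intro exI[of _ "inverse (1 + y)"]) simp
qed

text \<open>At \<open>N + 1\<close> common zeros of \<open>t\<close>, take approximate indicators
  \<open>y j\<close>. In a relation between them over F[t], look at the place with index
  \<open>l\<close> where \<open>c l 0\<close> is nonzero: all other terms vanish there, but this one
  does not.\<close>

lemma finite_zeros:
  assumes "t \<noteq> 0"
  shows "finite {R. place F R \<and> t \<in> maxid R}"
proof (rule ccontr)
  assume inf: "infinite {R. place F R \<and> t \<in> maxid R}"
  from algebraic_relation[OF assms] obtain N where N: "\<And>y :: nat \<Rightarrow> 'k. \<exists>d c. (\<forall>j i. c j i \<in> F) \<and> (\<exists>j\<le>N. c j 0 \<noteq> 0) \<and>
     (\<Sum>j\<le>N. \<Sum>i\<le>d. c j i * t ^ i * y j) = 0" by blast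
  obtain Z where Z: "Z \<subseteq> {R. place F R \<and> t \<in> maxid R}" "finite Z" "card Z = Suc N"
    using infinite_arbitrarily_large[OF inf] by blast
  obtain P where P: "bij_betw P {..N} Z"
    using ex_bij_betw_nat_finite[OF Z(2)] Z(3) by (metis atLeast0LessThan lessThan_Suc_atMost)
  have PP: "place F (P j)" "t \<in> maxid (P j)" if "j \<le> N" for j using P Z(1) that by (auto simp: bij_betw_def)
  have "\<exists>y. y - 1 \<in> maxid (P j) \<and> (\<forall>Q\<in>P ` ({..N} - {j}). y \<in> maxid Q)" if "j \<le> N" for j
    by (rule approximate_indicator) (use PP that P in \<open>auto simp: bij_betw_def inj_on_def\<close>)
  then obtain y where y: "\<And>j. j \<le> N \<Longrightarrow> y j - 1 \<in> maxid (P j)"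
    "\<And>j i. j \<le> N \<Longrightarrow> i \<le> N \<Longrightarrow> i \<noteq> j \<Longrightarrow> y j \<in> maxid (P i)" by (metis DiffI atMost_iff empty_iff imageI insert_iff)
  from N[of y] obtain d c where c: "\<And>j i. c j i \<in> F" "\<exists>j\<le>N. c j 0 \<noteq> 0"
    "(\<Sum>j\<le>N. \<Sum>i\<le>d. c j i * t ^ i * y j) = 0" by blast
  then obtain l where l: "l \<le> N" "c l 0 \<noteq> 0" by blast
  note R = PP(1)[OF l(1)]
  have yl: "y l \<in> P l" using place_add[OF R maxid_imp_place[OF y(1)[OF l(1)]] place_1[OF R]] by simp
  have yR: "y j \<in> P l" if "j \<le> N" for j
    using yl y(2)[OF that l(1)] maxid_imp_place by (cases "j = l") auto
  let ?w = "\<lambda>(j, i). c j i * t ^ i * y j"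
  have "0 = sum ?w ({..N} \<times> {..d})" using c(3) by (simp add: sum.cartesian_product)
  also have "\<dots> = ?w (l, 0) + sum ?w ({..N} \<times> {..d} - {(l, 0)})" using l by (subst sum.remove[of _ "(l, 0)"]) auto
  finally have "?w (l, 0) = - sum ?w ({..N} \<times> {..d} - {(l, 0)})" by (simp add: eq_neg_iff_add_eq_0)
  also have "\<dots> \<in> maxid (P l)"
  proof (intro maxid_uminus maxid_sum R)
    fix b assume b: "b \<in> {..N} \<times> {..d} - {(l, 0)}"
    obtain j i where ji: "b = (j, i)" by (cases b)
    have cR: "c j i \<in> P l" using place_F[OF R c(1)] .
    have "c j i * t ^ i * y j \<in> maxid (P l)"
    proof (cases "i = 0")
      case True
      then have "y j \<in> maxid (P l)" using b ji y(2)[of j l] l by auto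
      then show ?thesis using True maxid_mult'[OF R _ cR] by simp
    next
      case False
      then have "t ^ i \<in> maxid (P l)" using maxid_power[OF R PP(2)[OF l(1)]] by simp
      then show ?thesis using maxid_mult[OF R maxid_mult'[OF R _ cR] yR] b ji by simp
    qed
    then show "?w b \<in> maxid (P l)" by (simp add: ji)
  qed
  finally have "c l 0 * y l \<in> maxid (P l)" by simp
  then have "y l \<in> maxid (P l)" using maxid_cancel_F[OF R c(1) l(2)] by blast
  then have "1 \<in> maxid (P l)" using maxid_diff[OF R _ y(1)[OF l(1)], of "y l"] by simp
  then show False using one_notin_maxid[OF R] by blast
qed

lemma finite_poles: "finite {R. place F R \<and> z \<notin> R}"
proof (cases "z = 0")
  case True
  then have "{R. place F R \<and> z \<notin> R} = {}" using place_0 by auto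
  then show ?thesis by (simp only: finite.emptyI)
next
  case False
  have "{R. place F R \<and> z \<notin> R} \<subseteq> {R. place F R \<and> inverse z \<in> maxid R}" using inverse_in_maxid by auto
  then show ?thesis using finite_zeros[of "inverse z"] False finite_subset by auto
qed

end

section \<open>Divisors and Riemann's inequality\<close>

context finite_function_field
begin

lemma divisor_combine:
  assumes "divisor F A" "divisor F B" "\<And>R. A R = 0 \<Longrightarrow> B R = 0 \<Longrightarrow> C R = 0"
  shows "divisor F C"
proof -
  have sub: "{R. C R \<noteq> 0} \<subseteq> {R. A R \<noteq> 0} \<union> {R. B R \<noteq> 0}" using assms(3) by blast
  have "finite {R. C R \<noteq> 0}" by (rule finite_subset[OF sub]) (use assms in \<open>simp add: divisor_def\<close>)
  moreover have "place F R" if "C R \<noteq> 0" for R using sub that assms unfolding divisor_def by blast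
  ultimately show ?thesis unfolding divisor_def by blast
qed

lemma divisor_add: "divisor F A \<Longrightarrow> divisor F B \<Longrightarrow> divisor F (A + B)"
  using divisor_combine[of A B "A + B"] by simp

lemma divisor_diff: "divisor F A \<Longrightarrow> divisor F B \<Longrightarrow> divisor F (A - B)"
  using divisor_combine[of A B "A - B"] by simp

lemma divisor_0: "divisor F 0"
  by (simp add: divisor_def)

definition pt :: "int \<Rightarrow> 'k set \<Rightarrow> 'k set \<Rightarrow> int" where
  "pt m P = (\<lambda>R. if R = P then m else 0)"

lemma divisor_pt: "place F P \<Longrightarrow> divisor F (pt m P)"
  by (auto simp: divisor_def pt_def)

lemma ddeg_eq_sum:
  assumes "finite S" "{R. A R \<noteq> 0} \<subseteq> S"
  shows "ddeg F A = (\<Sum>R\<in>S. A R * int (pdeg F R))"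
  unfolding ddeg_def by (rule sum.mono_neutral_left) (use assms in auto)

lemma ddeg_add:
  assumes "divisor F A" "divisor F B"
  shows "ddeg F (A + B) = ddeg F A + ddeg F B"
proof -
  let ?S = "{R. A R \<noteq> 0} \<union> {R. B R \<noteq> 0}"
  have fin: "finite ?S" using assms by (auto simp: divisor_def)
  show ?thesis
    using ddeg_eq_sum[OF fin, of A] ddeg_eq_sum[OF fin, of B] ddeg_eq_sum[OF fin, of "A + B"]
    by (force simp: distrib_right sum.distrib)
qed

lemma ddeg_diff:
  assumes "divisor F A" "divisor F B"
  shows "ddeg F (A - B) = ddeg F A - ddeg F B"
  using ddeg_add[OF divisor_diff[OF assms] assms(2)] by simp

lemma ddeg_0: "ddeg F 0 = 0"
  by (simp add: ddeg_def)

lemma ddeg_pt: "ddeg F (pt m P) = m * int (pdeg F P)"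
proof -
  have "{R. pt m P R \<noteq> 0} \<subseteq> {P}" by (auto simp: pt_def)
  then show ?thesis using ddeg_eq_sum[of "{P}" "pt m P"] by (simp add: pt_def)
qed

lemma ddeg_nonneg:
  assumes "divisor F A" "\<And>R. place F R \<Longrightarrow> A R \<ge> 0"
  shows "ddeg F A \<ge> 0"
  unfolding ddeg_def using assms by (intro sum_nonneg) (auto simp: divisor_def)

text \<open>Passes from \<open>A\<close> to \<open>B\<close> by adding one place at a time. The
  proof removes places from \<open>B\<close> instead, and the measure \<open>m\<close> sums the
  remaining gaps over a fixed finite support.\<close>

lemma divisor_le_induct [consumes 3, case_names base step]:
  assumes A: "divisor F A" and B: "divisor F B" and le: "\<And>R. A R \<le> B R"
    and base: "P A"
    and step: "\<And>C Q. divisor F C \<Longrightarrow> place F Q \<Longrightarrow> P C \<Longrightarrow> P (C + pt 1 Q)"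
  shows "P B"
proof -
  define m where "m C = (\<Sum>R\<in>{R. A R \<noteq> 0} \<union> {R. B R \<noteq> 0}. nat (C R - A R))" for C :: "'k set \<Rightarrow> int"
  have fin: "finite ({R. A R \<noteq> 0} \<union> {R. B R \<noteq> 0})" using A B by (auto simp: divisor_def)
  have "P C" if "divisor F C" "\<And>R. A R \<le> C R" "{R. C R \<noteq> 0} \<subseteq> {R. A R \<noteq> 0} \<union> {R. B R \<noteq> 0}" for C
    using that
  proof (induction "m C" arbitrary: C rule: less_induct)
    case less
    show ?case
    proof (cases "C = A")
      case False
      then obtain Q where Q: "A Q < C Q" using less.prems(2) by (metis ext order_le_less)
      then have "A Q \<noteq> 0 \<or> C Q \<noteq> 0" by auto
      then have QS: "Q \<in> {R. A R \<noteq> 0} \<union> {R. B R \<noteq> 0}" using less.prems(3) by blast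
      then have plQ: "place F Q" using A B by (auto simp: divisor_def)
      let ?C = "C - pt 1 Q"
      have div: "divisor F ?C" using less.prems(1) plQ by (intro divisor_diff divisor_pt)
      have "m ?C < m C" unfolding m_def
        by (rule sum_strict_mono_ex1[OF fin]) (use Q QS in \<open>auto simp: pt_def\<close>)
      then have "P ?C"
        by (rule less.hyps) (use div Q QS less.prems in \<open>auto simp: pt_def split: if_splits\<close>)
      from step[OF div plQ this] show ?thesis by simp
    qed (use base in simp)
  qed
  then show ?thesis using B le by auto
qed

definition dv :: "'k \<Rightarrow> 'k set \<Rightarrow> int" where
  "dv f = (\<lambda>R. if place F R then val R f else 0)"

lemma divisor_dv:
  assumes "f \<noteq> 0"
  shows "divisor F (dv f)"
proof -
  have "{R. dv f R \<noteq> 0} \<subseteq> {R. place F R \<and> f \<in> maxid R} \<union> {R. place F R \<and> f \<notin> R}"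
  proof
    fix R assume "R \<in> {R. dv f R \<noteq> 0}"
    then have R: "place F R" "val R f \<noteq> 0" by (auto simp: dv_def split: if_splits)
    then show "R \<in> {R. place F R \<and> f \<in> maxid R} \<union> {R. place F R \<and> f \<notin> R}"
      using val_nonneg_iff[OF R(1) assms] val_pos_iff[OF R(1) assms] by auto
  qed
  then have "finite {R. dv f R \<noteq> 0}"
    using finite_zeros[OF assms] finite_poles finite_subset by blast
  then show ?thesis by (auto simp: divisor_def dv_def split: if_splits)
qed

lemma dv_mult: "f \<noteq> 0 \<Longrightarrow> h \<noteq> 0 \<Longrightarrow> dv (f * h) = dv f + dv h"
  by (auto simp: dv_def val_mult fun_eq_iff)

lemma dv_inverse: "f \<noteq> 0 \<Longrightarrow> dv (inverse f) = 0 - dv f"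
  by (auto simp: dv_def val_inverse fun_eq_iff)

lemma dv_1: "dv 1 = 0"
  by (auto simp: dv_def val_1 fun_eq_iff)

lemma LL_iff: "f \<in> LL F A \<longleftrightarrow> (\<forall>R. place F R \<longrightarrow> f \<in> fil R (- A R))"
  by (fastforce simp: LL_def fil_def)

lemma fsubspace_LL: "fsubspace (*) (LL F A)"
  by (simp add: fsubspace_def LL_iff fil_0 fil_add fil_scale)

lemma LL_diff: "f \<in> LL F A \<Longrightarrow> h \<in> LL F A \<Longrightarrow> f - h \<in> LL F A"
  by (simp add: LL_iff fil_diff)

lemma LL_mono: "(\<And>R. place F R \<Longrightarrow> A R \<le> B R) \<Longrightarrow> LL F A \<subseteq> LL F B"
  by (force simp: LL_iff intro: fil_mono)

lemma LL_mult: "f \<in> LL F A \<Longrightarrow> h \<in> LL F B \<Longrightarrow> f * h \<in> LL F (A + B)"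
  using fil_mult by (fastforce simp: LL_iff)

lemma LL_dv: "f \<noteq> 0 \<Longrightarrow> f \<in> LL F (0 - dv f)"
  by (simp add: LL_iff fil_def dv_def)

lemma LL_shift:
  assumes h: "h \<noteq> 0"
  shows "LL F (A - dv h) = (*) h ` LL F A"
proof
  show "(*) h ` LL F A \<subseteq> LL F (A - dv h)"
    using LL_mult[OF LL_dv[OF h], of _ A] by (auto simp: diff_add_eq)
  show "LL F (A - dv h) \<subseteq> (*) h ` LL F A"
  proof
    fix f assume "f \<in> LL F (A - dv h)"
    then have "inverse h * f \<in> LL F (0 - dv (inverse h) + (A - dv h))"
      using LL_mult[OF LL_dv[of "inverse h"]] h by simp
    then have "inverse h * f \<in> LL F A" using h by (simp add: dv_inverse)
    then show "f \<in> (*) h ` LL F A" using h by (intro image_eqI[of _ _ "inverse h * f"]) (auto simp: mult.assoc[symmetric])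
  qed
qed

text \<open>Bases are transported directly rather than by counting, because finiteness of
  \<open>LL F A\<close> rests on \<open>ddeg_dv\<close>, which in turn rests on this lemma.\<close>

lemma kdim_scale:
  assumes h: "h \<noteq> 0"
  shows "kdim F ((*) h ` V) = kdim F V"
proof -
  have imp: "\<exists>B. finite B \<and> B \<subseteq> (*) h ` V \<and> card B = d \<and> (*) h ` V \<subseteq> kspan F B"
    if ex: "\<exists>B. finite B \<and> B \<subseteq> V \<and> card B = d \<and> V \<subseteq> kspan F B" and h: "h \<noteq> 0" for d V h
  proof -
    obtain B where B: "finite B" "B \<subseteq> V" "card B = d" "V \<subseteq> kspan F B" using ex by blast
    have inj: "inj_on ((*) h) B" using h by (auto simp: inj_on_def)
    have "h * v \<in> kspan F ((*) h ` B)" if "v \<in> V" for v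
    proof -
      obtain c where c: "v = (\<Sum>b\<in>B. c b * b)" "\<forall>b\<in>B. c b \<in> F" using B(4) \<open>v \<in> V\<close> unfolding kspan_def by blast
      have inv: "inverse h * (h * b) = b" for b using h by (simp flip: mult.assoc)
      have "(\<Sum>b\<in>(*) h ` B. c (inverse h * b) * b) = (\<Sum>b\<in>B. c b * (h * b))"
        by (simp only: sum.reindex[OF inj] o_def inv)
      also have "\<dots> = h * v" unfolding c(1) sum_distrib_left by (intro sum.cong) (simp_all add: mult.left_commute)
      finally have "h * v = (\<Sum>b\<in>(*) h ` B. c (inverse h * b) * b)" by simp
      moreover have "\<forall>b\<in>(*) h ` B. c (inverse h * b) \<in> F" using c(2) by (simp only: ball_simps inv)
      ultimately show ?thesis unfolding kspan_def
        by (intro CollectI exI[of _ "\<lambda>b. c (inverse h * b)"] conjI)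
    qed
    then show ?thesis using B card_image[OF inj] by (intro exI[of _ "(*) h ` B"]) auto
  qed
  have "(*) (inverse h) ` (*) h ` V = V" using h by (simp add: image_image mult.assoc[symmetric])
  then have "(\<exists>B. finite B \<and> B \<subseteq> (*) h ` V \<and> card B = d \<and> (*) h ` V \<subseteq> kspan F B)
     \<longleftrightarrow> (\<exists>B. finite B \<and> B \<subseteq> V \<and> card B = d \<and> V \<subseteq> kspan F B)" for d
    using imp[of V d h] imp[of "(*) h ` V" d "inverse h"] h by auto
  then show ?thesis unfolding kdim_def by simp
qed

lemma ell_shift: "h \<noteq> 0 \<Longrightarrow> ell F (A - dv h) = ell F A"
  by (simp add: ell_def LL_shift kdim_scale)

text \<open>\<open>h\<close> takes the leading coefficient at \<open>Q\<close>: a function in the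
  larger space has order at least \<open>- (A Q + 1)\<close> there, and it lies in
  \<open>LL F A\<close> exactly when the residue after rescaling is zero.\<close>

lemma LL_step:
  assumes Q: "place F Q"
  defines "h \<equiv> \<lambda>A f. res Q (f * unif Q powi (A Q + 1))"
  shows LL_step_image: "h A ` LL F (A + pt 1 Q) \<subseteq> res Q ` Q"
    and LL_step_finite: "finite (LL F A) \<Longrightarrow> finite (LL F (A + pt 1 Q))"
    and LL_step_card: "finite (LL F A) \<Longrightarrow>
      card (LL F (A + pt 1 Q)) = card (LL F A) * card (h A ` LL F (A + pt 1 Q))"
proof -
  show im: "h A ` LL F (A + pt 1 Q) \<subseteq> res Q ` Q"
  proof (rule image_subsetI)
    fix f assume "f \<in> LL F (A + pt 1 Q)"
    then have "f \<in> fil Q (- (A Q + 1))" using Q by (auto simp: LL_iff pt_def)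
    then have "f * unif Q powi (A Q + 1) \<in> Q"
      using fil_iff[OF Q, of f "- (A Q + 1)"] by (simp only: minus_minus)
    then show "h A f \<in> res Q ` Q" unfolding h_def by blast
  qed
  have hiff: "h A x = h A y \<longleftrightarrow> x - y \<in> LL F A"
    if x: "x \<in> LL F (A + pt 1 Q)" and y: "y \<in> LL F (A + pt 1 Q)" for x y
  proof -
    have "h A x = h A y \<longleftrightarrow> x - y \<in> fil Q (- A Q)"
      using fil_maxid_iff[OF Q, of "x - y" "- (A Q + 1)"]
      unfolding h_def res_eq_iff[OF Q] by (simp add: left_diff_distrib add.commute)
    also have "\<dots> \<longleftrightarrow> x - y \<in> LL F A"
    proof
      assume q: "x - y \<in> fil Q (- A Q)"
      have "x - y \<in> fil R (- A R)" if "place F R" for R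
      proof (cases "R = Q")
        case False
        then have "(A + pt 1 Q) R = A R" by (simp add: pt_def)
        then show ?thesis using LL_diff[OF x y] that unfolding LL_iff by metis
      qed (use q in simp)
      then show "x - y \<in> LL F A" by (simp add: LL_iff)
    qed (use Q in \<open>simp add: LL_iff\<close>)
    finally show ?thesis .
  qed
  have sub: "LL F A \<subseteq> LL F (A + pt 1 Q)" by (rule LL_mono) (simp add: pt_def)
  have fin: "finite (h A ` LL F (A + pt 1 Q))" using finite_subset[OF im card_residue_field(1)[OF Q]] .
  have add: "x + y \<in> LL F (A + pt 1 Q)" if "x \<in> LL F (A + pt 1 Q)" "y \<in> LL F A" for x y
    using fsubspaceD(2)[OF fsubspace_LL] that sub by blast
  show "finite (LL F A) \<Longrightarrow> finite (LL F (A + pt 1 Q))"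
    by (rule card_eq_card_kernel_times_image(1)[OF _ fin sub add hiff])
  show "finite (LL F A) \<Longrightarrow> card (LL F (A + pt 1 Q)) = card (LL F A) * card (h A ` LL F (A + pt 1 Q))"
    by (rule card_eq_card_kernel_times_image(2)[OF _ fin sub add hiff])
qed

end

text \<open>The rational place \<open>P0\<close> allows degrees to be changed by exactly one; in the
  theorem it is the first evaluation point.\<close>

locale curve = finite_function_field F for F :: "'k::field set" +
  fixes g :: nat and P0 :: "'k set"
  assumes genus: "is_genus F g" and rational_P0: "rational_place F P0"
begin

section \<open>Principal divisors, finiteness of \<open>LL\<close> and the index of
  speciality\<close>

lemma place_P0: "place F P0" and pdeg_P0: "pdeg F P0 = 1"
  using rational_P0 by (auto simp: rational_place_def)

lemma riemann: "divisor F A \<Longrightarrow> ddeg F A - int (ell F A) + 1 \<le> int g"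
  using genus by (auto simp: is_genus_def)

text \<open>Multiplication by a power of \<open>f\<close> preserves \<open>ell\<close>, so a nonzero degree of \<open>dv f\<close> would make
  the degree unbounded for a fixed value of \<open>ell\<close>, contradicting Riemann's inequality.\<close>

lemma ddeg_dv:
  assumes f: "f \<noteq> 0"
  shows "ddeg F (dv f) = 0"
proof -
  have le: "ddeg F (dv f) \<le> 0" if f: "f \<noteq> 0" for f
  proof (rule ccontr)
    assume pos: "\<not> ddeg F (dv f) \<le> 0"
    have pow: "ddeg F (dv (f ^ n)) = int n * ddeg F (dv f)" for n
      using f by (induction n) (simp_all add: dv_1 ddeg_0 dv_mult ddeg_add divisor_dv distrib_right)
    have bound: "int n * ddeg F (dv f) \<le> int g + int (ell F 0)" for n
    proof -
      have fn: "inverse (f ^ n) \<noteq> 0" using f by simp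
      have "ell F (dv (f ^ n)) = ell F 0"
        using ell_shift[OF fn, of 0] dv_inverse[of "f ^ n"] f by simp
      then show ?thesis using riemann[OF divisor_dv, of "f ^ n"] f pow[of n] by simp
    qed
    define n where "n = Suc (g + ell F 0)"
    have "int n * 1 \<le> int n * ddeg F (dv f)" using pos by (intro mult_left_mono) auto
    moreover have "int n = int g + int (ell F 0) + 1" by (simp add: n_def)
    ultimately show False using bound[of n] by linarith
  qed
  have "ddeg F (dv (inverse f)) = - ddeg F (dv f)"
    using ddeg_diff[OF divisor_0 divisor_dv[OF f]] dv_inverse[OF f] by (simp add: ddeg_0)
  then show ?thesis using le[OF f] le[of "inverse f"] f by simp
qed

lemma LL_neg_degree:
  assumes "divisor F A" "ddeg F A < 0"
  shows "LL F A = {0}"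
proof -
  have "f = 0" if fA: "f \<in> LL F A" for f
  proof (rule ccontr)
    assume f: "f \<noteq> 0"
    have "(A + dv f) R \<ge> 0" if "place F R" for R
      using fA f that by (auto simp: LL_def dv_def)
    then have "ddeg F (A + dv f) \<ge> 0" by (intro ddeg_nonneg divisor_add divisor_dv assms f)
    then show False using assms by (simp add: ddeg_add divisor_dv f ddeg_dv)
  qed
  then show ?thesis using fsubspaceD(1)[OF fsubspace_LL] by blast
qed

text \<open>Removing \<open>P0\<close> once divides the size by at most \<open>q\<close>. With the
  strict bound, \<open>n = 0\<close> is the case of negative degree, where only zero is
  left.\<close>

lemma LL_finite_card_le:
  assumes "divisor F A" "ddeg F A < int n"
  shows "finite (LL F A) \<and> card (LL F A) \<le> q ^ n"
  using assms
proof (induction n arbitrary: A)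
  case 0
  then show ?case using LL_neg_degree[of A] by simp
next
  case (Suc n)
  let ?A = "A - pt 1 P0"
  have "divisor F ?A" using Suc.prems place_P0 by (intro divisor_diff divisor_pt)
  moreover have "ddeg F ?A < int n"
    using Suc.prems place_P0 by (simp add: ddeg_diff divisor_pt ddeg_pt pdeg_P0)
  ultimately have IH: "finite (LL F ?A)" "card (LL F ?A) \<le> q ^ n" using Suc.IH by auto
  have "card (LL F A) = card (LL F ?A) * card ((\<lambda>f. res P0 (f * unif P0 powi (?A P0 + 1))) ` LL F A)"
    using LL_step_card[OF place_P0 IH(1)] by simp
  also have "\<dots> \<le> q ^ n * q"
    using card_mono[OF card_residue_field(1)[OF place_P0] LL_step_image[OF place_P0, of ?A]]
      card_residue_field(2)[OF place_P0] pdeg_P0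
    by (intro mult_mono IH) auto
  finally show ?case using LL_step_finite[OF place_P0 IH(1)] by (simp add: mult.commute)
qed

lemma finite_LL: "divisor F A \<Longrightarrow> finite (LL F A)"
  using LL_finite_card_le[of A "nat (ddeg F A + 1)"] by simp

lemma card_LL: "divisor F A \<Longrightarrow> card (LL F A) = q ^ ell F A"
  unfolding ell_def by (rule card_eq_power_kdim[OF fsubspace_LL finite_LL])

lemma ell_le: "divisor F A \<Longrightarrow> ddeg F A < int n \<Longrightarrow> ell F A \<le> n"
  using LL_finite_card_le[of A n] card_LL[of A] by simp

lemma ell_mono:
  assumes "divisor F A" "divisor F B" "\<And>R. place F R \<Longrightarrow> A R \<le> B R"
  shows "ell F A \<le> ell F B"
  using card_mono[OF finite_LL[OF assms(2)] LL_mono[of A B]] assms by (simp add: card_LL)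

lemma ell_step_le:
  assumes "divisor F A" "place F Q"
  shows "ell F (A + pt 1 Q) \<le> ell F A + pdeg F Q"
proof -
  have "card (LL F (A + pt 1 Q)) \<le> card (LL F A) * card (res Q ` Q)"
    unfolding LL_step_card[OF assms(2) finite_LL[OF assms(1)]]
    by (intro mult_le_mono2 card_mono card_residue_field LL_step_image assms)
  then have "q ^ ell F (A + pt 1 Q) \<le> q ^ (ell F A + pdeg F Q)"
    using assms by (simp add: card_LL divisor_add divisor_pt card_residue_field power_add)
  then show ?thesis by simp
qed

text \<open>The index of speciality; Riemann's inequality says that it is nonnegative.\<close>

definition spec :: "('k set \<Rightarrow> int) \<Rightarrow> int" where
  "spec A = int (ell F A) - ddeg F A - 1 + int g"

lemma spec_nonneg: "divisor F A \<Longrightarrow> spec A \<ge> 0"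
  using riemann[of A] by (simp add: spec_def)

lemma spec_step: "divisor F A \<Longrightarrow> place F Q \<Longrightarrow> spec (A + pt 1 Q) \<le> spec A"
  using ell_step_le[of A Q] by (simp add: spec_def ddeg_add divisor_pt ddeg_pt)

lemma spec_antimono:
  assumes "divisor F A" "divisor F B" "\<And>R. A R \<le> B R"
  shows "spec B \<le> spec A"
  using assms
proof (induction rule: divisor_le_induct)
  case (step C Q)
  show ?case by (rule order_trans[OF spec_step[OF step(1,2)] step(3)])
qed simp

lemma spec_shift:
  assumes "divisor F A" "h \<noteq> 0"
  shows "spec (A - dv h) = spec A"
  using assms by (simp add: spec_def ell_shift ddeg_diff divisor_dv ddeg_dv)

text \<open>Let \<open>A0\<close> attain the genus, so that \<open>spec A0 = 0\<close>. If
  \<open>A\<close> has degree at least \<open>ddeg F A0 + g\<close>, then \<open>A - A0\<close> has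
  a nonzero section, so \<open>A\<close> is equivalent to a divisor above \<open>A0\<close>;
  \<open>spec\<close> is antitone and invariant under equivalence.\<close>

lemma spec_eq_0_large_degree: "\<exists>d. \<forall>A. divisor F A \<longrightarrow> ddeg F A \<ge> d \<longrightarrow> spec A = 0"
proof -
  obtain A0 where A0: "divisor F A0" "ddeg F A0 - int (ell F A0) + 1 = int g"
    using genus by (auto simp: is_genus_def)
  have "spec A = 0" if A: "divisor F A" "ddeg F A \<ge> ddeg F A0 + int g" for A
  proof -
    have div: "divisor F (A - A0)" using A A0 by (intro divisor_diff)
    have "int (ell F (A - A0)) \<ge> 1" using riemann[OF div] A A0 by (simp add: ddeg_diff)
    then have "card (LL F (A - A0)) \<noteq> 1" using card_LL[OF div] q_ge_2 by simp
    then have "LL F (A - A0) \<noteq> {0}" by auto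
    then obtain f where f: "f \<in> LL F (A - A0)" "f \<noteq> 0"
      using fsubspaceD(1)[OF fsubspace_LL, of "A - A0"] by blast
    let ?B = "A - dv (inverse f)"
    have B: "divisor F ?B" using A f by (intro divisor_diff divisor_dv) auto
    have "A0 R \<le> ?B R" for R
    proof (cases "place F R")
      case True
      then show ?thesis using f by (auto simp: LL_def dv_def val_inverse)
    next
      case False
      then have "A0 R = 0" "A R = 0" using A A0 by (auto simp: divisor_def)
      then show ?thesis using False by (simp add: dv_def)
    qed
    then have "spec ?B \<le> spec A0" using spec_antimono A0(1) B by blast
    then show ?thesis using spec_shift[OF A(1), of "inverse f"] f A0 spec_nonneg[OF A(1)] by (simp add: spec_def)
  qed
  then show ?thesis by blast
qed

end

section \<open>Adeles\<close>

context finite_function_field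
begin

text \<open>\<open>F\<close> injects into the residue field, and for degree one both have
  \<open>q\<close> elements.\<close>

lemma rational_residue:
  assumes "rational_place F R" "z \<in> R"
  shows "\<exists>!c. c \<in> F \<and> z - c \<in> maxid R"
proof -
  have R: "place F R" and deg: "pdeg F R = 1" using assms(1) by (auto simp: rational_place_def)
  have uniq: "c = d" if "c \<in> F" "d \<in> F" "c - d \<in> maxid R" for c d
    using F_maxid[OF R, of "c - d"] that by simp
  have inj: "inj_on (res R) F" using uniq res_eq_iff[OF R] by (auto simp: inj_on_def)
  have "res R ` F = res R ` R"
    by (rule card_subset_eq)
      (use card_residue_field[OF R] place_F[OF R] card_image[OF inj] deg in auto)
  then obtain c where c: "c \<in> F" "z - c \<in> maxid R" using assms(2) res_eq_iff[OF R] by (metis imageE imageI)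
  moreover have "d = c" if "d \<in> F" "z - d \<in> maxid R" for d
    using uniq[of d c] maxid_diff[OF R c(2) that(2)] c that by simp
  ultimately show ?thesis by blast
qed

text \<open>Coordinates at sets that are not places are unconstrained; they lie in every \<open>adl A\<close>, so
  functionals vanishing on \<open>adl A\<close> ignore them.\<close>

definition adeles :: "('k set \<Rightarrow> 'k) set" where
  "adeles = {\<alpha>. finite {R. place F R \<and> \<alpha> R \<notin> R}}"

definition adl :: "('k set \<Rightarrow> int) \<Rightarrow> ('k set \<Rightarrow> 'k) set" where
  "adl A = {\<alpha>. \<forall>R. place F R \<longrightarrow> \<alpha> R \<in> fil R (- A R)}"

definition kst :: "'k \<Rightarrow> 'k set \<Rightarrow> 'k" where "kst z = (\<lambda>_. z)"

text \<open>The sum of \<open>adl A\<close> and the function field, embedded diagonally by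
  \<open>kst\<close>.\<close>

definition adl_K :: "('k set \<Rightarrow> int) \<Rightarrow> ('k set \<Rightarrow> 'k) set" where
  "adl_K A = {\<alpha> + kst z | \<alpha> z. \<alpha> \<in> adl A}"

lemma kst_apply [simp]: "kst z R = z" by (simp add: kst_def)

lemma adeles_add:
  assumes "\<alpha> \<in> adeles" "\<beta> \<in> adeles"
  shows "\<alpha> + \<beta> \<in> adeles"
proof -
  have "{R. place F R \<and> (\<alpha> + \<beta>) R \<notin> R} \<subseteq> {R. place F R \<and> \<alpha> R \<notin> R} \<union> {R. place F R \<and> \<beta> R \<notin> R}"
    using place_add by auto
  then show ?thesis using assms finite_subset unfolding adeles_def by blast
qed

lemma kst_adeles: "kst z \<in> adeles"
  using finite_poles[of z] by (simp add: adeles_def)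

lemma fscale_adeles:
  assumes "\<alpha> \<in> adeles"
  shows "fscale z \<alpha> \<in> adeles"
proof -
  have "{R. place F R \<and> fscale z \<alpha> R \<notin> R} \<subseteq> {R. place F R \<and> z \<notin> R} \<union> {R. place F R \<and> \<alpha> R \<notin> R}"
    using place_mult by auto
  then show ?thesis using assms finite_poles[of z] finite_subset unfolding adeles_def by blast
qed

lemma fsubspace_adeles: "fsubspace fscale adeles"
  using adeles_add fscale_adeles kst_adeles[of 0] by (auto simp: fsubspace_def kst_def zero_fun_def)

lemma adeles_diff: "\<alpha> \<in> adeles \<Longrightarrow> \<beta> \<in> adeles \<Longrightarrow> \<alpha> - \<beta> \<in> adeles"
  by (rule fsubspace_diff[OF module_fscale fsubspace_adeles])

lemma adl_imp_adeles:
  assumes "divisor F A" "\<alpha> \<in> adl A"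
  shows "\<alpha> \<in> adeles"
proof -
  have "{R. place F R \<and> \<alpha> R \<notin> R} \<subseteq> {R. A R \<noteq> 0}"
    using assms(2) fil_eq_place unfolding adl_def by force
  then show ?thesis using assms(1) finite_subset unfolding adeles_def divisor_def by blast
qed

lemma adl_add: "\<alpha> \<in> adl A \<Longrightarrow> \<beta> \<in> adl A \<Longrightarrow> \<alpha> + \<beta> \<in> adl A"
  by (simp add: adl_def fil_add)

lemma adl_scale: "a \<in> F \<Longrightarrow> \<alpha> \<in> adl A \<Longrightarrow> fscale a \<alpha> \<in> adl A"
  by (simp add: adl_def fil_scale)

lemma adl_mono: "(\<And>R. A R \<le> B R) \<Longrightarrow> adl A \<subseteq> adl B"
  by (force simp: adl_def intro: fil_mono)

lemma adl_K_I: "\<alpha> \<in> adl A \<Longrightarrow> \<alpha> + kst z \<in> adl_K A"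
  by (auto simp: adl_K_def)

lemma adl_subset_adl_K: "adl A \<subseteq> adl_K A"
proof
  fix \<alpha> assume "\<alpha> \<in> adl A"
  then have "\<alpha> + kst 0 \<in> adl_K A" by (rule adl_K_I)
  moreover have "\<alpha> + kst 0 = \<alpha>" by (simp add: fun_eq_iff)
  ultimately show "\<alpha> \<in> adl_K A" by simp
qed

lemma kst_adl_K: "kst z \<in> adl_K A"
proof -
  have "0 + kst z \<in> adl_K A" by (rule adl_K_I) (simp add: adl_def fil_0)
  then show ?thesis by simp
qed

lemma adl_K_mono: "(\<And>R. A R \<le> B R) \<Longrightarrow> adl_K A \<subseteq> adl_K B"
  using adl_mono unfolding adl_K_def by blast

lemma fsubspace_adl_K: "fsubspace fscale (adl_K A)"
  unfolding fsubspace_def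
proof (intro conjI ballI)
  show "0 \<in> adl_K A" using kst_adl_K[of 0] by (simp add: kst_def zero_fun_def)
next
  fix x y assume "x \<in> adl_K A" "y \<in> adl_K A"
  then obtain \<alpha> z \<beta> w where *: "x = \<alpha> + kst z" "y = \<beta> + kst w" "\<alpha> \<in> adl A" "\<beta> \<in> adl A"
    unfolding adl_K_def by blast
  then have "x + y = (\<alpha> + \<beta>) + kst (z + w)" by (simp add: fun_eq_iff)
  then show "x + y \<in> adl_K A" using adl_K_I[OF adl_add[OF *(3,4)]] by simp
next
  fix a x assume a: "a \<in> F" and "x \<in> adl_K A"
  then obtain \<alpha> z where *: "x = \<alpha> + kst z" "\<alpha> \<in> adl A" unfolding adl_K_def by blast
  then have "fscale a x = fscale a \<alpha> + kst (a * z)" by (simp add: fun_eq_iff distrib_left)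
  then show "fscale a x \<in> adl_K A" using adl_K_I[OF adl_scale[OF a *(2)]] by simp
qed

lemma adl_step_sub:
  assumes Q: "place F Q" and \<alpha>: "\<alpha> \<in> adl (A + pt 1 Q)" and \<beta>: "\<beta> \<in> adl (A + pt 1 Q)"
    and eq: "res Q (\<alpha> Q * unif Q powi (A Q + 1)) = res Q (\<beta> Q * unif Q powi (A Q + 1))"
  shows "\<alpha> - \<beta> \<in> adl A"
proof -
  have "(\<alpha> - \<beta>) R \<in> fil R (- A R)" if R: "place F R" for R
  proof (cases "R = Q")
    case True
    have "(\<alpha> Q - \<beta> Q) * unif Q powi (A Q + 1) \<in> maxid Q"
      using eq res_eq_iff[OF Q] by (simp add: left_diff_distrib)
    then show ?thesis using fil_maxid_iff[OF Q, of "\<alpha> Q - \<beta> Q" "- (A Q + 1)"] True by (simp add: add.commute)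
  next
    case False
    then have "(A + pt 1 Q) R = A R" by (simp add: pt_def)
    then have "\<alpha> R \<in> fil R (- A R)" "\<beta> R \<in> fil R (- A R)" using \<alpha> \<beta> R unfolding adl_def by auto
    then show ?thesis by (simp add: fil_diff R)
  qed
  then show ?thesis by (simp add: adl_def)
qed

lemma kst_adl_iff: "kst f \<in> adl A \<longleftrightarrow> f \<in> LL F A"
  by (simp add: adl_def LL_iff)

lemma adl_step_residue:
  assumes Q: "place F Q" and \<alpha>: "\<alpha> \<in> adl (A + pt 1 Q)"
  shows "\<alpha> Q * unif Q powi (A Q + 1) \<in> Q"
proof -
  have "(A + pt 1 Q) Q = A Q + 1" by (simp add: pt_def)
  then have "\<alpha> Q \<in> fil Q (- (A Q + 1))" using \<alpha> Q unfolding adl_def by fastforce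
  then show ?thesis using fil_iff[OF Q, of "\<alpha> Q" "- (A Q + 1)"] by (simp only: minus_minus)
qed

lemma adele_in_large_adl:
  assumes A: "divisor F A" and \<alpha>: "\<alpha> \<in> adeles"
  obtains B where "divisor F B" "\<And>R. A R \<le> B R" "\<alpha> \<in> adl B"
proof -
  define B where "B = (\<lambda>R. if place F R \<and> \<alpha> R \<noteq> 0 then max (A R) (- val R (\<alpha> R)) else A R)"
  have sub: "{R. B R \<noteq> 0} \<subseteq> {R. A R \<noteq> 0} \<union> {R. place F R \<and> \<alpha> R \<notin> R}"
  proof
    fix R assume "R \<in> {R. B R \<noteq> 0}"
    then show "R \<in> {R. A R \<noteq> 0} \<union> {R. place F R \<and> \<alpha> R \<notin> R}"
      using val_nonneg_iff[of R "\<alpha> R"] by (auto simp: B_def max_def split: if_splits)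
  qed
  have "divisor F B" unfolding divisor_def
  proof
    show "finite {R. B R \<noteq> 0}"
      by (rule finite_subset[OF sub]) (use A \<alpha> in \<open>simp add: divisor_def adeles_def\<close>)
    show "\<forall>R. B R \<noteq> 0 \<longrightarrow> place F R" using sub A unfolding divisor_def by blast
  qed
  moreover have "A R \<le> B R" for R by (simp add: B_def)
  moreover have "\<alpha> \<in> adl B" by (auto simp: adl_def fil_def B_def)
  ultimately show ?thesis using that by blast
qed

text \<open>The classes of \<open>e 0\<close>, ..., \<open>e (r - 1)\<close> form an
  \<open>F\<close>-basis of the adeles modulo \<open>M\<close>; stated with representatives to avoid
  a quotient type.\<close>

definition cobasis :: "('k set \<Rightarrow> 'k) set \<Rightarrow> nat \<Rightarrow> (nat \<Rightarrow> 'k set \<Rightarrow> 'k) \<Rightarrow> bool" where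
  "cobasis M r e \<longleftrightarrow> (\<forall>j<r. e j \<in> adeles) \<and>
     (\<forall>\<alpha>\<in>adeles. \<exists>c. (\<forall>j<r. c j \<in> F) \<and> \<alpha> - (\<Sum>j<r. fscale (c j) (e j)) \<in> M) \<and>
     (\<forall>c. (\<forall>j<r. c j \<in> F) \<longrightarrow> (\<Sum>j<r. fscale (c j) (e j)) \<in> M \<longrightarrow> (\<forall>j<r. c j = 0))"

text \<open>The class of \<open>x\<close> is a basis of \<open>M'\<close> modulo \<open>M\<close>,
  so it completes a cobasis of \<open>M'\<close> to one of the smaller space
  \<open>M\<close>.\<close>

lemma cobasis_extend:
  assumes M: "fsubspace fscale M" "fsubspace fscale M'" "M \<subseteq> M'"
    and e: "cobasis M' r e" and x: "x \<in> M'" "x \<in> adeles"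
    and span: "\<And>\<alpha>. \<alpha> \<in> M' \<Longrightarrow> \<exists>c\<in>F. \<alpha> - fscale c x \<in> M"
    and ind: "\<And>c. c \<in> F \<Longrightarrow> fscale c x \<in> M \<Longrightarrow> c = 0"
  shows "cobasis M (Suc r) (e(r := x))"
proof -
  have sum_eq: "(\<Sum>j<Suc r. fscale (c j) ((e(r := x)) j)) = (\<Sum>j<r. fscale (c j) (e j)) + fscale (c r) x" for c
    by simp
  have 1: "\<forall>j<Suc r. (e(r := x)) j \<in> adeles" using e x by (auto simp: cobasis_def less_Suc_eq)
  have 2: "\<exists>c. (\<forall>j<Suc r. c j \<in> F) \<and> \<alpha> - (\<Sum>j<Suc r. fscale (c j) ((e(r := x)) j)) \<in> M"
    if \<alpha>: "\<alpha> \<in> adeles" for \<alpha>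
  proof -
    obtain c where c: "\<forall>j<r. c j \<in> F" "\<alpha> - (\<Sum>j<r. fscale (c j) (e j)) \<in> M'"
      using e \<alpha> unfolding cobasis_def by blast
    obtain d where d: "d \<in> F" "\<alpha> - (\<Sum>j<r. fscale (c j) (e j)) - fscale d x \<in> M" using span[OF c(2)] by blast
    have "(\<Sum>j<r. fscale ((c(r := d)) j) (e j)) = (\<Sum>j<r. fscale (c j) (e j))" by (rule sum.cong) auto
    then show ?thesis
      using c(1) d unfolding sum_eq by (intro exI[of _ "c(r := d)"]) (auto simp: less_Suc_eq diff_diff_eq)
  qed
  have 3: "\<forall>j<Suc r. c j = 0" if c: "\<forall>j<Suc r. c j \<in> F" and m: "(\<Sum>j<Suc r. fscale (c j) ((e(r := x)) j)) \<in> M" for c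
  proof -
    have m': "(\<Sum>j<r. fscale (c j) (e j)) + fscale (c r) x \<in> M" using m unfolding sum_eq .
    moreover have "fscale (c r) x \<in> M'" using fsubspaceD(3)[OF M(2)] c x by simp
    ultimately have "(\<Sum>j<r. fscale (c j) (e j)) + fscale (c r) x - fscale (c r) x \<in> M'"
      using M(3) by (intro fsubspace_diff[OF module_fscale M(2)]) auto
    then have "(\<Sum>j<r. fscale (c j) (e j)) \<in> M'" by (simp only: add_diff_cancel_right')
    then have z: "\<forall>j<r. c j = 0" using e c unfolding cobasis_def by (metis less_SucI)
    then have "(\<Sum>j<r. fscale (c j) (e j)) = 0" by (intro sum.neutral) (auto simp: fun_eq_iff)
    then have "fscale (c r) x \<in> M" using m' by simp
    then show ?thesis using ind c z by (auto simp: less_Suc_eq)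
  qed
  show ?thesis unfolding cobasis_def using 1 2 3 by blast
qed

end

section \<open>The adeles modulo \<open>adl_K A\<close> have dimension \<open>spec A\<close>\<close>

context curve
begin

text \<open>When \<open>ell\<close> makes the full jump, every leading coefficient at
  \<open>Q\<close> is that of some global function \<open>f\<close>; subtracting the constant adele
  of \<open>f\<close> moves \<alpha> into \<open>adl A\<close>.\<close>

lemma nonspecial_adl_step:
  assumes A: "divisor F A" and Q: "place F Q" and full: "ell F (A + pt 1 Q) = ell F A + pdeg F Q"
    and \<alpha>: "\<alpha> \<in> adl (A + pt 1 Q)"
  shows "\<alpha> \<in> adl_K A"
proof -
  let ?h = "\<lambda>f. res Q (f * unif Q powi (A Q + 1))"
  let ?V = "LL F (A + pt 1 Q)"
  have "q ^ ell F A * q ^ pdeg F Q = q ^ ell F A * card (?h ` ?V)"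
    using LL_step_card[OF Q finite_LL[OF A]] A Q by (simp add: card_LL divisor_add divisor_pt full power_add)
  then have "card (?h ` ?V) = q ^ pdeg F Q" using q_ge_2 by simp
  then have "?h ` ?V = res Q ` Q"
    using card_subset_eq[OF card_residue_field(1)[OF Q] LL_step_image[OF Q, of A]] card_residue_field(2)[OF Q] by simp
  moreover have "res Q (\<alpha> Q * unif Q powi (A Q + 1)) \<in> res Q ` Q" using adl_step_residue[OF Q \<alpha>] by blast
  ultimately obtain f where f: "f \<in> ?V" "res Q (\<alpha> Q * unif Q powi (A Q + 1)) = ?h f"
    by (metis (no_types, lifting) imageE)
  have "\<alpha> - kst f \<in> adl A" by (rule adl_step_sub[OF Q \<alpha>]) (use f in \<open>simp_all add: kst_adl_iff\<close>)
  then have "(\<alpha> - kst f) + kst f \<in> adl_K A" by (rule adl_K_I)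
  then show ?thesis by simp
qed

text \<open>\<open>spec\<close> remains 0 above \<open>A\<close>, so each added place makes the full
  jump and yields nothing new modulo \<open>adl_K A\<close>. Every adele lies in
  \<open>adl B\<close> for some such larger \<open>B\<close>.\<close>

lemma adl_K_eq_adeles:
  assumes A: "divisor F A" "spec A = 0"
  shows "adeles \<subseteq> adl_K A"
proof
  fix \<alpha> assume "\<alpha> \<in> adeles"
  then obtain B where B: "divisor F B" "\<And>R. A R \<le> B R" "\<alpha> \<in> adl B" using adele_in_large_adl[OF A(1)] by blast
  have "spec B = 0 \<and> adl B \<subseteq> adl_K A"
    using A(1) B(1,2)
  proof (induction rule: divisor_le_induct)
    case base
    show ?case using A adl_subset_adl_K by blast
  next
    case (step C Q)
    then have s0: "spec (C + pt 1 Q) = 0"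
      using spec_step[OF step(1,2)] spec_nonneg[of "C + pt 1 Q"] by (simp add: divisor_add divisor_pt)
    then have "ell F (C + pt 1 Q) = ell F C + pdeg F Q"
      using step by (simp add: spec_def ddeg_add divisor_pt ddeg_pt)
    then have "adl (C + pt 1 Q) \<subseteq> adl_K C" using nonspecial_adl_step step(1,2) by blast
    moreover have "adl_K C \<subseteq> adl_K A"
    proof
      fix x assume "x \<in> adl_K C"
      then obtain \<beta> z where x: "x = \<beta> + kst z" "\<beta> \<in> adl C" unfolding adl_K_def by blast
      then have "\<beta> \<in> adl_K A" using step(3) by blast
      then show "x \<in> adl_K A" unfolding x(1) using fsubspaceD(2)[OF fsubspace_adl_K] kst_adl_K by blast
    qed
    ultimately have "adl (C + pt 1 Q) \<subseteq> adl_K A" by blast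
    with s0 show ?case by (rule conjI)
  qed
  then show "\<alpha> \<in> adl_K A" using B(3) by blast
qed

text \<open>Removing \<open>P0\<close> has two outcomes. If \<open>ell\<close> drops, both
  \<open>spec\<close> and the space \<open>adl_K\<close> are unchanged. If \<open>ell\<close> stays,
  \<open>spec\<close> grows by one, and an adele with a single pole at \<open>P0\<close> supplies
  the new class.\<close>

lemma adl_K_step_rational:
  assumes A: "divisor F A" and e: "\<exists>e. cobasis (adl_K (A + pt 1 P0)) (nat (spec (A + pt 1 P0))) e"
  shows "\<exists>e. cobasis (adl_K A) (nat (spec A)) e"
proof -
  let ?B = "A + pt 1 P0"
  have B: "divisor F ?B" using A place_P0 by (intro divisor_add divisor_pt)
  have le: "A R \<le> ?B R" for R by (simp add: pt_def)
  have deg: "ddeg F ?B = ddeg F A + 1" using A place_P0 by (simp add: ddeg_add divisor_pt ddeg_pt pdeg_P0)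
  have "ell F A \<le> ell F ?B" using ell_mono[OF A B] le by blast
  moreover have "ell F ?B \<le> ell F A + 1" using ell_step_le[OF A place_P0] pdeg_P0 by simp
  ultimately consider "ell F ?B = ell F A + 1" | "ell F ?B = ell F A" by linarith
  then show ?thesis
  proof cases
    case 1
    have "adl ?B \<subseteq> adl_K A" using nonspecial_adl_step[OF A place_P0] 1 pdeg_P0 by auto
    then have "adl_K ?B \<subseteq> adl_K A"
      using fsubspaceD(2)[OF fsubspace_adl_K] kst_adl_K unfolding adl_K_def[of ?B] by blast
    then have "adl_K ?B = adl_K A" using adl_K_mono[of A ?B] le by blast
    moreover have "spec ?B = spec A" using 1 deg by (simp add: spec_def)
    ultimately show ?thesis using e by simp
  next
    case 2
    have s: "nat (spec A) = Suc (nat (spec ?B))"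
      using 2 deg spec_nonneg[OF B] by (simp add: spec_def)
    let ?p = "unif P0 powi (- (A P0 + 1))"
    \<comment> \<open>Supported at \<open>P0\<close>, with the worst pole allowed by
      \<open>?B\<close> and leading coefficient 1.\<close>
    define x where "x = (\<lambda>R. if R = P0 then ?p else 0)"
    have pinv: "?p * unif P0 powi (A P0 + 1) = 1"
      using unif_nonzero[OF place_P0] by (simp flip: power_int_add)
    have BP0: "?B P0 = A P0 + 1" by (simp add: pt_def)
    have "?p \<in> fil P0 (- (A P0 + 1))"
      using val_powi[OF place_P0, of "- (A P0 + 1)"] by (simp add: fil_def)
    then have xB: "x \<in> adl ?B" using BP0 by (auto simp: adl_def x_def fil_0)
    have span: "\<exists>c\<in>F. \<alpha> - fscale c x \<in> adl A" if \<alpha>: "\<alpha> \<in> adl ?B" for \<alpha>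
    proof -
      obtain c where c: "c \<in> F" "\<alpha> P0 * unif P0 powi (A P0 + 1) - c \<in> maxid P0"
        using rational_residue[OF rational_P0 adl_step_residue[OF place_P0 \<alpha>]] by blast
      have eq: "fscale c x P0 * unif P0 powi (A P0 + 1) = c" using pinv by (simp add: x_def mult.assoc)
      have "res P0 (\<alpha> P0 * unif P0 powi (A P0 + 1)) = res P0 (fscale c x P0 * unif P0 powi (A P0 + 1))"
        unfolding eq res_eq_iff[OF place_P0] by (rule c(2))
      then have "\<alpha> - fscale c x \<in> adl A"
        by (rule adl_step_sub[OF place_P0 \<alpha> adl_scale[OF c(1) xB]])
      then show ?thesis using c by blast
    qed
    have "finite (LL F ?B)" using finite_LL[OF B] .
    moreover have "LL F A \<subseteq> LL F ?B" by (rule LL_mono) (rule le)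
    moreover have "card (LL F A) = card (LL F ?B)" using 2 A B by (simp add: card_LL)
    ultimately have LLeq: "LL F A = LL F ?B" by (intro card_subset_eq)
    \<comment> \<open>If \<open>fscale c x\<close> is an element of \<open>adl A\<close> plus a
      function \<open>z\<close>, then \<open>z\<close> lies in \<open>LL F ?B\<close>, which equals
      \<open>LL F A\<close> in this case. So \<open>fscale c x\<close> is itself in
      \<open>adl A\<close>, which forces the leading coefficient \<open>c\<close> to vanish.\<close>
    have ind: "c = 0" if c: "c \<in> F" and m: "fscale c x \<in> adl_K A" for c
    proof -
      obtain \<beta> z where bz: "fscale c x = \<beta> + kst z" "\<beta> \<in> adl A" using m unfolding adl_K_def by blast
      have "kst z = fscale c x + fscale (-1) \<beta>" using bz(1) by (simp add: fun_eq_iff)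
      also have "\<dots> \<in> adl ?B"
        using bz(2) adl_mono[of A ?B] le c by (intro adl_add adl_scale xB) auto
      finally have "kst z \<in> adl A" using LLeq by (simp add: kst_adl_iff)
      then have "fscale c x \<in> adl A" unfolding bz(1) using bz(2) adl_add by blast
      then have "c * ?p \<in> fil P0 (- (A P0 + 1) + 1)" using place_P0 by (auto simp: adl_def x_def)
      then have "c * ?p * unif P0 powi (- (- (A P0 + 1))) \<in> maxid P0" using fil_maxid_iff[OF place_P0] by blast
      then have "c * (?p * unif P0 powi (A P0 + 1)) \<in> maxid P0" by (simp only: minus_minus mult.assoc)
      then have "c \<in> maxid P0" using pinv by simp
      then show ?thesis using F_maxid[OF place_P0 c] by blast
    qed
    obtain e where e: "cobasis (adl_K ?B) (nat (spec ?B)) e" using assms(2) by blast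
    have "cobasis (adl_K A) (Suc (nat (spec ?B))) (e(nat (spec ?B) := x))"
    proof (rule cobasis_extend[OF fsubspace_adl_K fsubspace_adl_K _ e _ _ _ ind])
      show "adl_K A \<subseteq> adl_K ?B" using adl_K_mono le by blast
      show "x \<in> adl_K ?B" using xB adl_subset_adl_K by blast
      show "x \<in> adeles" using adl_imp_adeles[OF B xB] .
      fix \<alpha> assume "\<alpha> \<in> adl_K ?B"
      then obtain \<beta> z where bz: "\<alpha> = \<beta> + kst z" "\<beta> \<in> adl ?B" unfolding adl_K_def by blast
      then obtain c where c: "c \<in> F" "\<beta> - fscale c x \<in> adl A" using span by blast
      have "\<alpha> - fscale c x = (\<beta> - fscale c x) + kst z" using bz(1) by (simp add: fun_eq_iff)
      then show "\<exists>c\<in>F. \<alpha> - fscale c x \<in> adl_K A" using c adl_K_I by metis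
    qed
    then show ?thesis unfolding s by blast
  qed
qed

text \<open>Descends from degrees so large that \<open>spec\<close> is 0 and the empty family
  suffices, removing \<open>P0\<close> once per step.\<close>

lemma adl_K_cobasis:
  assumes "divisor F A"
  shows "\<exists>e. cobasis (adl_K A) (nat (spec A)) e"
proof -
  obtain d where d: "\<And>A. divisor F A \<Longrightarrow> ddeg F A \<ge> d \<Longrightarrow> spec A = 0" using spec_eq_0_large_degree by blast
  have "\<exists>e. cobasis (adl_K A) (nat (spec A)) e" if "divisor F A" "ddeg F A + int n \<ge> d" for n A
    using that
  proof (induction n arbitrary: A)
    case 0
    then have s: "spec A = 0" using d by simp
    then show ?case using adl_K_eq_adeles[OF 0(1) s] by (auto simp: cobasis_def)
  next
    case (Suc n)
    have "divisor F (A + pt 1 P0)" using Suc.prems place_P0 by (intro divisor_add divisor_pt)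
    moreover have "ddeg F (A + pt 1 P0) + int n \<ge> d"
      using Suc.prems place_P0 by (simp add: ddeg_add divisor_pt ddeg_pt pdeg_P0)
    ultimately show ?case using Suc.IH adl_K_step_rational[OF Suc.prems(1)] by blast
  qed
  from this[OF assms, of "nat (d - ddeg F A)"] show ?thesis by simp
qed

end

section \<open>Weil differentials\<close>

context finite_function_field
begin

text \<open>Weil differentials with divisor at least \<open>A\<close>, extended by zero outside the adeles so that
  equality of functions is equality of functionals.\<close>

definition Om :: "('k set \<Rightarrow> int) \<Rightarrow> (('k set \<Rightarrow> 'k) \<Rightarrow> 'k) set" where
  "Om A = {\<omega>. (\<forall>\<alpha>. \<omega> \<alpha> \<in> F) \<and> (\<forall>\<alpha>. \<alpha> \<notin> adeles \<longrightarrow> \<omega> \<alpha> = 0) \<and>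
     (\<forall>\<alpha>\<in>adeles. \<forall>\<beta>\<in>adeles. \<omega> (\<alpha> + \<beta>) = \<omega> \<alpha> + \<omega> \<beta>) \<and>
     (\<forall>a\<in>F. \<forall>\<alpha>\<in>adeles. \<omega> (fscale a \<alpha>) = a * \<omega> \<alpha>) \<and>
     (\<forall>\<alpha>\<in>adl A. \<omega> \<alpha> = 0) \<and> (\<forall>z. \<omega> (kst z) = 0)}"

lemma OmD:
  assumes "\<omega> \<in> Om A"
  shows "\<omega> \<alpha> \<in> F" "\<alpha> \<notin> adeles \<Longrightarrow> \<omega> \<alpha> = 0"
    "\<alpha> \<in> adeles \<Longrightarrow> \<beta> \<in> adeles \<Longrightarrow> \<omega> (\<alpha> + \<beta>) = \<omega> \<alpha> + \<omega> \<beta>"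
    "a \<in> F \<Longrightarrow> \<alpha> \<in> adeles \<Longrightarrow> \<omega> (fscale a \<alpha>) = a * \<omega> \<alpha>"
    "\<alpha> \<in> adl A \<Longrightarrow> \<omega> \<alpha> = 0" "\<omega> (kst z) = 0"
  using assms unfolding Om_def by auto

lemma Om_zero: "\<omega> \<in> Om A \<Longrightarrow> \<omega> 0 = 0"
  using OmD(6)[of \<omega> A 0] by (simp add: kst_def zero_fun_def)

lemma Om_diff:
  assumes "\<omega> \<in> Om A" "\<alpha> \<in> adeles" "\<beta> \<in> adeles"
  shows "\<omega> (\<alpha> - \<beta>) = \<omega> \<alpha> - \<omega> \<beta>"
  using OmD(3)[OF assms(1) adeles_diff[OF assms(2,3)] assms(3)] by (simp add: algebra_simps)

lemma Om_sum:
  assumes "\<omega> \<in> Om A" "\<And>i. i \<in> I \<Longrightarrow> f i \<in> adeles"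
  shows "\<omega> (sum f I) = (\<Sum>i\<in>I. \<omega> (f i))"
  using assms(2)
proof (induction I rule: infinite_finite_induct)
  case (insert i I)
  have "sum f I \<in> adeles" "f i \<in> adeles"
    using insert.prems by (auto intro!: fsubspace_sum[OF fsubspace_adeles])
  then have "\<omega> (f i + sum f I) = \<omega> (f i) + \<omega> (sum f I)" by (intro OmD(3)[OF assms(1)])
  then show ?case using insert by (simp only: sum.insert insert_iff simp_thms)
qed (simp_all add: Om_zero[OF assms(1)])

lemma Om_adl_K:
  assumes A: "divisor F A" and "\<omega> \<in> Om A" "\<alpha> \<in> adl_K A"
  shows "\<omega> \<alpha> = 0"
proof -
  obtain \<beta> z where *: "\<alpha> = \<beta> + kst z" "\<beta> \<in> adl A" using assms(3) unfolding adl_K_def by blast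
  then show ?thesis
    using OmD(3,5,6)[OF assms(2)] adl_imp_adeles[OF A] kst_adeles by simp
qed

text \<open>The function field acts on differentials through its multiplication on adeles.\<close>

definition act :: "'k \<Rightarrow> (('k set \<Rightarrow> 'k) \<Rightarrow> 'k) \<Rightarrow> ('k set \<Rightarrow> 'k) \<Rightarrow> 'k" where
  "act z \<omega> = (\<lambda>\<alpha>. \<omega> (fscale z \<alpha>))"

lemma fscale_fscale: "fscale z (fscale w \<alpha>) = fscale (z * w) \<alpha>"
  by (simp add: fun_eq_iff mult.assoc)

lemma fscale_1: "fscale 1 \<alpha> = \<alpha>" and fscale_0: "fscale 0 \<alpha> = 0"
  by (simp_all add: fun_eq_iff)

lemma act_Om:
  assumes \<omega>: "\<omega> \<in> Om A" and z: "z \<in> LL F C"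
  shows "act z \<omega> \<in> Om (A - C)"
proof -
  have out: "\<omega> (fscale z \<alpha>) = 0" if "\<alpha> \<notin> adeles" for \<alpha>
  proof (cases "z = 0")
    case True
    then show ?thesis using Om_zero[OF \<omega>] by (simp add: fscale_0)
  next
    case False
    then have "fscale z \<alpha> \<notin> adeles"
      using fscale_adeles[of "fscale z \<alpha>" "inverse z"] that by (auto simp: fscale_fscale fscale_1)
    then show ?thesis using OmD(2)[OF \<omega>] by blast
  qed
  have add: "\<omega> (fscale z (\<alpha> + \<beta>)) = \<omega> (fscale z \<alpha>) + \<omega> (fscale z \<beta>)" if "\<alpha> \<in> adeles" "\<beta> \<in> adeles" for \<alpha> \<beta>
  proof -
    have "fscale z (\<alpha> + \<beta>) = fscale z \<alpha> + fscale z \<beta>" by (simp add: fun_eq_iff distrib_left)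
    then show ?thesis using OmD(3)[OF \<omega>] fscale_adeles that by simp
  qed
  have scale: "\<omega> (fscale z (fscale a \<alpha>)) = a * \<omega> (fscale z \<alpha>)" if "a \<in> F" "\<alpha> \<in> adeles" for a \<alpha>
    using OmD(4)[OF \<omega> that(1) fscale_adeles[OF that(2)], of z] by (simp add: fscale_fscale mult.commute)
  have van: "\<omega> (fscale z \<alpha>) = 0" if "\<alpha> \<in> adl (A - C)" for \<alpha>
  proof -
    have "z * \<alpha> R \<in> fil R (- A R)" if R: "place F R" for R
    proof -
      have "z * \<alpha> R \<in> fil R (- C R + - (A - C) R)"
        using \<open>\<alpha> \<in> adl (A - C)\<close> z R unfolding adl_def LL_iff by (intro fil_mult) auto
      then show ?thesis by simp
    qed
    then have "fscale z \<alpha> \<in> adl A" by (simp add: adl_def)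
    then show ?thesis using OmD(5)[OF \<omega>] by blast
  qed
  have "fscale z (kst w) = kst (z * w)" for w by (simp add: fun_eq_iff)
  then have "\<omega> (fscale z (kst w)) = 0" for w using OmD(6)[OF \<omega>] by simp
  then show ?thesis unfolding Om_def act_def using out add scale van OmD(1)[OF \<omega>] by blast
qed

lemma Om_add:
  assumes "\<omega> \<in> Om A" "\<eta> \<in> Om A"
  shows "(\<lambda>\<alpha>. \<omega> \<alpha> + \<eta> \<alpha>) \<in> Om A"
  using assms unfolding Om_def by (auto simp: distrib_left)

lemma act_diff:
  assumes "\<omega> \<in> Om A" "\<alpha> \<in> adeles"
  shows "act (z - w) \<omega> \<alpha> = act z \<omega> \<alpha> - act w \<omega> \<alpha>"
proof -
  have "fscale (z - w) \<alpha> = fscale z \<alpha> - fscale w \<alpha>" by (simp add: fun_eq_iff left_diff_distrib)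
  then show ?thesis unfolding act_def using Om_diff[OF assms(1) fscale_adeles[OF assms(2)] fscale_adeles[OF assms(2)]] by simp
qed

lemma act_eq_0:
  assumes \<omega>: "\<omega> \<in> Om A" and z: "z \<noteq> 0" and "\<And>\<alpha>. \<alpha> \<in> adeles \<Longrightarrow> act z \<omega> \<alpha> = 0"
  shows "\<omega> \<alpha> = 0"
proof (cases "\<alpha> \<in> adeles")
  case True
  then have "act z \<omega> (fscale (inverse z) \<alpha>) = 0" using assms(3) fscale_adeles by blast
  then show ?thesis using z by (simp add: act_def fscale_fscale fscale_1)
qed (use OmD(2)[OF \<omega>] in blast)

end

context curve
begin

text \<open>A functional that vanishes on \<open>adl_K A\<close> is determined by its values on a
  cobasis.\<close>

lemma card_Om:
  assumes A: "divisor F A"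
  shows "finite (Om A)" "card (Om A) \<le> q ^ nat (spec A)"
proof -
  define r where "r = nat (spec A)"
  obtain e where e: "cobasis (adl_K A) r e" using adl_K_cobasis[OF A] unfolding r_def by blast
  let ?\<Phi> = "\<lambda>\<omega>. restrict (\<lambda>j. \<omega> (e j)) {..<r}"
  have inj: "inj_on ?\<Phi> (Om A)"
  proof (rule inj_onI)
    fix \<omega> \<eta> assume \<omega>: "\<omega> \<in> Om A" and \<eta>: "\<eta> \<in> Om A" and eq: "?\<Phi> \<omega> = ?\<Phi> \<eta>"
    have eqj: "\<omega> (e j) = \<eta> (e j)" if "j < r" for j using fun_cong[OF eq, of j] that by simp
    show "\<omega> = \<eta>"
    proof
      fix \<alpha>
      show "\<omega> \<alpha> = \<eta> \<alpha>"
      proof (cases "\<alpha> \<in> adeles")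
        case True
        then obtain c where c: "\<forall>j<r. c j \<in> F" "\<alpha> - (\<Sum>j<r. fscale (c j) (e j)) \<in> adl_K A"
          using e unfolding cobasis_def by blast
        have ea: "e j \<in> adeles" if "j < r" for j using e that unfolding cobasis_def by blast
        have sa: "(\<Sum>j<r. fscale (c j) (e j)) \<in> adeles"
          using ea fscale_adeles by (intro fsubspace_sum[OF fsubspace_adeles]) auto
        have val: "\<mu> \<alpha> = (\<Sum>j<r. c j * \<mu> (e j))" if \<mu>: "\<mu> \<in> Om A" for \<mu>
        proof -
          have "\<mu> \<alpha> - \<mu> (\<Sum>j<r. fscale (c j) (e j)) = 0"
            using Om_adl_K[OF A \<mu> c(2)] Om_diff[OF \<mu> True sa] by simp
          moreover have "\<mu> (\<Sum>j<r. fscale (c j) (e j)) = (\<Sum>j<r. c j * \<mu> (e j))"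
            using c(1) ea fscale_adeles OmD(4)[OF \<mu>] by (subst Om_sum[OF \<mu>]) auto
          ultimately show ?thesis by simp
        qed
        show ?thesis unfolding val[OF \<omega>] val[OF \<eta>] using eqj by (intro sum.cong) auto
      qed (use OmD(2)[OF \<omega>] OmD(2)[OF \<eta>] in simp)
    qed
  qed
  have im: "?\<Phi> ` Om A \<subseteq> {..<r} \<rightarrow>\<^sub>E F"
    using OmD(1) by (auto simp: PiE_def Pi_def extensional_def)
  have fin: "finite ({..<r} \<rightarrow>\<^sub>E F)" by (rule finite_PiE) (simp_all add: finite_F)
  show "finite (Om A)" using inj_on_finite[OF inj im fin] .
  show "card (Om A) \<le> q ^ nat (spec A)" using card_inj_on_le[OF inj im fin] by (simp add: card_PiE r_def)
qed

text \<open>The dual vector of \<open>e i\<close>: send an adele to its coordinate number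
  \<open>i\<close>. Independence modulo \<open>adl_K A\<close> makes the chosen representation
  irrelevant, hence the map linear.\<close>

lemma coordinate_functional:
  assumes A: "divisor F A" and e: "cobasis (adl_K A) r e" and i: "i < r"
  shows "\<exists>\<omega>\<in>Om A. \<forall>j<r. \<omega> (e j) = (if j = i then 1 else 0)"
proof -
  interpret module "fscale :: 'k \<Rightarrow> ('k set \<Rightarrow> 'k) \<Rightarrow> _" by (rule module_fscale)
  define rep where "rep \<alpha> c \<longleftrightarrow> (\<forall>j<r. c j \<in> F) \<and> \<alpha> - (\<Sum>j<r. fscale (c j) (e j)) \<in> adl_K A" for \<alpha> c
  have ex: "\<exists>c. rep \<alpha> c" if "\<alpha> \<in> adeles" for \<alpha> using e that unfolding cobasis_def rep_def by blast
  have indep: "\<forall>j<r. c j = 0" if "\<forall>j<r. c j \<in> F" "(\<Sum>j<r. fscale (c j) (e j)) \<in> adl_K A" for c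
    using e that unfolding cobasis_def by blast
  have uniq: "c j = d j" if c: "rep \<alpha> c" and d: "rep \<alpha> d" and j: "j < r" for \<alpha> c d j
  proof -
    have "\<alpha> - (\<Sum>j<r. fscale (d j) (e j)) \<in> adl_K A" "\<alpha> - (\<Sum>j<r. fscale (c j) (e j)) \<in> adl_K A"
      using c d unfolding rep_def by blast+
    then have "(\<alpha> - (\<Sum>j<r. fscale (d j) (e j))) - (\<alpha> - (\<Sum>j<r. fscale (c j) (e j))) \<in> adl_K A"
      by (rule fsubspace_diff[OF module_fscale fsubspace_adl_K])
    also have "(\<alpha> - (\<Sum>j<r. fscale (d j) (e j))) - (\<alpha> - (\<Sum>j<r. fscale (c j) (e j))) = (\<Sum>j<r. fscale (c j - d j) (e j))"
      by (simp add: scale_left_diff_distrib sum_subtractf)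
    finally have m: "(\<Sum>j<r. fscale (c j - d j) (e j)) \<in> adl_K A" .
    have "\<forall>j<r. c j - d j \<in> F" using c d unfolding rep_def by simp
    then have "c j - d j = 0" using indep[OF _ m] j by blast
    then show ?thesis by (simp only: right_minus_eq)
  qed
  define \<omega> where "\<omega> \<alpha> = (if \<alpha> \<in> adeles then (SOME c. rep \<alpha> c) i else 0)" for \<alpha>
  have \<omega>_eq: "\<omega> \<alpha> = c i" if "\<alpha> \<in> adeles" "rep \<alpha> c" for \<alpha> c
    unfolding \<omega>_def using uniq[OF someI_ex[OF ex[OF that(1)]] that(2) i] that(1) by simp
  have rep_F: "\<omega> \<alpha> \<in> F" for \<alpha>
  proof (cases "\<alpha> \<in> adeles")
    case True
    then obtain c where c: "rep \<alpha> c" using ex by blast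
    then have "c i \<in> F" using i unfolding rep_def by blast
    then show ?thesis using \<omega>_eq[OF True c] by metis
  qed (simp add: \<omega>_def)
  have add: "\<omega> (\<alpha> + \<beta>) = \<omega> \<alpha> + \<omega> \<beta>" if a: "\<alpha> \<in> adeles" and b: "\<beta> \<in> adeles" for \<alpha> \<beta>
  proof -
    obtain c d where c: "rep \<alpha> c" and d: "rep \<beta> d" using ex a b by blast
    have "(\<alpha> - (\<Sum>j<r. fscale (c j) (e j))) + (\<beta> - (\<Sum>j<r. fscale (d j) (e j))) \<in> adl_K A"
      using c d fsubspaceD(2)[OF fsubspace_adl_K] unfolding rep_def by blast
    also have "(\<alpha> - (\<Sum>j<r. fscale (c j) (e j))) + (\<beta> - (\<Sum>j<r. fscale (d j) (e j)))
      = (\<alpha> + \<beta>) - (\<Sum>j<r. fscale (c j + d j) (e j))"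
      by (simp add: scale_left_distrib sum.distrib)
    finally have m: "(\<alpha> + \<beta>) - (\<Sum>j<r. fscale (c j + d j) (e j)) \<in> adl_K A" .
    have "\<forall>j<r. c j + d j \<in> F" using c d unfolding rep_def by simp
    with m have "rep (\<alpha> + \<beta>) (\<lambda>j. c j + d j)" unfolding rep_def by (intro conjI)
    then show ?thesis using \<omega>_eq[OF a c] \<omega>_eq[OF b d] \<omega>_eq[OF adeles_add[OF a b]] by presburger
  qed
  have scale: "\<omega> (fscale a \<alpha>) = a * \<omega> \<alpha>" if a: "a \<in> F" and b: "\<alpha> \<in> adeles" for a \<alpha>
  proof -
    obtain c where c: "rep \<alpha> c" using ex b by blast
    have "fscale a (\<alpha> - (\<Sum>j<r. fscale (c j) (e j))) \<in> adl_K A"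
      using c a fsubspaceD(3)[OF fsubspace_adl_K] unfolding rep_def by blast
    also have "fscale a (\<alpha> - (\<Sum>j<r. fscale (c j) (e j))) = fscale a \<alpha> - (\<Sum>j<r. fscale (a * c j) (e j))"
      by (simp add: scale_right_diff_distrib scale_sum_right)
    finally have m: "fscale a \<alpha> - (\<Sum>j<r. fscale (a * c j) (e j)) \<in> adl_K A" .
    have "\<forall>j<r. a * c j \<in> F" using c a unfolding rep_def by simp
    with m have "rep (fscale a \<alpha>) (\<lambda>j. a * c j)" unfolding rep_def by (intro conjI)
    then show ?thesis using \<omega>_eq[OF b c] \<omega>_eq[OF fscale_adeles[OF b]] by presburger
  qed
  have van: "\<omega> \<alpha> = 0" if "\<alpha> \<in> adeles" "\<alpha> \<in> adl_K A" for \<alpha>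
    using \<omega>_eq[OF that(1), of "\<lambda>_. 0"] that(2) by (simp add: rep_def fscale_0)
  have out: "\<omega> \<alpha> = 0" if "\<alpha> \<notin> adeles" for \<alpha> using that by (simp add: \<omega>_def)
  have "\<omega> \<in> Om A" unfolding Om_def
  proof (intro CollectI conjI allI ballI impI)
    show "\<omega> \<alpha> = 0" if "\<alpha> \<in> adl A" for \<alpha>
      using van adl_imp_adeles[OF A that] adl_subset_adl_K that by blast
    show "\<omega> (kst z) = 0" for z using van kst_adeles kst_adl_K by blast
  qed (fact rep_F out add scale)+
  moreover have "\<omega> (e j) = (if j = i then 1 else 0)" if j: "j < r" for j
  proof -
    have ej: "e j \<in> adeles" using e j unfolding cobasis_def by blast
    have "(\<Sum>l<r. fscale (if l = j then 1 else 0) (e l)) = (\<Sum>l<r. if l = j then e l else 0)"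
      by (rule sum.cong) (auto simp: fscale_1 fscale_0)
    also have "\<dots> = e j" using j by simp
    finally have "rep (e j) (\<lambda>l. if l = j then 1 else 0)"
      using fsubspaceD(1)[OF fsubspace_adl_K] by (simp add: rep_def)
    then show ?thesis using \<omega>_eq[OF ej] by auto
  qed
  ultimately show ?thesis by blast
qed

text \<open>Two coordinate functionals. The scalars act on values, so this is independence over the
  constants; over the function field any two nonzero differentials turn out to be
  proportional.\<close>

lemma independent_functionals:
  assumes A: "divisor F A" and "spec A \<ge> 2"
  obtains \<omega> \<eta> where "\<omega> \<in> Om A" "\<eta> \<in> Om A"
    "\<And>a b. (\<And>\<alpha>. \<alpha> \<in> adeles \<Longrightarrow> a * \<omega> \<alpha> + b * \<eta> \<alpha> = 0) \<Longrightarrow> a = 0 \<and> b = 0"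
proof -
  define r where "r = nat (spec A)"
  obtain e where e: "cobasis (adl_K A) r e" using adl_K_cobasis[OF A] unfolding r_def by blast
  have r: "0 < r" "1 < r" using assms(2) by (auto simp: r_def)
  obtain \<omega> where \<omega>: "\<omega> \<in> Om A" "\<forall>j<r. \<omega> (e j) = (if j = 0 then 1 else 0)"
    using coordinate_functional[OF A e r(1)] by blast
  obtain \<eta> where \<eta>: "\<eta> \<in> Om A" "\<forall>j<r. \<eta> (e j) = (if j = 1 then 1 else 0)"
    using coordinate_functional[OF A e r(2)] by blast
  have ea: "e 0 \<in> adeles" "e 1 \<in> adeles" using e r unfolding cobasis_def by blast+
  show ?thesis
  proof (rule that[OF \<omega>(1) \<eta>(1)])
    fix a b assume z: "\<And>\<alpha>. \<alpha> \<in> adeles \<Longrightarrow> a * \<omega> \<alpha> + b * \<eta> \<alpha> = 0"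
    show "a = 0 \<and> b = 0" using z[OF ea(1)] z[OF ea(2)] \<omega>(2) \<eta>(2) r by simp
  qed
qed

text \<open>Multiplying a fixed nonzero functional by \<open>LL F E\<close> embeds \<open>LL F E\<close> into \<open>Om 0\<close>, so
  \<open>ell F E \<le> g\<close>.\<close>

lemma Om_nonzero_degree:
  assumes E: "divisor F E" and \<omega>: "\<omega> \<in> Om E" "\<omega> \<alpha> \<noteq> 0"
  shows "ddeg F E \<le> 2 * int g - 2"
proof -
  have inj: "inj_on (\<lambda>z. act z \<omega>) (LL F E)"
  proof (rule inj_onI, rule ccontr)
    fix z w assume eq: "act z \<omega> = act w \<omega>" and ne: "z \<noteq> w"
    have "act (z - w) \<omega> \<beta> = 0" if "\<beta> \<in> adeles" for \<beta> using act_diff[OF \<omega>(1) that] eq by simp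
    then show False using act_eq_0[OF \<omega>(1), of "z - w" \<alpha>] ne \<omega>(2) by simp
  qed
  have im: "(\<lambda>z. act z \<omega>) ` LL F E \<subseteq> Om 0" using act_Om[OF \<omega>(1), of _ E] by auto
  have "q ^ ell F E \<le> card (Om 0)"
    using card_inj_on_le[OF inj im card_Om(1)[OF divisor_0]] card_LL[OF E] by simp
  also have "\<dots> \<le> q ^ nat (spec 0)" by (rule card_Om(2)[OF divisor_0])
  finally have 1: "ell F E \<le> nat (spec 0)" by simp
  have "ell F 0 \<le> 1" using ell_le[OF divisor_0, of 1] by (simp add: ddeg_0)
  then have 2: "spec 0 \<le> int g" by (simp add: spec_def ddeg_0)
  \<comment> \<open>Zero and \<omega> are two elements of \<open>Om E\<close>, so
    \<open>spec E\<close> is at least 1, that is \<open>ell F E\<close> \<ge>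
    \<open>ddeg F E + 2 - g\<close>. Together with \<open>ell F E\<close> \<le> \<open>g\<close>
    this is the bound.\<close>
  have "(\<lambda>_. 0) \<in> Om E" by (simp add: Om_def)
  moreover have "(\<lambda>_. 0) \<noteq> \<omega>" using \<omega>(2) by metis
  ultimately have "card {(\<lambda>_. 0), \<omega>} \<le> card (Om E)" using \<omega>(1) by (intro card_mono card_Om E) auto
  then have "2 \<le> q ^ nat (spec E)" using card_Om(2)[OF E] \<open>(\<lambda>_. 0) \<noteq> \<omega>\<close> by simp
  then have 3: "spec E \<ge> 1" by (cases "nat (spec E) = 0") auto
  show ?thesis using 1 2 3 by (simp add: spec_def)
qed

text \<open>A \<open>LEAST\<close> over integers needs a lower bound: two independent sections force
  degree at least 1, so the minimum can be taken over naturals. The upper bound comes from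
  \<open>(g + 1)\<close> times \<open>P0\<close>, which has two sections by Riemann's
  inequality.\<close>

lemma gonality_properties:
  shows gonality_le: "divisor F A \<Longrightarrow> ell F A \<ge> 2 \<Longrightarrow> gonality F \<le> ddeg F A"
    and gonality_pos: "gonality F \<ge> 1" and gonality_le_genus: "gonality F \<le> int g + 1"
    and ell_le_1: "divisor F A \<Longrightarrow> ddeg F A < gonality F \<Longrightarrow> ell F A \<le> 1"
proof -
  define P where "P d \<longleftrightarrow> (\<exists>A. divisor F A \<and> ell F A \<ge> 2 \<and> ddeg F A = d)" for d
  have pos: "d \<ge> 1" if "P d" for d
    using that ell_le[of _ 1] unfolding P_def by (metis not_less numeral_le_one_iff of_nat_1 order_trans semiring_norm(69))
  let ?A = "pt (int g + 1) P0"
  have A: "divisor F ?A" "ddeg F ?A = int g + 1" using place_P0 by (simp_all add: divisor_pt ddeg_pt pdeg_P0)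
  have PA: "P (int g + 1)" unfolding P_def using A riemann[OF A(1)] by auto
  define m where "m = (LEAST n. P (int n))"
  have Pm: "P (int m)" unfolding m_def by (rule LeastI[of _ "g + 1"]) (use PA in \<open>simp add: add.commute\<close>)
  have le: "int m \<le> d" if "P d" for d
  proof -
    have d: "int (nat d) = d" using pos[OF that] by simp
    have "m \<le> nat d" unfolding m_def by (rule Least_le) (use that d in simp)
    then show ?thesis using d by linarith
  qed
  have gon: "gonality F = int m"
    unfolding gonality_def P_def[symmetric] by (rule Least_equality) (use Pm le in auto)
  show 1: "gonality F \<le> ddeg F A" if "divisor F A" "ell F A \<ge> 2" for A
    using le[of "ddeg F A"] that unfolding gon P_def by blast
  show "gonality F \<ge> 1" using pos[OF Pm] gon by simp
  show "gonality F \<le> int g + 1" using le[OF PA] gon by simp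
  show "ell F A \<le> 1" if "divisor F A" "ddeg F A < gonality F"
    using 1[OF that(1)] that(2) by (cases "ell F A \<ge> 2") auto
qed

text \<open>Multiples of \<omega> and \<eta> by \<open>LL F C\<close> all lie in
  \<open>Om (B - C)\<close>. For \<open>C\<close> of large degree c, pairs of multipliers have
  dimension about 2 c but the target only about c, so two pairs collide and their difference gives u
  \<omega> + v \<eta> = 0.\<close>

lemma proportional_functionals:
  assumes B: "divisor F B" and \<omega>: "\<omega> \<in> Om B" and \<eta>: "\<eta> \<in> Om B"
    and nz: "\<omega> \<alpha>1 \<noteq> 0" "\<eta> \<alpha>2 \<noteq> 0"
  obtains \<phi> where "\<phi> \<noteq> 0" "\<And>\<alpha>. \<alpha> \<in> adeles \<Longrightarrow> \<eta> \<alpha> = \<omega> (fscale \<phi> \<alpha>)"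
proof -
  \<comment> \<open>Large enough that \<open>B - C\<close> has negative degree and that 2 (c + 1 -
    g) exceeds c - deg B - 1 + g.\<close>
  define c where "c = 3 * int g + \<bar>ddeg F B\<bar> + 1"
  define C where "C = pt c P0"
  have C: "divisor F C" "ddeg F C = c" using place_P0 by (simp_all add: C_def divisor_pt ddeg_pt pdeg_P0)
  have BC: "divisor F (B - C)" "ddeg F (B - C) = ddeg F B - c" using B C by (simp_all add: divisor_diff ddeg_diff)
  have "ell F (B - C) \<le> 0" by (rule ell_le[OF BC(1)]) (use BC(2) c_def in simp)
  then have spec_BC: "spec (B - C) = c - ddeg F B - 1 + int g" using BC by (simp add: spec_def)
  have "int (ell F C) \<ge> c + 1 - int g" using riemann[OF C(1)] C(2) by simp
  then have less: "nat (spec (B - C)) < 2 * ell F C" using spec_BC c_def by simp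
  let ?\<Phi> = "\<lambda>(f, h). (\<lambda>\<alpha>. act f \<omega> \<alpha> + act h \<eta> \<alpha>)"
  let ?V = "LL F C \<times> LL F C"
  have im: "?\<Phi> ` ?V \<subseteq> Om (B - C)" using act_Om[OF \<omega>] act_Om[OF \<eta>] Om_add by auto
  have "card (Om (B - C)) \<le> q ^ nat (spec (B - C))" by (rule card_Om[OF BC(1)])
  also have "\<dots> < q ^ (2 * ell F C)" using less by (simp only: q_power_less_iff)
  also have "\<dots> = card ?V" using card_LL[OF C(1)] by (simp add: card_cartesian_product mult_2 power_add)
  finally have "\<not> inj_on ?\<Phi> ?V" using card_inj_on_le[OF _ im card_Om(1)[OF BC(1)]] by fastforce
  then obtain f h f' h' where ne: "(f, h) \<noteq> (f', h')"
    and eq: "(\<lambda>\<alpha>. act f \<omega> \<alpha> + act h \<eta> \<alpha>) = (\<lambda>\<alpha>. act f' \<omega> \<alpha> + act h' \<eta> \<alpha>)"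
    by (auto simp: inj_on_def)
  define u where "u = f - f'"
  define v where "v = h - h'"
  have rel: "act u \<omega> \<alpha> + act v \<eta> \<alpha> = 0" if "\<alpha> \<in> adeles" for \<alpha>
    unfolding u_def v_def act_diff[OF \<omega> that] act_diff[OF \<eta> that]
    using fun_cong[OF eq, of \<alpha>] by (simp flip: add_diff_add)
  have "u \<noteq> 0 \<or> v \<noteq> 0" using ne by (auto simp: u_def v_def)
  moreover have "act 0 \<mu> \<alpha> = 0" if "\<mu> \<in> Om B" for \<mu> \<alpha> using Om_zero[OF that] by (simp add: act_def fscale_0)
  ultimately have uv: "u \<noteq> 0" "v \<noteq> 0"
    using rel act_eq_0[OF \<omega>, of u \<alpha>1] act_eq_0[OF \<eta>, of v \<alpha>2] nz \<omega> \<eta> by auto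
  show ?thesis
  proof (rule that[of "- u / v"])
    show "- u / v \<noteq> 0" using uv by simp
    fix \<alpha> assume a: "\<alpha> \<in> adeles"
    have "\<eta> \<alpha> = act v \<eta> (fscale (inverse v) \<alpha>)" using uv by (simp add: act_def fscale_fscale fscale_1)
    also have "\<dots> = - act u \<omega> (fscale (inverse v) \<alpha>)"
      using rel[OF fscale_adeles[OF a], of "inverse v"] by (simp add: eq_neg_iff_add_eq_0 add.commute)
    also have "\<dots> = (-1) * \<omega> (fscale (u / v) \<alpha>)" by (simp add: act_def fscale_fscale divide_inverse)
    also have "\<dots> = \<omega> (fscale (-1) (fscale (u / v) \<alpha>))" using OmD(4)[OF \<omega> _ fscale_adeles[OF a], of "-1"] by simp
    finally show "\<eta> \<alpha> = \<omega> (fscale (- u / v) \<alpha>)" by (simp add: fscale_fscale)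
  qed
qed

text \<open>If \<open>\<omega>\<close> and \<open>\<phi> \<omega>\<close> both vanish on \<open>adl B\<close>, then \<open>\<omega>\<close> vanishes on \<open>adl E\<close> with \<open>E\<close> the
  sum of \<open>B\<close> and the polar divisor of \<open>\<phi>\<close>, whose degree is at least the gonality.\<close>

lemma spec_le_1:
  assumes B: "divisor F B" and deg: "ddeg F B + gonality F > 2 * int g - 2"
  shows "spec B \<le> 1"
proof (rule ccontr)
  assume "\<not> spec B \<le> 1"
  then have "spec B \<ge> 2" by simp
  then obtain \<omega> \<eta> where \<omega>: "\<omega> \<in> Om B" and \<eta>: "\<eta> \<in> Om B"
    and ind: "\<And>a b. (\<And>\<alpha>. \<alpha> \<in> adeles \<Longrightarrow> a * \<omega> \<alpha> + b * \<eta> \<alpha> = 0) \<Longrightarrow> a = 0 \<and> b = 0"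
    using independent_functionals[OF B] by blast
  obtain \<alpha>1 where \<alpha>1: "\<omega> \<alpha>1 \<noteq> 0" using ind[of 1 0] by auto
  obtain \<alpha>2 where \<alpha>2: "\<eta> \<alpha>2 \<noteq> 0" using ind[of 0 1] by auto
  obtain \<phi> where \<phi>: "\<phi> \<noteq> 0" "\<And>\<alpha>. \<alpha> \<in> adeles \<Longrightarrow> \<eta> \<alpha> = \<omega> (fscale \<phi> \<alpha>)"
    using proportional_functionals[OF B \<omega> \<eta> \<alpha>1 \<alpha>2] by blast
  \<comment> \<open>A constant \<phi> would make \<eta> a multiple of \<omega> over
    \<open>F\<close>.\<close>
  have \<phi>F: "\<phi> \<notin> F"
  proof
    assume "\<phi> \<in> F"
    then have "\<phi> * \<omega> \<alpha> + (-1) * \<eta> \<alpha> = 0" if "\<alpha> \<in> adeles" for \<alpha> using \<phi>(2) OmD(4)[OF \<omega>] that by simp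
    then show False using ind[of \<phi> "-1"] by simp
  qed
  \<comment> \<open>The polar divisor of \<phi>. Its space contains the constants and \<phi>, hence
    more than \<open>q\<close> elements.\<close>
  define N where "N = (\<lambda>R. max 0 (- dv \<phi> R))"
  have N: "divisor F N" using divisor_combine[OF divisor_dv[OF \<phi>(1)] divisor_0, of N] by (simp add: N_def)
  have "insert \<phi> F \<subseteq> LL F N"
    using val_F by (auto simp: LL_def N_def dv_def)
  then have "card (insert \<phi> F) \<le> card (LL F N)" by (intro card_mono finite_LL N)
  then have "q ^ 1 < q ^ ell F N" using \<phi>F finite_F card_LL[OF N] by simp
  then have "ell F N \<ge> 2" by (simp only: q_power_less_iff)
  then have degN: "ddeg F N \<ge> gonality F" using gonality_le[OF N] by blast
  let ?E = "B + N"
  have E: "divisor F ?E" using B N by (rule divisor_add)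
  have "\<omega> \<alpha> = 0" if \<alpha>: "\<alpha> \<in> adl ?E" for \<alpha>
  proof -
    \<comment> \<open>Place by place, \<alpha> is put into \<beta> if \<open>B\<close> already
      permits its pole, and otherwise divided by \<phi> and put into \<gamma>. In the second case
      \<open>N R = - val R \<phi>\<close>, so the division brings the pole back within
      \<open>B\<close>. Now \<omega> kills \<beta>, and its value on \<phi> \<gamma> is \<eta> on
      \<gamma>.\<close>
    define \<beta> where "\<beta> R = (if \<alpha> R \<in> fil R (- B R) then \<alpha> R else 0)" for R
    define \<gamma> where "\<gamma> R = (if \<alpha> R \<in> fil R (- B R) then 0 else inverse \<phi> * \<alpha> R)" for R
    have \<beta>: "\<beta> \<in> adl B" by (simp add: adl_def \<beta>_def fil_0)
    have \<gamma>: "\<gamma> \<in> adl B"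
    proof -
      have "\<gamma> R \<in> fil R (- B R)" if R: "place F R" for R
      proof (cases "\<alpha> R \<in> fil R (- B R)")
        case False
        have aE: "\<alpha> R \<in> fil R (- (B R + N R))" using \<alpha> R unfolding adl_def by fastforce
        then have "N R = - val R \<phi>" using False R by (auto simp: N_def dv_def max_def split: if_splits)
        moreover have "inverse \<phi> \<in> fil R (- val R \<phi>)" using \<phi>(1) R by (simp add: fil_def val_inverse)
        ultimately have "inverse \<phi> * \<alpha> R \<in> fil R (- val R \<phi> + - (B R + - val R \<phi>))"
          using fil_mult[OF R] aE by metis
        then show ?thesis using False by (simp add: \<gamma>_def)
      qed (simp add: \<gamma>_def fil_0)
      then show ?thesis by (simp add: adl_def)
    qed
    have "\<alpha> = \<beta> + fscale \<phi> \<gamma>" using \<phi>(1) by (auto simp: fun_eq_iff \<beta>_def \<gamma>_def simp flip: mult.assoc)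
    moreover have ad: "\<beta> \<in> adeles" "\<gamma> \<in> adeles" using adl_imp_adeles[OF B] \<beta> \<gamma> by blast+
    ultimately have "\<omega> \<alpha> = \<omega> \<beta> + \<omega> (fscale \<phi> \<gamma>)" using OmD(3)[OF \<omega> _ fscale_adeles] by simp
    then show ?thesis using OmD(5)[OF \<omega> \<beta>] OmD(5)[OF \<eta> \<gamma>] \<phi>(2)[OF ad(2)] by simp
  qed
  then have "\<omega> \<in> Om ?E" using \<omega> unfolding Om_def by blast
  from Om_nonzero_degree[OF E this \<alpha>1] show False using deg degN B N by (simp add: ddeg_add)
qed

end

section \<open>State complexity of geometric codes\<close>

context finite_function_field
begin

lemma evalp_spec:
  assumes "rational_place F R" "f \<in> R"
  shows "evalp F R f \<in> F" "f - evalp F R f \<in> maxid R"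
  using theI'[OF rational_residue[OF assms]] unfolding evalp_def by auto

lemma evalp_eqI:
  assumes "rational_place F R" "f \<in> R" "c \<in> F" "f - c \<in> maxid R"
  shows "evalp F R f = c"
  using rational_residue[OF assms(1,2)] evalp_spec[OF assms(1,2)] assms(3,4) by blast

lemma evalp_add:
  assumes R: "rational_place F R" and f: "f \<in> R" and h: "h \<in> R"
  shows "evalp F R (f + h) = evalp F R f + evalp F R h"
proof -
  have pl: "place F R" using R by (simp add: rational_place_def)
  have "(f - evalp F R f) + (h - evalp F R h) \<in> maxid R"
    using evalp_spec[OF R f] evalp_spec[OF R h] maxid_add[OF pl] by blast
  then have "f + h - (evalp F R f + evalp F R h) \<in> maxid R" by (simp add: add_diff_add)
  then show ?thesis
    using evalp_spec[OF R f] evalp_spec[OF R h] place_add[OF pl f h] by (intro evalp_eqI[OF R]) auto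
qed

lemma evalp_scale:
  assumes R: "rational_place F R" and f: "f \<in> R" and a: "a \<in> F"
  shows "evalp F R (a * f) = a * evalp F R f"
proof -
  have pl: "place F R" using R by (simp add: rational_place_def)
  have "a * (f - evalp F R f) \<in> maxid R"
    using evalp_spec[OF R f] maxid_mult'[OF pl] place_F[OF pl a] by blast
  then have "a * f - a * evalp F R f \<in> maxid R" by (simp add: right_diff_distrib)
  then show ?thesis
    using evalp_spec[OF R f] place_mult[OF pl place_F[OF pl a] f] a by (intro evalp_eqI[OF R]) auto
qed

lemma evalp_eq_0_iff:
  assumes R: "rational_place F R" and f: "f \<in> R"
  shows "evalp F R f = 0 \<longleftrightarrow> f \<in> maxid R"
  using evalp_spec[OF R f] evalp_eqI[OF R f, of 0] by auto

lemma fsubspace_image: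
  assumes "fsubspace (*) V" "\<And>x y. x \<in> V \<Longrightarrow> y \<in> V \<Longrightarrow> T (x + y) = T x + T y"
    "\<And>a x. a \<in> F \<Longrightarrow> x \<in> V \<Longrightarrow> T (a * x) = fscale a (T x)"
  shows "fsubspace fscale (T ` V)"
proof -
  have "T (0 * 0) = fscale 0 (T 0)" using assms(3)[of 0 0] fsubspaceD(1)[OF assms(1)] by simp
  then have "0 = T 0" by (simp add: fun_eq_iff)
  then have "0 \<in> T ` V" using fsubspaceD(1)[OF assms(1)] by blast
  moreover have "x + y \<in> T ` V" if xy: "x \<in> T ` V" "y \<in> T ` V" for x y
  proof -
    obtain u v where uv: "x = T u" "y = T v" "u \<in> V" "v \<in> V" using xy by blast
    then have "x + y = T (u + v)" using assms(2) by simp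
    then show ?thesis using fsubspaceD(2)[OF assms(1) uv(3,4)] by blast
  qed
  moreover have "fscale a x \<in> T ` V" if ax: "a \<in> F" "x \<in> T ` V" for a x
  proof -
    obtain u where u: "x = T u" "u \<in> V" using ax by blast
    then have "fscale a x = T (a * u)" using assms(3) ax by simp
    then show ?thesis using fsubspaceD(3)[OF assms(1) ax(1) u(2)] by blast
  qed
  ultimately show ?thesis by (simp add: fsubspace_def)
qed

definition ptsum :: "(nat \<Rightarrow> 'k set) \<Rightarrow> nat set \<Rightarrow> 'k set \<Rightarrow> int" where
  "ptsum Ps J = (\<lambda>R. if R \<in> Ps ` J then 1 else 0)"

lemma divisor_ptsum:
  assumes "finite J" "\<And>j. j \<in> J \<Longrightarrow> rational_place F (Ps j)"
  shows "divisor F (ptsum Ps J)"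
proof -
  have "{R. ptsum Ps J R \<noteq> 0} = Ps ` J" by (auto simp: ptsum_def)
  then show ?thesis unfolding divisor_def using assms by (auto simp: ptsum_def rational_place_def)
qed

lemma ddeg_ptsum:
  assumes "finite J" "\<And>j. j \<in> J \<Longrightarrow> rational_place F (Ps j)" "inj_on Ps J"
  shows "ddeg F (ptsum Ps J) = int (card J)"
proof -
  have "ddeg F (ptsum Ps J) = (\<Sum>R\<in>Ps ` J. ptsum Ps J R * int (pdeg F R))"
    by (rule ddeg_eq_sum) (use assms in \<open>auto simp: ptsum_def\<close>)
  also have "\<dots> = (\<Sum>R\<in>Ps ` J. 1)"
    by (rule sum.cong) (use assms in \<open>auto simp: ptsum_def rational_place_def\<close>)
  also have "\<dots> = int (card J)" using card_image[OF assms(3)] by simp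
  finally show ?thesis .
qed

end

locale AG = curve F g P0 for F :: "'k::field set" and g P0 +
  fixes n :: nat and Ps :: "nat \<Rightarrow> 'k set" and G :: "'k set \<Rightarrow> int"
  assumes rational: "\<And>i. i < n \<Longrightarrow> rational_place F (Ps i)"
    and distinct: "inj_on Ps {..<n}"
    and divisor_G: "divisor F G" and G_Ps: "\<And>i. i < n \<Longrightarrow> G (Ps i) = 0"
begin

definition ev :: "'k \<Rightarrow> nat \<Rightarrow> 'k" where
  "ev f = (\<lambda>i. if i < n then evalp F (Ps i) f else 0)"

abbreviation C where "C \<equiv> AG_code F n Ps G"

lemma C_eq: "C = ev ` LL F G"
  by (auto simp: AG_code_def ev_def)

lemma LL_regular: "f \<in> LL F G \<Longrightarrow> i < n \<Longrightarrow> f \<in> Ps i"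
  using fil_eq_place[of "Ps i"] rational[of i] G_Ps[of i] by (auto simp: LL_iff rational_place_def)

lemma ev_add: "f \<in> LL F G \<Longrightarrow> h \<in> LL F G \<Longrightarrow> ev (f + h) = ev f + ev h"
  by (simp add: fun_eq_iff ev_def evalp_add rational LL_regular)

lemma ev_scale: "f \<in> LL F G \<Longrightarrow> a \<in> F \<Longrightarrow> ev (a * f) = fscale a (ev f)"
  by (simp add: fun_eq_iff ev_def evalp_scale rational LL_regular)

abbreviation GJ where "GJ J \<equiv> G - ptsum Ps J"

lemma divisor_GJ: "J \<subseteq> {..<n} \<Longrightarrow> divisor F (GJ J)"
  using rational finite_subset[of J "{..<n}"] by (intro divisor_diff divisor_G divisor_ptsum) auto

lemma ddeg_GJ: "J \<subseteq> {..<n} \<Longrightarrow> ddeg F (GJ J) = ddeg F G - int (card J)"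
proof -
  assume J: "J \<subseteq> {..<n}"
  then have "finite J" "\<And>j. j \<in> J \<Longrightarrow> rational_place F (Ps j)" "inj_on Ps J"
    using finite_subset rational inj_on_subset[OF distinct] by auto
  then show ?thesis by (simp add: ddeg_diff[OF divisor_G divisor_ptsum] ddeg_ptsum)
qed

text \<open>As \<open>G\<close> is 0 at each evaluation point, subtracting the point requires order
  at least 1 there, which is vanishing of the evaluation.\<close>

lemma LL_GJ:
  assumes J: "J \<subseteq> {..<n}"
  shows "LL F (GJ J) = {f \<in> LL F G. \<forall>j\<in>J. ev f j = 0}"
proof -
  have zero: "ev f j = 0 \<longleftrightarrow> f \<in> fil (Ps j) 1" if "f \<in> LL F G" "j \<in> J" for f j
    using evalp_eq_0_iff[OF rational LL_regular[OF that(1)], of j] that J fil_eq_maxid[of "Ps j"] rational[of j]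
    by (auto simp: ev_def rational_place_def)
  have "f \<in> LL F (GJ J) \<longleftrightarrow> f \<in> LL F G \<and> (\<forall>j\<in>J. f \<in> fil (Ps j) 1)" for f
  proof
    assume f: "f \<in> LL F (GJ J)"
    moreover have "LL F (GJ J) \<subseteq> LL F G" by (rule LL_mono) (simp add: ptsum_def)
    ultimately have "f \<in> LL F G" by blast
    moreover have "f \<in> fil (Ps j) 1" if "j \<in> J" for j
    proof -
      have "place F (Ps j)" "- GJ J (Ps j) = 1"
        using that J rational[of j] G_Ps[of j] by (auto simp: rational_place_def ptsum_def)
      then show ?thesis using f unfolding LL_iff by metis
    qed
    ultimately show "f \<in> LL F G \<and> (\<forall>j\<in>J. f \<in> fil (Ps j) 1)" by blast
  next
    assume f: "f \<in> LL F G \<and> (\<forall>j\<in>J. f \<in> fil (Ps j) 1)"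
    have "f \<in> fil R (- GJ J R)" if R: "place F R" for R
    proof (cases "R \<in> Ps ` J")
      case True
      then obtain j where j: "j \<in> J" "R = Ps j" by blast
      then have "- GJ J R = 1" using J G_Ps[of j] by (auto simp: ptsum_def)
      then show ?thesis using f j by simp
    next
      case False
      then have "GJ J R = G R" by (simp add: ptsum_def)
      then show ?thesis using f R unfolding LL_iff by metis
    qed
    then show "f \<in> LL F (GJ J)" by (simp add: LL_iff)
  qed
  then show ?thesis using zero by blast
qed

lemma vdim_image:
  assumes "divisor F A" "\<And>x y. x \<in> LL F A \<Longrightarrow> y \<in> LL F A \<Longrightarrow> T (x + y) = T x + T y"
    "\<And>a x. a \<in> F \<Longrightarrow> x \<in> LL F A \<Longrightarrow> T (a * x) = fscale a (T x)" "inj_on T (LL F A)"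
  shows "vdim F (T ` LL F A) = ell F A"
proof -
  have "card (T ` LL F A) = q ^ vdim F (T ` LL F A)"
    by (rule card_eq_power_vdim[OF fsubspace_image[OF fsubspace_LL assms(2,3)]]) (use finite_LL[OF assms(1)] in auto)
  then show ?thesis using card_image[OF assms(4)] card_LL[OF assms(1)] by simp
qed

lemma card_C: "finite C" "card C = q ^ vdim F C"
proof -
  show fin: "finite C" unfolding C_eq using finite_LL[OF divisor_G] by simp
  have "fsubspace fscale C"
    unfolding C_eq by (rule fsubspace_image[OF fsubspace_LL]) (auto simp: ev_add ev_scale)
  from card_eq_power_vdim[OF this fin] show "card C = q ^ vdim F C" .
qed

lemma ev_eq_iff: "f \<in> LL F G \<Longrightarrow> h \<in> LL F G \<Longrightarrow> ev f = ev h \<longleftrightarrow> f - h \<in> LL F (GJ {..<n})"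
proof -
  assume f: "f \<in> LL F G" and h: "h \<in> LL F G"
  have d: "f - h \<in> LL F G" using LL_diff f h .
  have "ev f = ev (f - h) + ev h" using ev_add[OF d h] by simp
  then have "ev f = ev h \<longleftrightarrow> ev (f - h) = 0" by simp
  also have "\<dots> \<longleftrightarrow> (\<forall>j\<in>{..<n}. ev (f - h) j = 0)" by (auto simp: fun_eq_iff ev_def)
  also have "\<dots> \<longleftrightarrow> f - h \<in> LL F (GJ {..<n})" using d by (simp add: LL_GJ)
  finally show ?thesis .
qed

text \<open>The functions evaluating to the zero word are those of \<open>GJ {..<n}\<close>, so this
  is rank plus nullity by counting.\<close>

lemma ell_G: "ell F G = vdim F C + ell F (GJ {..<n})"
proof -
  have "card (LL F G) = card (LL F (GJ {..<n})) * card (ev ` LL F G)"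
  proof (rule card_eq_card_kernel_times_image(2))
    show "finite (LL F (GJ {..<n}))" by (rule finite_LL[OF divisor_GJ]) simp
    show "finite (ev ` LL F G)" using finite_LL[OF divisor_G] by simp
    show "LL F (GJ {..<n}) \<subseteq> LL F G" by (auto simp: LL_GJ)
    then show "x + y \<in> LL F G" if "x \<in> LL F G" "y \<in> LL F (GJ {..<n})" for x y
      using that fsubspaceD(2)[OF fsubspace_LL] by blast
  qed (rule ev_eq_iff)
  then have "q ^ ell F G = q ^ (ell F (GJ {..<n}) + vdim F C)"
    using card_C(2) divisor_GJ[of "{..<n}"] by (simp add: card_LL divisor_G C_eq power_add)
  then show ?thesis by simp
qed

section \<open>Past and future subcodes at rate at most one half\<close>

context
  assumes low_rate: "2 * vdim F C \<le> n" and long: "n > 2 * g"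
begin

text \<open>A nonzero kernel forces deg G \<ge> n and has dimension at most deg G - n + 1. With
  Riemann's inequality for \<open>G\<close> this gives k \<ge> n - g, and n > 2 g turns it into 2 k
  > n.\<close>

lemma ell_GD: "ell F (GJ {..<n}) = 0"
proof (rule ccontr)
  assume pos: "ell F (GJ {..<n}) \<noteq> 0"
  let ?m = "ddeg F G"
  have deg: "ddeg F (GJ {..<n}) = ?m - int n" by (simp add: ddeg_GJ)
  have div: "divisor F (GJ {..<n})" by (rule divisor_GJ) simp
  have "ell F (GJ {..<n}) \<le> 0" if "?m - int n < 0" using ell_le[OF div, of 0] that deg by simp
  then have "?m \<ge> int n" using pos by linarith
  then have "int (ell F (GJ {..<n})) \<le> ?m - int n + 1" using ell_le[OF div, of "nat (?m - int n + 1)"] deg by simp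
  moreover have "?m - int (ell F G) + 1 \<le> int g" using riemann[OF divisor_G] .
  ultimately show False using ell_G low_rate long by simp
qed

lemma ev_inj: "inj_on ev (LL F G)"
proof -
  have "card (LL F (GJ {..<n})) = 1" using card_LL[OF divisor_GJ, of "{..<n}"] ell_GD by simp
  then have "LL F (GJ {..<n}) = {0}" using fsubspaceD(1)[OF fsubspace_LL, of "GJ {..<n}"] by (metis card_1_singletonE singletonD)
  then show ?thesis using ev_eq_iff by (auto simp: inj_on_def)
qed

lemma vdim_past:
  assumes "i \<le> n"
  shows "vdim F (past n C i) = ell F (GJ {i..<n})"
proof -
  have J: "{i..<n} \<subseteq> {..<n}" by auto
  have sub: "LL F (GJ {i..<n}) \<subseteq> LL F G" using LL_GJ[OF J] by blast
  have past: "past n C i = ev ` LL F (GJ {i..<n})"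
  proof -
    have "(\<lambda>j. if j < i then ev f j else 0) = ev f" if "f \<in> LL F (GJ {i..<n})" for f
      using that unfolding LL_GJ[OF J] by (auto simp: fun_eq_iff ev_def)
    moreover have "past n C i = (\<lambda>f j. if j < i then ev f j else 0) ` LL F (GJ {i..<n})"
      unfolding past_def C_eq LL_GJ[OF J] by auto
    ultimately show ?thesis by (simp cong: image_cong)
  qed
  show ?thesis unfolding past
    by (rule vdim_image[OF divisor_GJ[OF J]])
      (use ev_add ev_scale inj_on_subset[OF ev_inj sub] sub in blast)+
qed

lemma vdim_future:
  assumes "i \<le> n"
  shows "vdim F (future n C i) = ell F (GJ {..<i})"
proof -
  have J: "{..<i} \<subseteq> {..<n}" using assms by auto
  have sub: "LL F (GJ {..<i}) \<subseteq> LL F G" using LL_GJ[OF J] by blast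
  let ?T = "\<lambda>f j. if j < n - i then ev f (j + i) else 0"
  have "future n C i = ?T ` LL F (GJ {..<i})"
    unfolding future_def C_eq LL_GJ[OF J] by auto
  moreover have "vdim F (?T ` LL F (GJ {..<i})) = ell F (GJ {..<i})"
  proof (rule vdim_image[OF divisor_GJ[OF J]])
    show "?T (x + y) = ?T x + ?T y" if "x \<in> LL F (GJ {..<i})" "y \<in> LL F (GJ {..<i})" for x y
      using ev_add[of x y] that sub by (auto simp: fun_eq_iff)
    show "?T (a * x) = fscale a (?T x)" if "a \<in> F" "x \<in> LL F (GJ {..<i})" for a x
      using ev_scale[of x a] that sub by (auto simp: fun_eq_iff)
    show "inj_on ?T (LL F (GJ {..<i}))"
    proof (rule inj_onI)
      fix x y assume x: "x \<in> LL F (GJ {..<i})" and y: "y \<in> LL F (GJ {..<i})" and eq: "?T x = ?T y"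
      have "ev x j = ev y j" for j
      proof -
        consider "j < i" | "i \<le> j" "j < n" | "j \<ge> n" by linarith
        then show ?thesis
        proof cases
          case 1
          then show ?thesis using x y unfolding LL_GJ[OF J] by auto
        next
          case 2
          then show ?thesis using fun_cong[OF eq, of "j - i"] by (simp add: diff_less_mono)
        qed (simp add: ev_def)
      qed
      then have "ev x = ev y" by blast
      then show "x = y" using inj_onD[OF ev_inj] x y sub by blast
    qed
  qed
  ultimately show ?thesis by simp
qed

text \<open>Cut where the future divisor has degree \<open>gonality F - 1\<close>, so that it has at most one section;
  the past divisor then has degree at most \<open>2 g - 1 - gonality F\<close>, to which \<open>spec_le_1\<close> applies.\<close>

lemma small_cut:
  "\<exists>i\<le>n. int (vdim F (past n C i) + vdim F (future n C i)) \<le> int g - gonality F + 2"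
proof -
  let ?m = "ddeg F G" and ?\<gamma> = "gonality F"
  have k: "?m + 1 - int g \<le> int (vdim F C)" using riemann[OF divisor_G] ell_G ell_GD by simp
  show ?thesis
  proof (cases "?m < ?\<gamma>")
    \<comment> \<open>Cutting before the first coordinate puts the whole code into the future; it
      has dimension at most 1, and 1 \<le> g - \<gamma> + 2 because the gonality is at most g +
      1.\<close>
    case True
    have "ell F (GJ {..<0}) \<le> 1" using ell_le_1[OF divisor_GJ] ddeg_GJ[of "{..<0}"] True by simp
    then have "vdim F (future n C 0) \<le> 1" using vdim_future[of 0] by simp
    moreover have "vdim F (past n C 0) = 0" using vdim_past[of 0] ell_GD by (simp add: atLeast0LessThan)
    ultimately show ?thesis using gonality_le_genus by (intro exI[of _ 0]) simp
  next
    case False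
    define i where "i = nat (?m - ?\<gamma> + 1)"
    have i: "int i = ?m - ?\<gamma> + 1" using False by (simp add: i_def)
    \<comment> \<open>As \<gamma> \<ge> 1, \<open>i\<close> is at most deg G, hence at most k + g -
      1, and both 2 k and 2 g are at most n.\<close>
    have "i \<le> n" using i k low_rate long gonality_pos by linarith
    have J: "{..<i} \<subseteq> {..<n}" "{i..<n} \<subseteq> {..<n}" using \<open>i \<le> n\<close> by auto
    have "ell F (GJ {..<i}) \<le> 1"
      using ell_le_1[OF divisor_GJ[OF J(1)]] ddeg_GJ[OF J(1)] i by simp
    then have future: "vdim F (future n C i) \<le> 1" using vdim_future[OF \<open>i \<le> n\<close>] by simp
    let ?B = "GJ {i..<n}"
    \<comment> \<open>Padding with multiples of \<open>P0\<close> raises the degree to exactly 2 g -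
      1 - \<gamma>. It equals n - 2 (deg G + 1 - g), which is nonnegative since deg G + 1 - g \<le>
      k and 2 k \<le> n.\<close>
    define s where "s = 2 * int g - 1 - ?\<gamma> - ddeg F ?B"
    define B' where "B' = ?B + pt s P0"
    have B: "divisor F ?B" using divisor_GJ[OF J(2)] .
    have degB: "ddeg F ?B = 2 * ?m - int n - ?\<gamma> + 1" using ddeg_GJ[OF J(2)] i \<open>i \<le> n\<close> by simp
    have s: "s \<ge> 0" using k low_rate by (simp add: s_def degB)
    have B': "divisor F B'" "ddeg F B' = 2 * int g - 1 - ?\<gamma>"
      using B place_P0 by (simp_all add: B'_def divisor_add divisor_pt ddeg_add ddeg_pt pdeg_P0 s_def)
    have "spec B' \<le> 1" by (rule spec_le_1[OF B'(1)]) (simp add: B'(2))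
    then have "int (ell F B') \<le> int g - ?\<gamma> + 1" by (simp add: spec_def B'(2))
    moreover have "ell F ?B \<le> ell F B'" using s by (intro ell_mono[OF B B'(1)]) (simp add: B'_def pt_def)
    ultimately have "int (vdim F (past n C i)) \<le> int g - ?\<gamma> + 1" using vdim_past[OF \<open>i \<le> n\<close>] by simp
    then show ?thesis using future \<open>i \<le> n\<close> by (intro exI[of _ i]) simp
  qed
qed

text \<open>The minimum over all cuts is at most the value at the small cut. The truncated
  subtraction in \<open>state_cplx\<close> can only increase the left side.\<close>

lemma state_cplx_ge: "int (state_cplx F n C) \<ge> int (vdim F C) - int g + gonality F - 2"
proof -
  obtain i where i: "i \<le> n" "int (vdim F (past n C i) + vdim F (future n C i)) \<le> int g - gonality F + 2"
    using small_cut by blast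
  let ?S = "{vdim F (past n C i) + vdim F (future n C i) | i. i \<le> n}"
  have "?S = (\<lambda>i. vdim F (past n C i) + vdim F (future n C i)) ` {..n}" by auto
  then have "finite ?S" by simp
  then have "Min ?S \<le> vdim F (past n C i) + vdim F (future n C i)" by (rule Min_le) (use i in blast)
  then show ?thesis using i(2) unfolding state_cplx_def by linarith
qed

end

end

text \<open>Permuting coordinates only reorders the evaluation points, so the bound for a fixed
  order applies to every permuted code.\<close>

lemma perm_AG_code:
  assumes "\<sigma> permutes {..<n}"
  shows "perm_code \<sigma> (AG_code F n Ps G) = AG_code F n (Ps \<circ> \<sigma>) G"
proof -
  have "(\<lambda>i. if i < n then evalp F (Ps i) f else 0) \<circ> \<sigma> = (\<lambda>i. if i < n then evalp F ((Ps \<circ> \<sigma>) i) f else 0)" for f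
    using permutes_in_image[OF assms] by (auto simp: fun_eq_iff)
  then show ?thesis unfolding perm_code_def AG_code_def Setcompr_eq_image Collect_mem_eq image_image
    by (simp only:)
qed

theorem theorem3p12:
  fixes F :: "'k::field set" and n k g :: nat
    and Ps :: "nat \<Rightarrow> 'k set" and G :: "'k set \<Rightarrow> int"
  assumes "finite F"
    and "function_field F"
    and "is_genus F g"
    and "\<forall>i<n. rational_place F (Ps i)"
    and "\<forall>i<n. \<forall>j<n. i \<noteq> j \<longrightarrow> Ps i \<noteq> Ps j"
    and "divisor F G"
    and "\<forall>i<n. G (Ps i) = 0"
    and "vdim F (AG_code F n Ps G) = k"
    and "2 * k \<le> n"
    and "n > 2 * g"
  shows "int (min_state_cplx F n (AG_code F n Ps G))
           \<ge> int (min k (n - k)) - int g + gonality F - 2"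
proof -
  have "subfield F" using assms(2) by (simp add: function_field_def)
  \<comment> \<open>\<open>n > 2 * g\<close> makes \<open>n\<close> positive, so \<open>Ps 0\<close>
    is a rational place.\<close>
  then interpret curve F g "Ps 0" using assms by unfold_locales auto
  have AG: "AG F g (Ps 0) n (Ps \<circ> \<sigma>) G" if \<sigma>: "\<sigma> permutes {..<n}" for \<sigma>
  proof unfold_locales
    have lt: "\<sigma> i < n" if "i < n" for i using permutes_in_image[OF \<sigma>, of i] that by simp
    show "rational_place F ((Ps \<circ> \<sigma>) i)" "G ((Ps \<circ> \<sigma>) i) = 0" if "i < n" for i
      using assms(4,7) lt[OF that] by auto
    have "inj_on Ps (\<sigma> ` {..<n})" using assms(5) permutes_image[OF \<sigma>] by (auto simp: inj_on_def)
    then show "inj_on (Ps \<circ> \<sigma>) {..<n}" using inj_on_subset[OF permutes_inj[OF \<sigma>]] by (intro comp_inj_on) auto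
  qed (rule assms)
  have bound: "int (state_cplx F n (perm_code \<sigma> (AG_code F n Ps G))) \<ge> int k - int g + gonality F - 2"
    if \<sigma>: "\<sigma> permutes {..<n}" for \<sigma>
  proof -
    interpret A: AG F g "Ps 0" n "Ps \<circ> \<sigma>" G by (rule AG[OF \<sigma>])
    interpret A0: AG F g "Ps 0" n Ps G using AG[OF permutes_id] by simp
    have "inj_on (\<lambda>c. c \<circ> \<sigma>) (AG_code F n Ps G)"
      using permutes_surj[OF \<sigma>] by (auto simp: inj_on_def surj_fun_eq)
    then have "card (AG_code F n (Ps \<circ> \<sigma>) G) = card (AG_code F n Ps G)"
      unfolding perm_AG_code[OF \<sigma>, symmetric] perm_code_def by (rule card_image)
    \<comment> \<open>Both dimensions are logarithms of the same cardinality.\<close>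
    then have "vdim F (AG_code F n (Ps \<circ> \<sigma>) G) = k" using A.card_C(2) A0.card_C(2) assms(8) by simp
    then show ?thesis using A.state_cplx_ge assms(9,10) unfolding perm_AG_code[OF \<sigma>] by simp
  qed
  let ?S = "{state_cplx F n (perm_code \<sigma> (AG_code F n Ps G)) | \<sigma>. \<sigma> permutes {..<n}}"
  have eq: "?S = (\<lambda>\<sigma>. state_cplx F n (perm_code \<sigma> (AG_code F n Ps G))) ` {\<sigma>. \<sigma> permutes {..<n}}" by auto
  have "finite ?S" unfolding eq by (simp add: finite_permutations)
  moreover have "?S \<noteq> {}" using permutes_id[of "{..<n}"] by blast
  ultimately have "Min ?S \<in> ?S" by (rule Min_in)
  then obtain \<sigma> where \<sigma>: "\<sigma> permutes {..<n}" "Min ?S = state_cplx F n (perm_code \<sigma> (AG_code F n Ps G))" by auto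
  have "int (min_state_cplx F n (AG_code F n Ps G)) \<ge> int k - int g + gonality F - 2"
    unfolding min_state_cplx_def \<sigma>(2) by (rule bound[OF \<sigma>(1)])
  \<comment> \<open>The bound for \<open>k\<close> suffices because the minimum is at most
    \<open>k\<close>.\<close>
  then show ?thesis by linarith
qed

end
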